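(* Let $M$ be an oriented smooth 4-manifold with boundary, $\jmath:\partial M\hookrightarrow M$ the inclusion, and $(\alpha_1,\dots,\alpha_5)\in\mathbb{R}^5$. For $e^i\in\Omega^1(M,\mathfrak{so}(3))$ and an $SO(3)$-connection $A^i\in\Omega^1(M,\mathfrak{so}(3))$ with curvature $F^i$ and covariant derivative $D$, consider the action $$S(e,A)=\int_M\Big(\alpha_1\epsilon_{ijk}e^i\wedge e^j\wedge F^k+\alpha_2De_i\wedge De^i+\alpha_3F_i\wedge F^i+\alpha_4\epsilon_{ijk}De^i\wedge e^j\wedge e^k+\alpha_5F_i\wedge De^i\Big).$$ (1) $(e,A)$ is a stationary point of $S$ if and only if $$(\alpha_1-\alpha_2)\epsilon_{ijk}e^j\wedge F^k=0,\qquad(\alpha_1-\alpha_2)\epsilon_{ijk}De^j\wedge e^k=0\quad\text{on }M,$$ $$\jmath^*\big(2\alpha_2De_i+\alpha_4\epsilon_{ijk}e^j\wedge e^k+\alpha_5F_i\big)=0,\qquad \jmath^*\big(\alpha_1\epsilon_{ijk}e^j\wedge e^k+2\alpha_3F_i+\alpha_5De_i\big)=0\quad\text{on }\partial M.$$ (2) If $4\alpha_2\alpha_3-\alpha_5^2\neq0$, the two boundary equations are equivalent to $$\jmath^*(F_i)=\jmath^*\Big(-\tfrac{2\alpha_1\alpha_2-\alpha_4\alpha_5}{4\alpha_2\alpha_3-\alpha_5^2}\epsilon_{ijk}e^j\wedge e^k\Big),\qquad \jmath^*(De_i)=\jmath^*\Big(-\tfrac{2\alpha_3\alpha_4-\alpha_1\alpha_5}{4\alpha_2\alpha_3-\alpha_5^2}\epsilon_{ijk}e^j\wedge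 e^k\Big).$$ (3) If moreover $2\alpha_3\alpha_4-\alpha_1\alpha_5=0$, these are the field equations of 3-dimensional Euclidean general relativity on $\partial M$, $\jmath^*(De_i)=0$ and $\jmath^*\big(F_i+\frac{\Lambda}{2}\epsilon_{ijk}e^j\wedge e^k\big)=0$, with cosmological constant $$\Lambda=\frac{4\alpha_1\alpha_2-2\alpha_4\alpha_5}{4\alpha_2\alpha_3-\alpha_5^2}.$$ Every $\Lambda\in\mathbb{R}$ arises in this way for some choice of parameters with $\alpha_1\neq\alpha_2$.
   Context: Indices $i,j,k\in\{1,2,3\}$ are $\mathfrak{so}(3)\cong\mathbb{R}^3$ indices, raised and lowered with $\delta_{ij}$; $\epsilon_{ijk}$ is the Levi-Civita symbol; repeated indices are summed. $F^i=\mathrm{d}A^i+\frac12\epsilon^i{}_{jk}A^j\wedge A^k$, and for an $\mathfrak{so}(3)$-valued form $\phi^i$, $D\phi^i=\mathrm{d}\phi^i+\epsilon^i{}_{jk}A^j\wedge\phi^k$. All fields are smooth. A configuration is a stationary point of an action $\int_M\mathcal{L}$ if the first variation $\int_M\delta\mathcal{L}$ vanishes for all smooth compactly supported variations of $e$ and $A$, not required to vanish on $\partial M$. *)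

theory Defs
  imports "HOL-Analysis.Analysis"
begin

section \<open>Smooth maps on subsets of Euclidean space\<close>

fun ck_on :: "nat \<Rightarrow> 'a::euclidean_space set \<Rightarrow> ('a \<Rightarrow> 'b::real_normed_vector) \<Rightarrow> bool" where
  "ck_on 0 W g \<longleftrightarrow> continuous_on W g"
| "ck_on (Suc k) W g \<longleftrightarrow>
     (\<forall>x\<in>W. g differentiable (at x)) \<and>
     (\<forall>v. ck_on k W (\<lambda>x. frechet_derivative g (at x) v))"

text \<open>On a set that need not be open, such as a relatively open subset of a half-space, smoothness
  means having a smooth extension to a neighbourhood of each point.\<close>

definition smooth_on :: "'a::euclidean_space set \<Rightarrow> ('a \<Rightarrow> 'b::real_normed_vector) \<Rightarrow> bool" where
  "smooth_on S f \<longleftrightarrow>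
     (\<forall>x\<in>S. \<exists>W g. open W \<and> x \<in> W \<and> (\<forall>k. ck_on k W g) \<and> (\<forall>y\<in>W \<inter> S. g y = f y))"

section \<open>Oriented smooth 4-manifolds with boundary\<close>

definition half_space :: "(real^4) set" where
  "half_space = {x. 0 \<le> x $ 1}"

type_synonym 'm chart = "'m set \<times> ('m \<Rightarrow> real^4)"

abbreviation chart_dom :: "'m chart \<Rightarrow> 'm set" where
  "chart_dom c \<equiv> fst c"

abbreviation chart_img :: "'m chart \<Rightarrow> (real^4) set" where
  "chart_img c \<equiv> snd c ` fst c"

definition chart_inv :: "'m chart \<Rightarrow> real^4 \<Rightarrow> 'm" where
  "chart_inv c = inv_into (fst c) (snd c)"

definition is_chart :: "'m::topological_space chart \<Rightarrow> bool" where
  "is_chart c \<longleftrightarrow>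
     open (chart_dom c) \<and>
     openin (top_of_set half_space) (chart_img c) \<and>
     homeomorphism (chart_dom c) (chart_img c) (snd c) (chart_inv c)"

definition transition :: "'m chart \<Rightarrow> 'm chart \<Rightarrow> real^4 \<Rightarrow> real^4" where
  "transition c c' = snd c' \<circ> chart_inv c"

text \<open>The image in the first chart of the overlap of two charts.\<close>

definition overlap :: "'m chart \<Rightarrow> 'm chart \<Rightarrow> (real^4) set" where
  "overlap c c' = snd c ` (chart_dom c \<inter> chart_dom c')"

text \<open>The manifold is the whole (Hausdorff, second countable) space \<open>'m\<close>; its smooth structure and
  its orientation are both given by an atlas whose transition maps have positive Jacobian.
  Derivatives at boundary points are taken within the half-space, where they are unique.\<close>

definition oriented_smooth_manifold ::
  "'m::{t2_space, second_countable_topology} chart set \<Rightarrow> bool" where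
  "oriented_smooth_manifold \<A> \<longleftrightarrow>
     (\<forall>c\<in>\<A>. is_chart c) \<and>
     (\<Union>c\<in>\<A>. chart_dom c) = UNIV \<and>
     (\<forall>c\<in>\<A>. \<forall>c'\<in>\<A>. smooth_on (overlap c c') (transition c c')) \<and>
     (\<forall>c\<in>\<A>. \<forall>c'\<in>\<A>. \<forall>x\<in>overlap c c'.
        0 < det (matrix (frechet_derivative (transition c c') (at x within half_space))))"

definition smooth_function :: "'m chart set \<Rightarrow> ('m \<Rightarrow> real) \<Rightarrow> bool" where
  "smooth_function \<A> \<rho> \<longleftrightarrow> (\<forall>c\<in>\<A>. smooth_on (chart_img c) (\<rho> \<circ> chart_inv c))"

section \<open>Alternating forms\<close>

text \<open>An alternating \<open>k\<close>-form is evaluated on a sequence of vectors, of which it only uses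
  the first \<open>k\<close>.\<close>

definition alternating :: "nat \<Rightarrow> ((nat \<Rightarrow> real^'n) \<Rightarrow> real) \<Rightarrow> bool" where
  "alternating k f \<longleftrightarrow>
     (\<forall>vs ws. (\<forall>i<k. vs i = ws i) \<longrightarrow> f vs = f ws) \<and>
     (\<forall>vs. \<forall>i<k. linear (\<lambda>v. f (vs(i := v)))) \<and>
     (\<forall>vs. \<forall>i<k. \<forall>j<k. i \<noteq> j \<and> vs i = vs j \<longrightarrow> f vs = 0)"

definition alt_wedge :: "nat \<Rightarrow> nat \<Rightarrow> ((nat \<Rightarrow> real^'n) \<Rightarrow> real) \<Rightarrow> ((nat \<Rightarrow> real^'n) \<Rightarrow> real) \<Rightarrow>
    (nat \<Rightarrow> real^'n) \<Rightarrow> real" where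
  "alt_wedge p q f g vs =
     (\<Sum>\<sigma> | \<sigma> permutes {..<p + q}.
        of_int (sign \<sigma>) * f (\<lambda>i. vs (\<sigma> i)) * g (\<lambda>i. vs (\<sigma> (p + i)))) / (fact p * fact q)"

definition pullback :: "(real^'n) set \<Rightarrow> (real^'n \<Rightarrow> real^'k) \<Rightarrow>
    (real^'k \<Rightarrow> (nat \<Rightarrow> real^'k) \<Rightarrow> real) \<Rightarrow> real^'n \<Rightarrow> (nat \<Rightarrow> real^'n) \<Rightarrow> real" where
  "pullback S f w x vs = w (f x) (\<lambda>i. frechet_derivative f (at x within S) (vs i))"

section \<open>Differential forms on the manifold\<close>

text \<open>As in Bott and Tu, a form on a manifold is a family of forms on the chart images, one for
  each chart of the atlas, compatible under pullback along the transition maps.  The values of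
  such a family off the chart images are irrelevant.  With \<open>'n = 4\<close> these are forms on \<open>M\<close>;
  with \<open>'n = 3\<close> they are forms on \<open>\<partial>M\<close>, represented in the charts of \<open>\<partial>M\<close> that arise by
  restricting those of \<open>M\<close>.\<close>

type_synonym ('m, 'n) form = "'m chart \<Rightarrow> real^'n \<Rightarrow> (nat \<Rightarrow> real^'n) \<Rightarrow> real"

definition smooth_form :: "'m chart set \<Rightarrow> nat \<Rightarrow> ('m, 4) form \<Rightarrow> bool" where
  "smooth_form \<A> k \<omega> \<longleftrightarrow>
     (\<forall>c\<in>\<A>. \<forall>x\<in>chart_img c. alternating k (\<omega> c x)) \<and>
     (\<forall>c\<in>\<A>. \<forall>vs. smooth_on (chart_img c) (\<lambda>x. \<omega> c x vs)) \<and>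
     (\<forall>c\<in>\<A>. \<forall>c'\<in>\<A>. \<forall>x\<in>overlap c c'.
        \<omega> c x = pullback half_space (transition c c') (\<omega> c') x)"

definition wedge :: "nat \<Rightarrow> nat \<Rightarrow> ('m, 'n::finite) form \<Rightarrow> ('m, 'n) form \<Rightarrow> ('m, 'n) form" where
  "wedge p q \<omega> \<eta> = (\<lambda>c x. alt_wedge p q (\<omega> c x) (\<eta> c x))"

definition ext_deriv :: "nat \<Rightarrow> ('m, 4) form \<Rightarrow> ('m, 4) form" where
  "ext_deriv k \<omega> = (\<lambda>c x vs. \<Sum>i\<le>k. (-1) ^ i *
     frechet_derivative (\<lambda>y. \<omega> c y (\<lambda>j. if j < i then vs j else vs (Suc j)))
       (at x within half_space) (vs i))"

definition zero_form :: "('m, 'n) form" where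
  "zero_form = (\<lambda>c x vs. 0)"

definition eq_on_M :: "'m chart set \<Rightarrow> ('m, 4) form \<Rightarrow> ('m, 4) form \<Rightarrow> bool" where
  "eq_on_M \<A> \<omega> \<eta> \<longleftrightarrow> (\<forall>c\<in>\<A>. \<forall>x\<in>chart_img c. \<omega> c x = \<eta> c x)"

text \<open>The inclusion \<open>\<partial>M \<rightarrow> M\<close>, read in a chart of \<open>M\<close> and the induced chart of \<open>\<partial>M\<close>.\<close>

definition bd_incl :: "real^3 \<Rightarrow> real^4" where
  "bd_incl y = (\<chi> i. if i = 2 then y $ 1 else if i = 3 then y $ 2 else if i = 4 then y $ 3 else 0)"

definition bd_pullback :: "('m, 4) form \<Rightarrow> ('m, 3) form" where
  "bd_pullback \<omega> = (\<lambda>c. pullback UNIV bd_incl (\<omega> c))"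

definition eq_on_boundary :: "'m chart set \<Rightarrow> ('m, 3) form \<Rightarrow> ('m, 3) form \<Rightarrow> bool" where
  "eq_on_boundary \<A> \<omega> \<eta> \<longleftrightarrow> (\<forall>c\<in>\<A>. \<forall>y. bd_incl y \<in> chart_img c \<longrightarrow> \<omega> c y = \<eta> c y)"

section \<open>Integration of compactly supported 4-forms\<close>

definition vanishes_off :: "'m chart set \<Rightarrow> 'm set \<Rightarrow> ('m, 4) form \<Rightarrow> bool" where
  "vanishes_off \<A> K \<omega> \<longleftrightarrow> (\<forall>c\<in>\<A>. \<forall>p\<in>chart_dom c - K. \<forall>vs. \<omega> c (snd c p) vs = 0)"

text \<open>The support may meet the boundary.\<close>

definition compactly_supported :: "'m::topological_space chart set \<Rightarrow> ('m, 4) form \<Rightarrow> bool" where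
  "compactly_supported \<A> \<omega> \<longleftrightarrow> (\<exists>K. compact K \<and> vanishes_off \<A> K \<omega>)"

definition chart_integral :: "'m chart \<Rightarrow> ('m \<Rightarrow> real) \<Rightarrow> ('m, 4) form \<Rightarrow> real" where
  "chart_integral c \<rho> \<omega> =
     integral (chart_img c)
       (\<lambda>x. \<rho> (chart_inv c x) * \<omega> c x ((!) [axis 1 1, axis 2 1, axis 3 1, axis 4 1]))"

text \<open>Integration through a finite smooth partition of unity over a compact set \<open>K\<close> carrying the
  form, subordinate to the oriented atlas; the value does not depend on the choices.\<close>

definition has_form_integral ::
  "'m::topological_space chart set \<Rightarrow> ('m, 4) form \<Rightarrow> real \<Rightarrow> bool" where
  "has_form_integral \<A> \<omega> I \<longleftrightarrow>
     (\<exists>K (n::nat) c \<rho>.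
        compact K \<and> vanishes_off \<A> K \<omega> \<and>
        (\<forall>i<n. c i \<in> \<A> \<and> smooth_function \<A> (\<rho> i) \<and> (\<forall>p. 0 \<le> \<rho> i p) \<and>
               (\<exists>C. compact C \<and> C \<subseteq> chart_dom (c i) \<and> (\<forall>p. p \<notin> C \<longrightarrow> \<rho> i p = 0))) \<and>
        (\<forall>p\<in>K. (\<Sum>i<n. \<rho> i p) = 1) \<and>
        I = (\<Sum>i<n. chart_integral (c i) (\<rho> i) \<omega>))"

definition form_integral :: "'m::topological_space chart set \<Rightarrow> ('m, 4) form \<Rightarrow> real" where
  "form_integral \<A> \<omega> = (THE I. has_form_integral \<A> \<omega> I)"

section \<open>The gauge fields, the Lagrangian and its first variation\<close>

definition levi_civita :: "3 \<Rightarrow> 3 \<Rightarrow> 3 \<Rightarrow> real" where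
  "levi_civita i j k =
     (if (i, j, k) \<in> {(1, 2, 3), (2, 3, 1), (3, 1, 2)} then 1
      else if (i, j, k) \<in> {(1, 3, 2), (2, 1, 3), (3, 2, 1)} then - 1
      else 0)"

text \<open>\<open>so(3)\<close>-valued forms are given by their three components; indices are raised
  and lowered with the Kronecker delta, so their position is not recorded.\<close>

type_synonym 'm so3_form = "3 \<Rightarrow> ('m, 4) form"

text \<open>\<open>cross p q \<phi> \<psi> i\<close> is \<open>\<epsilon>\<^sub>i\<^sub>j\<^sub>k \<phi>\<^sup>j \<and> \<psi>\<^sup>k\<close>.\<close>

definition cross :: "nat \<Rightarrow> nat \<Rightarrow> 'm so3_form \<Rightarrow> 'm so3_form \<Rightarrow> 'm so3_form" where
  "cross p q \<phi> \<psi> i = (\<lambda>c x vs. \<Sum>j\<in>UNIV. \<Sum>k\<in>UNIV.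
     levi_civita i j k * wedge p q (\<phi> j) (\<psi> k) c x vs)"

definition curvature :: "'m so3_form \<Rightarrow> 'm so3_form" where
  "curvature A i = (\<lambda>c x vs. ext_deriv 1 (A i) c x vs + 1/2 * cross 1 1 A A i c x vs)"

definition cov_deriv :: "'m so3_form \<Rightarrow> nat \<Rightarrow> 'm so3_form \<Rightarrow> 'm so3_form" where
  "cov_deriv A k \<phi> i = (\<lambda>c x vs. ext_deriv k (\<phi> i) c x vs + cross 1 k A \<phi> i c x vs)"

definition lagrangian :: "real \<Rightarrow> real \<Rightarrow> real \<Rightarrow> real \<Rightarrow> real \<Rightarrow> 'm so3_form \<Rightarrow> 'm so3_form \<Rightarrow>
    ('m, 4) form" where
  "lagrangian \<alpha>1 \<alpha>2 \<alpha>3 \<alpha>4 \<alpha>5 e A =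
     (let F = curvature A; De = cov_deriv A 1 e in
      (\<lambda>c x vs.
         \<alpha>1 * (\<Sum>i\<in>UNIV. \<Sum>j\<in>UNIV. \<Sum>k\<in>UNIV.
           levi_civita i j k * wedge 2 2 (wedge 1 1 (e i) (e j)) (F k) c x vs)
       + \<alpha>2 * (\<Sum>i\<in>UNIV. wedge 2 2 (De i) (De i) c x vs)
       + \<alpha>3 * (\<Sum>i\<in>UNIV. wedge 2 2 (F i) (F i) c x vs)
       + \<alpha>4 * (\<Sum>i\<in>UNIV. \<Sum>j\<in>UNIV. \<Sum>k\<in>UNIV.
           levi_civita i j k * wedge 3 1 (wedge 2 1 (De i) (e j)) (e k) c x vs)
       + \<alpha>5 * (\<Sum>i\<in>UNIV. wedge 2 2 (F i) (De i) c x vs)))"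

definition add_scaled :: "'m so3_form \<Rightarrow> real \<Rightarrow> 'm so3_form \<Rightarrow> 'm so3_form" where
  "add_scaled \<phi> t \<psi> i = (\<lambda>c x vs. \<phi> i c x vs + t * \<psi> i c x vs)"

definition first_variation :: "('m so3_form \<Rightarrow> 'm so3_form \<Rightarrow> ('m, 4) form) \<Rightarrow>
    'm so3_form \<Rightarrow> 'm so3_form \<Rightarrow> 'm so3_form \<Rightarrow> 'm so3_form \<Rightarrow> ('m, 4) form" where
  "first_variation L e A \<delta>e \<delta>A =
     (\<lambda>c x vs. deriv (\<lambda>t::real. L (add_scaled e t \<delta>e) (add_scaled A t \<delta>A) c x vs) 0)"

text \<open>The integral of the Lagrangian itself need not converge; as usual only the integral of its
  first variation enters.\<close>

definition stationary_point :: "'m::topological_space chart set \<Rightarrow>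
    ('m so3_form \<Rightarrow> 'm so3_form \<Rightarrow> ('m, 4) form) \<Rightarrow> 'm so3_form \<Rightarrow> 'm so3_form \<Rightarrow> bool" where
  "stationary_point \<A> L e A \<longleftrightarrow>
     (\<forall>\<delta>e \<delta>A.
        (\<forall>i. smooth_form \<A> 1 (\<delta>e i) \<and> compactly_supported \<A> (\<delta>e i)) \<and>
        (\<forall>i. smooth_form \<A> 1 (\<delta>A i) \<and> compactly_supported \<A> (\<delta>A i)) \<longrightarrow>
        form_integral \<A> (first_variation L e A \<delta>e \<delta>A) = 0)"

section \<open>Field equations\<close>

definition bulk_equations :: "'m chart set \<Rightarrow> real \<Rightarrow> real \<Rightarrow>
    'm so3_form \<Rightarrow> 'm so3_form \<Rightarrow> bool" where
  "bulk_equations \<A> \<alpha>1 \<alpha>2 e A \<longleftrightarrow>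
     (let F = curvature A; De = cov_deriv A 1 e in
      \<forall>i. eq_on_M \<A> (\<lambda>c x vs. (\<alpha>1 - \<alpha>2) * cross 1 2 e F i c x vs) zero_form \<and>
          eq_on_M \<A> (\<lambda>c x vs. (\<alpha>1 - \<alpha>2) * cross 2 1 De e i c x vs) zero_form)"

definition boundary_equations :: "'m chart set \<Rightarrow> real \<Rightarrow> real \<Rightarrow> real \<Rightarrow> real \<Rightarrow> real \<Rightarrow>
    'm so3_form \<Rightarrow> 'm so3_form \<Rightarrow> bool" where
  "boundary_equations \<A> \<alpha>1 \<alpha>2 \<alpha>3 \<alpha>4 \<alpha>5 e A \<longleftrightarrow>
     (let F = curvature A; De = cov_deriv A 1 e in
      \<forall>i. eq_on_boundary \<A>
            (bd_pullback (\<lambda>c x vs. 2 * \<alpha>2 * De i c x vs + \<alpha>4 * cross 1 1 e e i c x vs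
               + \<alpha>5 * F i c x vs))
            zero_form \<and>
          eq_on_boundary \<A>
            (bd_pullback (\<lambda>c x vs. \<alpha>1 * cross 1 1 e e i c x vs + 2 * \<alpha>3 * F i c x vs
               + \<alpha>5 * De i c x vs))
            zero_form)"

definition gr3_equations :: "'m chart set \<Rightarrow> real \<Rightarrow> 'm so3_form \<Rightarrow> 'm so3_form \<Rightarrow> bool" where
  "gr3_equations \<A> \<Lambda> e A \<longleftrightarrow>
     (\<forall>i. eq_on_boundary \<A> (bd_pullback (cov_deriv A 1 e i)) zero_form \<and>
          eq_on_boundary \<A>
            (bd_pullback (\<lambda>c x vs. curvature A i c x vs + \<Lambda> / 2 * cross 1 1 e e i c x vs))
            zero_form)"

end

theory Submission
  imports Defs
begin

text \<open>By the Bianchi identities \<open>DF = 0\<close>, \<open>D(De) = F \<times> e\<close> and \<open>D(e \<times> e) = 2 De \<times> e\<close>, the first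
  variation of the Lagrangian is a pairing of the variations with the field equations plus the exterior
  derivative of a 3-form \<open>\<theta>\<close> which is algebraic in the variations. A partition of unity reduces the
  condition to variations supported in one chart, where Stokes' theorem turns \<open>d\<theta>\<close> into the integral of
  \<open>\<theta>\<close> over the boundary hyperplane. The normal derivative is integrated as a limit of translation
  difference quotients: translation invariance leaves only a layer of thickness \<open>h\<close> at the boundary, so
  that Fubini is not needed. Conversely, test variations with one nonzero component, a bump function,
  give the bulk equations in the interior, hence everywhere by continuity, and then, with the bulk
  terms gone, the boundary equations.\<close>

section \<open>Calculus of smooth maps\<close>

text \<open>Why only \<alpha>1 - \<alpha>2 survives in the bulk: De_i \<and> De^i equals an exact
  form minus \<epsilon>_ijk e^i \<and> e^j \<and> F^k, while the \<alpha>3, \<alpha>4 and \<alpha>5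
  terms are exact, with primitives the Chern-Simons form, one third of \<epsilon>_ijk e^i \<and> e^j
  \<and> e^k, and F_i \<and> e^i. Those parameters can act only through the boundary. The boundary
  integral itself is not formed. Two facts about the half-space integral of a normal derivative
  replace it: it is 0 if the function vanishes on the boundary hyperplane, and negative if the
  function is nonnegative and somewhere positive there. Each direction of the equivalence uses one
  of them. The integral of a 4-form is a definite description, so nothing can be evaluated before
  independence of charts and partitions is known. This is where orientation and the determinant law
  for 4-forms enter. By contrast d\<theta> is used in one chart at a time, so only the exterior
  derivative of 1-forms has to be compatible with transition maps.\<close>

lemma ck_on_cong:
  assumes "open W" "\<And>x. x \<in> W \<Longrightarrow> f x = g x" "ck_on k W f"
  shows "ck_on k W g"
  using assms(2,3)
proof (induction k arbitrary: f g)
  case 0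
  then show ?case by (metis ck_on.simps(1) continuous_on_cong)
next
  case (Suc k)
  have "g differentiable (at x)" if "x \<in> W" for x
  proof -
    have "(f has_derivative frechet_derivative f (at x)) (at x)"
      using Suc.prems that frechet_derivative_works by auto
    then have "(g has_derivative frechet_derivative f (at x)) (at x)"
      using has_derivative_transform_within_open[OF _ \<open>open W\<close> that] Suc.prems(1) by blast
    then show ?thesis by (rule differentiableI)
  qed
  moreover have "ck_on k W (\<lambda>x. frechet_derivative g (at x) v)" for v
  proof (rule Suc.IH)
    show "ck_on k W (\<lambda>x. frechet_derivative f (at x) v)" using Suc.prems by simp
    show "frechet_derivative f (at x) v = frechet_derivative g (at x) v" if "x \<in> W" for x
      using frechet_derivative_transform_within_open[OF _ \<open>open W\<close> that, of f g] Suc.prems that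
      by simp
  qed
  ultimately show ?case by simp
qed

lemma ck_on_subset: "ck_on k W f \<Longrightarrow> V \<subseteq> W \<Longrightarrow> ck_on k V f"
proof (induction k arbitrary: f)
  case 0
  then show ?case using continuous_on_subset by auto
qed auto

lemma ck_on_SucD: "ck_on (Suc k) W f \<Longrightarrow> ck_on k W f"
proof (induction k arbitrary: f)
  case 0
  then show ?case
    by (auto intro!: continuous_at_imp_continuous_on differentiable_imp_continuous_within)
next
  case (Suc k)
  then show ?case by (metis ck_on.simps(2))
qed

text \<open>Derivatives on an open set are unique, so any explicit formula may be supplied. The
  closure lemmas below therefore need not compute \<open>frechet_derivative\<close> of a compound
  expression.\<close>

lemma ck_on_SucI:
  assumes "open W" "\<And>x. x \<in> W \<Longrightarrow> (f has_derivative f' x) (at x)"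
    and "\<And>v. ck_on k W (\<lambda>x. f' x v)"
  shows "ck_on (Suc k) W f"
proof -
  have eq: "f' x = frechet_derivative f (at x)" if "x \<in> W" for x
    using assms(2)[OF that] by (rule frechet_derivative_at)
  have "ck_on k W (\<lambda>x. frechet_derivative f (at x) v)" for v
    by (rule ck_on_cong[OF \<open>open W\<close> _ assms(3)[of v]]) (simp add: eq)
  then show ?thesis using assms(2) by (auto intro: differentiableI)
qed

lemma ck_on_Suc_has_derivative:
  "ck_on (Suc k) W f \<Longrightarrow> x \<in> W \<Longrightarrow> (f has_derivative frechet_derivative f (at x)) (at x)"
  using frechet_derivative_works by auto

lemma ck_on_Suc_deriv: "ck_on (Suc k) W f \<Longrightarrow> ck_on k W (\<lambda>x. frechet_derivative f (at x) v)"
  by simp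

declare ck_on.simps(2) [simp del]

lemma ck_on_const: "open W \<Longrightarrow> ck_on k W (\<lambda>x. c)"
proof (induction k arbitrary: c)
  case (Suc k)
  show ?case by (rule ck_on_SucI[where f' = "\<lambda>x v. 0"]) (use Suc in auto)
qed auto

lemma ck_on_bounded_linear_compose:
  assumes "open W" "bounded_linear L" "ck_on k W f"
  shows "ck_on k W (\<lambda>x. L (f x))"
  using assms(3)
proof (induction k arbitrary: f)
  case 0
  then show ?case
    unfolding ck_on.simps by (rule bounded_linear.continuous_on[OF assms(2)])
next
  case (Suc k)
  show ?case
  proof (rule ck_on_SucI[where f' = "\<lambda>x v. L (frechet_derivative f (at x) v)"])
    show "((\<lambda>x. L (f x)) has_derivative (\<lambda>v. L (frechet_derivative f (at x) v))) (at x)"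
      if "x \<in> W" for x
      by (rule bounded_linear.has_derivative[OF assms(2) ck_on_Suc_has_derivative[OF Suc.prems that]])
    show "ck_on k W (\<lambda>x. L (frechet_derivative f (at x) v))" for v
      by (rule Suc.IH[OF ck_on_Suc_deriv[OF Suc.prems]])
  qed (rule assms(1))
qed

lemma ck_on_bounded_linear:
  assumes "open W" "bounded_linear L"
  shows "ck_on k W L"
proof (cases k)
  case (Suc m)
  show ?thesis unfolding Suc
    by (rule ck_on_SucI[where f' = "\<lambda>x. L"])
      (use assms bounded_linear_imp_has_derivative ck_on_const in auto)
qed (use assms linear_continuous_on in auto)

lemma ck_on_add:
  assumes "open W" "ck_on k W f" "ck_on k W g"
  shows "ck_on k W (\<lambda>x. f x + g x)"
  using assms(2,3)
proof (induction k arbitrary: f g)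
  case 0
  then show ?case unfolding ck_on.simps by (rule continuous_on_add)
next
  case (Suc k)
  show ?case
  proof (rule ck_on_SucI[OF assms(1)])
    show "((\<lambda>x. f x + g x) has_derivative
        (\<lambda>v. frechet_derivative f (at x) v + frechet_derivative g (at x) v)) (at x)" if "x \<in> W" for x
      by (rule has_derivative_add[OF ck_on_Suc_has_derivative[OF Suc.prems(1) that]
            ck_on_Suc_has_derivative[OF Suc.prems(2) that]])
    show "ck_on k W (\<lambda>x. frechet_derivative f (at x) v + frechet_derivative g (at x) v)" for v
      by (rule Suc.IH[OF ck_on_Suc_deriv[OF Suc.prems(1)] ck_on_Suc_deriv[OF Suc.prems(2)]])
  qed
qed

lemma ck_on_sum:
  assumes "open W" "\<And>i. i \<in> I \<Longrightarrow> ck_on k W (f i)"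
  shows "ck_on k W (\<lambda>x. \<Sum>i\<in>I. f i x)"
  using assms(2)
  by (induction I rule: infinite_finite_induct) (auto intro: ck_on_const ck_on_add assms(1))

lemma ck_on_scaleR:
  assumes "open W" "ck_on k W f" "ck_on k W g"
  shows "ck_on k W (\<lambda>x. f x *\<^sub>R g x)"
  using assms(2,3)
proof (induction k arbitrary: f g)
  case 0
  then show ?case unfolding ck_on.simps by (rule continuous_on_scaleR)
next
  case (Suc k)
  have f: "ck_on k W f" "\<And>v. ck_on k W (\<lambda>x. frechet_derivative f (at x) v)"
    and g: "ck_on k W g" "\<And>v. ck_on k W (\<lambda>x. frechet_derivative g (at x) v)"
    using Suc.prems by (auto intro: ck_on_SucD ck_on_Suc_deriv)
  show ?case
  proof (rule ck_on_SucI[OF assms(1)])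
    show "((\<lambda>x. f x *\<^sub>R g x) has_derivative (\<lambda>v. f x *\<^sub>R frechet_derivative g (at x) v
          + frechet_derivative f (at x) v *\<^sub>R g x)) (at x)" if "x \<in> W" for x
      by (rule has_derivative_scaleR[OF ck_on_Suc_has_derivative[OF Suc.prems(1) that]
            ck_on_Suc_has_derivative[OF Suc.prems(2) that]])
    show "ck_on k W (\<lambda>x. f x *\<^sub>R frechet_derivative g (at x) v + frechet_derivative f (at x) v *\<^sub>R g x)" for v
      by (intro ck_on_add Suc.IH assms(1) f g)
  qed
qed

lemma ck_on_mult:
  fixes f g :: "_ \<Rightarrow> real"
  shows "open W \<Longrightarrow> ck_on k W f \<Longrightarrow> ck_on k W g \<Longrightarrow> ck_on k W (\<lambda>x. f x * g x)"
  using ck_on_scaleR[of W k f g] by simp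

text \<open>The derivative of 1/f is a product of f' with two factors 1/f, and these have already
  been treated at the order to which f' is smooth.\<close>

lemma ck_on_inverse:
  fixes f :: "_ \<Rightarrow> real"
  assumes "open W" "\<And>x. x \<in> W \<Longrightarrow> f x \<noteq> 0" "ck_on k W f"
  shows "ck_on k W (\<lambda>x. inverse (f x))"
  using assms(3)
proof (induction k)
  case 0
  then show ?case using assms(2) by (auto intro: continuous_intros)
next
  case (Suc k)
  have "ck_on k W (\<lambda>x. inverse (f x))" using Suc ck_on_SucD by blast
  then have "ck_on k W (\<lambda>x. (-1) * (inverse (f x) * frechet_derivative f (at x) v * inverse (f x)))" for v
    using ck_on_Suc_deriv[OF Suc.prems] by (intro ck_on_mult assms ck_on_const) auto
  then show ?case
    by (intro ck_on_SucI[where f' = "\<lambda>x v. - (inverse (f x) * frechet_derivative f (at x) v * inverse (f x))"])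
      (use assms ck_on_Suc_has_derivative[OF Suc.prems] in \<open>auto intro!: has_derivative_inverse\<close>)
qed

text \<open>In the chain rule the direction f'(x)v varies with x. Expanding it over
  \<open>Basis\<close> leaves derivatives of g in fixed directions composed with f, to which the
  induction hypothesis applies because it is general in g.\<close>

lemma ck_on_compose:
  fixes f :: "'a::euclidean_space \<Rightarrow> 'b::euclidean_space" and g :: "'b \<Rightarrow> 'c::real_normed_vector"
  assumes "open W" "open V" "f ` W \<subseteq> V" "ck_on k W f" "ck_on k V g"
  shows "ck_on k W (\<lambda>x. g (f x))"
  using assms(4,5)
proof (induction k arbitrary: g)
  case 0
  then show ?case unfolding ck_on.simps using assms(3) by (rule_tac continuous_on_compose2)
next
  case (Suc k)
  let ?f' = "\<lambda>x. frechet_derivative f (at x)" and ?g' = "\<lambda>y. frechet_derivative g (at y)"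
  have g: "(g has_derivative ?g' (f x)) (at (f x))" if "x \<in> W" for x
    using ck_on_Suc_has_derivative[OF Suc.prems(2)] assms(3) that by auto
  show ?case
  proof (rule ck_on_SucI[where f' = "\<lambda>x v. \<Sum>b\<in>Basis. (?f' x v \<bullet> b) *\<^sub>R ?g' (f x) b"])
    fix x assume "x \<in> W"
    then have D: "((\<lambda>x. g (f x)) has_derivative (\<lambda>v. ?g' (f x) (?f' x v))) (at x)"
      using diff_chain_at[OF ck_on_Suc_has_derivative[OF Suc.prems(1)] g] by (simp add: o_def)
    have rep: "?g' (f x) w = (\<Sum>b\<in>Basis. (w \<bullet> b) *\<^sub>R ?g' (f x) b)" for w
    proof -
      interpret linear "?g' (f x)" by (rule has_derivative_linear[OF g[OF \<open>x \<in> W\<close>]])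
      have "?g' (f x) w = ?g' (f x) (\<Sum>b\<in>Basis. (w \<bullet> b) *\<^sub>R b)"
        by (simp add: euclidean_representation)
      then show ?thesis by (simp add: sum scale)
    qed
    show "((\<lambda>x. g (f x)) has_derivative (\<lambda>v. \<Sum>b\<in>Basis. (?f' x v \<bullet> b) *\<^sub>R ?g' (f x) b)) (at x)"
      by (rule has_derivative_eq_rhs[OF D]) (rule ext, rule rep)
  next
    fix v
    have "ck_on k W (\<lambda>x. ?g' (f x) b)" for b
      by (rule Suc.IH[OF ck_on_SucD[OF Suc.prems(1)] ck_on_Suc_deriv[OF Suc.prems(2)]])
    moreover have "ck_on k W (\<lambda>x. ?f' x v \<bullet> b)" for b
      by (rule ck_on_bounded_linear_compose[OF assms(1) bounded_linear_inner_left
            ck_on_Suc_deriv[OF Suc.prems(1)]])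
    ultimately show "ck_on k W (\<lambda>x. \<Sum>b\<in>Basis. (?f' x v \<bullet> b) *\<^sub>R ?g' (f x) b)"
      by (intro ck_on_sum ck_on_scaleR assms(1))
  qed (use assms in auto)
qed

text \<open>The second difference of \<open>g\<close> over a small parallelogram is \<open>h\<^sup>2\<close> times a value of
  either mixed derivative.\<close>

lemma second_difference_mvt:
  fixes g :: "'a::euclidean_space \<Rightarrow> real"
  assumes "open W" "ck_on (Suc (Suc 0)) W g" "0 < h"
    and W: "\<And>s t. 0 \<le> s \<Longrightarrow> s \<le> h \<Longrightarrow> 0 \<le> t \<Longrightarrow> t \<le> h \<Longrightarrow> x + s *\<^sub>R u + t *\<^sub>R v \<in> W"
  shows "\<exists>s t. 0 < s \<and> s < h \<and> 0 < t \<and> t < h \<and>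
    g (x + h *\<^sub>R u + h *\<^sub>R v) - g (x + h *\<^sub>R u) - g (x + h *\<^sub>R v) + g x
      = h * h * frechet_derivative (\<lambda>y. frechet_derivative g (at y) u) (at (x + s *\<^sub>R u + t *\<^sub>R v)) v"
proof -
  let ?D = "\<lambda>y. frechet_derivative g (at y)"
  let ?E = "\<lambda>y. frechet_derivative (\<lambda>y. frechet_derivative g (at y) u) (at y)"
  have d1: "((\<lambda>s. g (x + s *\<^sub>R u + t *\<^sub>R v)) has_derivative (\<lambda>r. r * ?D (x + s *\<^sub>R u + t *\<^sub>R v) u)) (at s)"
    if "0 \<le> s" "s \<le> h" "0 \<le> t" "t \<le> h" for s t
  proof -
    have g: "(g has_derivative ?D (x + s *\<^sub>R u + t *\<^sub>R v)) (at (x + s *\<^sub>R u + t *\<^sub>R v))"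
      using ck_on_Suc_has_derivative[OF assms(2)] W that by blast
    have "((\<lambda>s. x + s *\<^sub>R u + t *\<^sub>R v) has_derivative (\<lambda>r. r *\<^sub>R u)) (at s)"
      by (auto intro!: derivative_eq_intros)
    from diff_chain_at[OF this g] show ?thesis
      using has_derivative_linear[OF g] by (simp add: o_def linear_scale)
  qed
  have d2: "((\<lambda>t. ?D (x + s *\<^sub>R u + t *\<^sub>R v) u) has_derivative (\<lambda>r. r * ?E (x + s *\<^sub>R u + t *\<^sub>R v) v)) (at t)"
    if "0 \<le> s" "s \<le> h" "0 \<le> t" "t \<le> h" for s t
  proof -
    have g: "((\<lambda>y. ?D y u) has_derivative ?E (x + s *\<^sub>R u + t *\<^sub>R v)) (at (x + s *\<^sub>R u + t *\<^sub>R v))"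
      by (rule ck_on_Suc_has_derivative[OF ck_on_Suc_deriv[OF assms(2)]]) (use W that in auto)
    have "((\<lambda>t. x + s *\<^sub>R u + t *\<^sub>R v) has_derivative (\<lambda>r. r *\<^sub>R v)) (at t)"
      by (auto intro!: derivative_eq_intros)
    from diff_chain_at[OF this g] show ?thesis
      using has_derivative_linear[OF g] by (simp add: o_def linear_scale)
  qed
  have h: "0 \<le> h" using assms(3) by simp
  \<comment> \<open>The mean value theorem is applied in direction u to the increment along v, and
    afterwards in direction v to the resulting first derivative.\<close>
  let ?F = "\<lambda>s. g (x + s *\<^sub>R u + h *\<^sub>R v) - g (x + s *\<^sub>R u + 0 *\<^sub>R v)"
  have "\<exists>s\<in>{0<..<h}. ?F h - ?F 0 = (h - 0) * (?D (x + s *\<^sub>R u + h *\<^sub>R v) u - ?D (x + s *\<^sub>R u + 0 *\<^sub>R v) u)"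
  proof -
    have "\<exists>s\<in>{0<..<h}. ?F h - ?F 0
       = (\<lambda>r. r * ?D (x + s *\<^sub>R u + h *\<^sub>R v) u - r * ?D (x + s *\<^sub>R u + 0 *\<^sub>R v) u) (h - 0)"
    proof (rule mvt_simple[OF assms(3)])
      show "(?F has_derivative (\<lambda>r. r * ?D (x + s *\<^sub>R u + h *\<^sub>R v) u - r * ?D (x + s *\<^sub>R u + 0 *\<^sub>R v) u))
           (at s within {0..h})" if "0 \<le> s" "s \<le> h" for s
        by (rule has_derivative_at_withinI, intro has_derivative_diff d1) (use that h in auto)
    qed
    then show ?thesis by (simp add: algebra_simps)
  qed
  then obtain s where s: "0 < s" "s < h"
    and Fs: "?F h - ?F 0 = h * (?D (x + s *\<^sub>R u + h *\<^sub>R v) u - ?D (x + s *\<^sub>R u + 0 *\<^sub>R v) u)" by auto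
  have "\<exists>t\<in>{0<..<h}. ?D (x + s *\<^sub>R u + h *\<^sub>R v) u - ?D (x + s *\<^sub>R u + 0 *\<^sub>R v) u
       = (\<lambda>r. r * ?E (x + s *\<^sub>R u + t *\<^sub>R v) v) (h - 0)"
  proof (rule mvt_simple[OF assms(3)])
    show "((\<lambda>t. ?D (x + s *\<^sub>R u + t *\<^sub>R v) u) has_derivative (\<lambda>r. r * ?E (x + s *\<^sub>R u + t *\<^sub>R v) v))
           (at t within {0..h})" if "0 \<le> t" "t \<le> h" for t
      by (rule has_derivative_at_withinI, intro d2) (use that s in auto)
  qed
  then obtain t where "0 < t" "t < h"
    "?D (x + s *\<^sub>R u + h *\<^sub>R v) u - ?D (x + s *\<^sub>R u + 0 *\<^sub>R v) u = h * ?E (x + s *\<^sub>R u + t *\<^sub>R v) v" by auto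
  with Fs s show ?thesis by (intro exI[of _ s] exI[of _ t]) (simp add: algebra_simps)
qed

text \<open>The same second difference is h^2 times either mixed derivative, each taken at some
  point of the parallelogram; continuity brings both close to their values at x.\<close>

lemma symmetric_second_derivative:
  fixes g :: "'a::euclidean_space \<Rightarrow> real"
  assumes "open W" "ck_on (Suc (Suc 0)) W g" "x \<in> W"
  shows "frechet_derivative (\<lambda>y. frechet_derivative g (at y) u) (at x) v
       = frechet_derivative (\<lambda>y. frechet_derivative g (at y) v) (at x) u"
proof (rule ccontr)
  let ?E = "\<lambda>u v y. frechet_derivative (\<lambda>y. frechet_derivative g (at y) u) (at y) v"
  assume ne: "?E u v x \<noteq> ?E v u x"
  define \<epsilon> where "\<epsilon> = dist (?E u v x) (?E v u x) / 2"
  have \<epsilon>: "0 < \<epsilon>" using ne by (simp add: \<epsilon>_def)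
  have "isCont (?E a b) x" for a b
    using ck_on_Suc_deriv[OF ck_on_Suc_deriv[OF assms(2)], of a b]
      continuous_on_eq_continuous_at[OF assms(1)] assms(3) unfolding ck_on.simps by blast
  then have "\<exists>d>0. \<forall>y. dist y x < d \<longrightarrow> dist (?E a b y) (?E a b x) < \<epsilon>" for a b
    using \<epsilon> by (auto simp: continuous_at_eps_delta)
  then obtain d1 d2 where d: "0 < d1" "0 < d2"
    and d1: "\<And>y. dist y x < d1 \<Longrightarrow> dist (?E u v y) (?E u v x) < \<epsilon>"
    and d2: "\<And>y. dist y x < d2 \<Longrightarrow> dist (?E v u y) (?E v u x) < \<epsilon>" by metis
  obtain d3 where d3: "0 < d3" "ball x d3 \<subseteq> W" using assms open_contains_ball by blast
  define r where "r = min d1 (min d2 d3)"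
  \<comment> \<open>Side length that keeps the parallelogram within r of x; the summand 1 avoids
    division by zero when u = v = 0.\<close>
  define h where "h = r / (norm u + norm v + 1)"
  have pos: "0 < norm u + norm v + 1" by (simp add: add_nonneg_pos)
  have r: "0 < r" using d d3 by (simp add: r_def)
  have h: "0 < h" unfolding h_def by (rule divide_pos_pos[OF r pos])
  have near: "dist (x + s *\<^sub>R a + t *\<^sub>R b) x < r"
    if "0 \<le> s" "s \<le> h" "0 \<le> t" "t \<le> h" "norm a + norm b = norm u + norm v" for s t a b
  proof -
    have "dist (x + s *\<^sub>R a + t *\<^sub>R b) x \<le> s * norm a + t * norm b"
      using norm_triangle_ineq[of "s *\<^sub>R a" "t *\<^sub>R b"] that by (simp add: dist_norm)
    also have "\<dots> \<le> h * norm a + h * norm b"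
      by (intro add_mono mult_right_mono) (use that in auto)
    also have "\<dots> = h * (norm u + norm v)" using that(5) by (metis distrib_left)
    also have "\<dots> < h * (norm u + norm v + 1)" using h by simp
    also have "\<dots> = r" using pos by (simp add: h_def)
    finally show ?thesis .
  qed
  have W: "x + s *\<^sub>R a + t *\<^sub>R b \<in> W"
    if "0 \<le> s" "s \<le> h" "0 \<le> t" "t \<le> h" "norm a + norm b = norm u + norm v" for s t a b
    using near[OF that] d3 by (auto simp: r_def dist_commute subset_iff)
  obtain s t where st: "0 < s" "s < h" "0 < t" "t < h"
    and 1: "g (x + h *\<^sub>R u + h *\<^sub>R v) - g (x + h *\<^sub>R u) - g (x + h *\<^sub>R v) + g x = h * h * ?E u v (x + s *\<^sub>R u + t *\<^sub>R v)"
    using second_difference_mvt[OF assms(1,2) h, of x u v] W by blast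
  obtain s' t' where st': "0 < s'" "s' < h" "0 < t'" "t' < h"
    and 2: "g (x + h *\<^sub>R v + h *\<^sub>R u) - g (x + h *\<^sub>R v) - g (x + h *\<^sub>R u) + g x = h * h * ?E v u (x + s' *\<^sub>R v + t' *\<^sub>R u)"
    using second_difference_mvt[OF assms(1,2) h, of x v u] W by (metis add.commute)
  have "g (x + h *\<^sub>R v + h *\<^sub>R u) = g (x + h *\<^sub>R u + h *\<^sub>R v)" by (simp add: add_ac)
  with 1 2 have "h * h * ?E u v (x + s *\<^sub>R u + t *\<^sub>R v) = h * h * ?E v u (x + s' *\<^sub>R v + t' *\<^sub>R u)"
    by linarith
  then have eq: "?E u v (x + s *\<^sub>R u + t *\<^sub>R v) = ?E v u (x + s' *\<^sub>R v + t' *\<^sub>R u)" using h by simp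
  have "dist (?E u v (x + s *\<^sub>R u + t *\<^sub>R v)) (?E u v x) < \<epsilon>"
    by (rule d1) (use near[of s t u v] st in \<open>auto simp: r_def\<close>)
  moreover have "dist (?E u v (x + s *\<^sub>R u + t *\<^sub>R v)) (?E v u x) < \<epsilon>"
    unfolding eq by (rule d2) (use near[of s' t' v u] st' in \<open>auto simp: r_def\<close>)
  ultimately show False
    using dist_triangle3[of "?E u v x" "?E v u x" "?E u v (x + s *\<^sub>R u + t *\<^sub>R v)"]
    unfolding \<epsilon>_def by linarith
qed

section \<open>Smoothness on arbitrary subsets through local extensions\<close>

lemma smooth_onI:
  assumes "\<And>x. x \<in> S \<Longrightarrow> \<exists>W g. open W \<and> x \<in> W \<and> (\<forall>k. ck_on k W g) \<and> (\<forall>y\<in>W \<inter> S. g y = f y)"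
  shows "smooth_on S f"
  using assms by (simp add: smooth_on_def)

lemma smooth_onE:
  assumes "smooth_on S f" "x \<in> S"
  obtains W g where "open W" "x \<in> W" "\<And>k. ck_on k W g" "\<And>y. y \<in> W \<Longrightarrow> y \<in> S \<Longrightarrow> g y = f y"
  using assms unfolding smooth_on_def by (metis IntI)

lemma smooth_on_subset: "smooth_on S f \<Longrightarrow> T \<subseteq> S \<Longrightarrow> smooth_on T f"
  unfolding smooth_on_def by (meson IntD1 IntD2 IntI subsetD)

lemma smooth_on_cong: "(\<And>x. x \<in> S \<Longrightarrow> f x = g x) \<Longrightarrow> smooth_on S f = smooth_on S g"
  unfolding smooth_on_def by auto

lemma smooth_on_local:
  assumes "\<And>x. x \<in> S \<Longrightarrow> \<exists>V. open V \<and> x \<in> V \<and> smooth_on (S \<inter> V) f"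
  shows "smooth_on S f"
proof (rule smooth_onI)
  fix x assume "x \<in> S"
  then obtain V where V: "open V" "x \<in> V" "smooth_on (S \<inter> V) f" using assms by blast
  then obtain W g where "open W" "x \<in> W" "\<And>k. ck_on k W g" "\<And>y. y \<in> W \<Longrightarrow> y \<in> S \<inter> V \<Longrightarrow> g y = f y"
    using smooth_onE[of "S \<inter> V" f x] \<open>x \<in> S\<close> by blast
  with V show "\<exists>W g. open W \<and> x \<in> W \<and> (\<forall>k. ck_on k W g) \<and> (\<forall>y\<in>W \<inter> S. g y = f y)"
    by (intro exI[of _ "W \<inter> V"] exI[of _ g]) (auto intro: ck_on_subset)
qed

lemma smooth_on_ck: "open W \<Longrightarrow> S \<subseteq> W \<Longrightarrow> (\<And>k. ck_on k W f) \<Longrightarrow> smooth_on S f"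
  by (rule smooth_onI) blast

lemma smooth_on_const [simp]: "smooth_on S (\<lambda>x. c)"
  by (rule smooth_on_ck[of UNIV]) (auto intro: ck_on_const)

lemma smooth_on_compose:
  fixes f :: "'a::euclidean_space \<Rightarrow> 'b::euclidean_space"
  assumes "smooth_on S f" "smooth_on T g" "f ` S \<subseteq> T"
  shows "smooth_on S (\<lambda>x. g (f x))"
proof (rule smooth_onI)
  fix x assume "x \<in> S"
  then obtain W f' where W: "open W" "x \<in> W" "\<And>k. ck_on k W f'" "\<And>y. y \<in> W \<Longrightarrow> y \<in> S \<Longrightarrow> f' y = f y"
    using smooth_onE[OF assms(1)] by blast
  have "f x \<in> T" using assms(3) \<open>x \<in> S\<close> by auto
  then obtain V g' where V: "open V" "f x \<in> V" "\<And>k. ck_on k V g'" "\<And>y. y \<in> V \<Longrightarrow> y \<in> T \<Longrightarrow> g' y = g y"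
    using smooth_onE[OF assms(2)] by blast
  have "continuous_on W f'" using W(3)[of 0] by simp
  then have o: "open (W \<inter> f' -` V)"
    by (rule continuous_open_preimage[OF _ W(1) V(1)])
  have "ck_on k (W \<inter> f' -` V) (\<lambda>x. g' (f' x))" for k
    by (rule ck_on_compose[OF o V(1)]) (use W V in \<open>auto intro: ck_on_subset\<close>)
  moreover have "g' (f' y) = g (f y)" if "y \<in> (W \<inter> f' -` V) \<inter> S" for y
    using that W(4) V(4) assms(3) by auto
  ultimately show "\<exists>W h. open W \<and> x \<in> W \<and> (\<forall>k. ck_on k W h) \<and> (\<forall>y\<in>W \<inter> S. h y = g (f y))"
    using o W V \<open>x \<in> S\<close> by (intro exI[of _ "W \<inter> f' -` V"] exI[of _ "\<lambda>x. g' (f' x)"]) auto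
qed

lemma smooth_on_bounded_linear_compose:
  assumes "bounded_linear L" "smooth_on S f"
  shows "smooth_on S (\<lambda>x. L (f x))"
proof (rule smooth_onI)
  fix x assume "x \<in> S"
  then obtain W g where "open W" "x \<in> W" "\<And>k. ck_on k W g" "\<And>y. y \<in> W \<Longrightarrow> y \<in> S \<Longrightarrow> g y = f y"
    using smooth_onE[OF assms(2)] by blast
  then show "\<exists>W h. open W \<and> x \<in> W \<and> (\<forall>k. ck_on k W h) \<and> (\<forall>y\<in>W \<inter> S. h y = L (f y))"
    by (intro exI[of _ W] exI[of _ "\<lambda>x. L (g x)"]) (auto intro: ck_on_bounded_linear_compose assms)
qed

text \<open>The two local extensions live on different neighbourhoods; intersecting them once here
  serves sums and products alike.\<close>

lemma smooth_on_binary: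
  fixes f :: "'a::euclidean_space \<Rightarrow> 'b::real_normed_vector" and g :: "'a \<Rightarrow> 'c::real_normed_vector"
  assumes f: "smooth_on S f" and g: "smooth_on S g"
    and op: "\<And>k (W :: 'a set) f g. open W \<Longrightarrow> ck_on k W f \<Longrightarrow> ck_on k W g \<Longrightarrow> ck_on k W (\<lambda>x. op (f x) (g x))"
  shows "smooth_on S (\<lambda>x. op (f x) (g x))"
proof (rule smooth_onI)
  fix x assume "x \<in> S"
  obtain W f' where W: "open W" "x \<in> W" "\<And>k. ck_on k W f'" "\<And>y. y \<in> W \<Longrightarrow> y \<in> S \<Longrightarrow> f' y = f y"
    using smooth_onE[OF f \<open>x \<in> S\<close>] by blast
  obtain V g' where V: "open V" "x \<in> V" "\<And>k. ck_on k V g'" "\<And>y. y \<in> V \<Longrightarrow> y \<in> S \<Longrightarrow> g' y = g y"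
    using smooth_onE[OF g \<open>x \<in> S\<close>] by blast
  have "ck_on k (W \<inter> V) (\<lambda>x. op (f' x) (g' x))" for k
    by (rule op) (use W V in \<open>auto intro: ck_on_subset\<close>)
  with W V show "\<exists>W h. open W \<and> x \<in> W \<and> (\<forall>k. ck_on k W h) \<and> (\<forall>y\<in>W \<inter> S. h y = op (f y) (g y))"
    by (intro exI[of _ "W \<inter> V"] exI[of _ "\<lambda>x. op (f' x) (g' x)"]) auto
qed

lemma smooth_on_add: "smooth_on S f \<Longrightarrow> smooth_on S g \<Longrightarrow> smooth_on S (\<lambda>x. f x + g x)"
  by (rule smooth_on_binary) (auto intro: ck_on_add)

lemma smooth_on_mult:
  fixes f g :: "_ \<Rightarrow> real"
  shows "smooth_on S f \<Longrightarrow> smooth_on S g \<Longrightarrow> smooth_on S (\<lambda>x. f x * g x)"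
  by (rule smooth_on_binary) (auto intro: ck_on_mult)

lemma smooth_on_diff:
  fixes f g :: "_ \<Rightarrow> real"
  assumes "smooth_on S f" "smooth_on S g"
  shows "smooth_on S (\<lambda>x. f x - g x)"
  using smooth_on_add[OF assms(1) smooth_on_mult[OF smooth_on_const[of _ "-1"] assms(2)]] by simp

lemma smooth_on_sum: "(\<And>i. i \<in> I \<Longrightarrow> smooth_on S (f i)) \<Longrightarrow> smooth_on S (\<lambda>x. \<Sum>i\<in>I. f i x)"
  by (induction I rule: infinite_finite_induct) (auto intro: smooth_on_add)

lemma smooth_on_prod:
  fixes f :: "_ \<Rightarrow> _ \<Rightarrow> real"
  shows "(\<And>i. i \<in> I \<Longrightarrow> smooth_on S (f i)) \<Longrightarrow> smooth_on S (\<lambda>x. \<Prod>i\<in>I. f i x)"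
  by (induction I rule: infinite_finite_induct) (auto intro: smooth_on_mult)

lemma smooth_on_continuous: "smooth_on S f \<Longrightarrow> continuous_on S f"
  unfolding continuous_on_eq_continuous_within
proof
  fix x assume f: "smooth_on S f" and x: "x \<in> S"
  then obtain W g where W: "open W" "x \<in> W" "\<And>k. ck_on k W g" "\<And>y. y \<in> W \<Longrightarrow> y \<in> S \<Longrightarrow> g y = f y"
    using smooth_onE[OF f] by blast
  have "continuous_on W g" using W(3)[of 0] by simp
  then have "isCont g x" using W(1,2) by (simp add: continuous_on_eq_continuous_at)
  then have "(g \<longlongrightarrow> g x) (at x within S)"
    using continuous_at_imp_continuous_within continuous_within by blast
  moreover have "eventually (\<lambda>y. g y = f y) (at x within S)"
    unfolding eventually_at_topological using W by auto
  ultimately show "continuous (at x within S) f"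
    unfolding continuous_within using W x Lim_transform_eventually by force
qed

section \<open>Derivatives within the half-space\<close>

abbreviation hderiv :: "(real^4 \<Rightarrow> 'b::real_normed_vector) \<Rightarrow> real^4 \<Rightarrow> real^4 \<Rightarrow> 'b" where
  "hderiv f x \<equiv> frechet_derivative f (at x within half_space)"

abbreviation hopen :: "(real^4) set \<Rightarrow> bool" where
  "hopen U \<equiv> openin (top_of_set half_space) U"

lemma hopen_subset: "hopen U \<Longrightarrow> U \<subseteq> half_space"
  using openin_imp_subset by blast

text \<open>Uniqueness survives at boundary points because every basis vector has nonnegative first
  component, so a short segment in each basis direction stays in the half-space.\<close>

lemma half_space_deriv_unique:
  fixes f :: "real^4 \<Rightarrow> 'b::real_normed_vector"
  assumes "x \<in> half_space" "(f has_derivative f') (at x within half_space)"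
    "(f has_derivative f'') (at x within half_space)"
  shows "f' = f''"
proof (rule frechet_derivative_unique_within[OF assms(2,3)])
  fix i :: "real^4" and r :: real assume "i \<in> Basis" "0 < r"
  then have "0 \<le> i $ 1" by (auto simp: Basis_vec_def axis_def)
  then have "x + (r / 2) *\<^sub>R i \<in> half_space" using assms(1) \<open>0 < r\<close> by (simp add: half_space_def)
  then show "\<exists>d. 0 < \<bar>d\<bar> \<and> \<bar>d\<bar> < r \<and> x + d *\<^sub>R i \<in> half_space"
    using \<open>0 < r\<close> by (intro exI[of _ "r/2"]) auto
qed

lemma hderiv_eq:
  "x \<in> half_space \<Longrightarrow> (f has_derivative f') (at x within half_space) \<Longrightarrow> hderiv f x = f'"
  using half_space_deriv_unique differentiableI frechet_derivative_works by blast

lemma at_within_hopen: "hopen U \<Longrightarrow> x \<in> U \<Longrightarrow> at x within U = at x within half_space"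
proof -
  assume "hopen U" "x \<in> U"
  then obtain T where "open T" "U = half_space \<inter> T" by (auto simp: openin_open)
  with \<open>x \<in> U\<close> show ?thesis by (intro at_within_nhd[of x T]) auto
qed

lemma has_derivative_hcong:
  assumes "hopen U" "x \<in> U" "\<And>y. y \<in> U \<Longrightarrow> f y = g y"
  shows "(f has_derivative f') (at x within half_space) \<longleftrightarrow> (g has_derivative f') (at x within half_space)"
  unfolding at_within_hopen[OF assms(1,2), symmetric]
  using has_derivative_transform[of x U g f f'] has_derivative_transform[of x U f g f'] assms(2,3)
  by metis

lemma hderiv_cong:
  assumes "hopen U" "x \<in> U" "\<And>y. y \<in> U \<Longrightarrow> f y = g y"
  shows "hderiv f x = hderiv g x"
proof -
  have "(f has_derivative f') (at x within half_space) \<longleftrightarrow> (g has_derivative f') (at x within half_space)" for f'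
    by (rule has_derivative_hcong[OF assms])
  then show ?thesis by (simp add: frechet_derivative_def)
qed

text \<open>A single extension computes f and its one-sided derivatives on a whole relative
  neighbourhood, so iterated derivatives within the half-space reduce to derivatives on an open
  set.\<close>

lemma smooth_on_extension:
  assumes "hopen U" "smooth_on U f" "x \<in> U"
  obtains W g where "open W" "x \<in> W" "W \<inter> half_space \<subseteq> U" "\<And>k. ck_on k W g"
    "\<And>y. y \<in> W \<inter> half_space \<Longrightarrow> g y = f y"
    "\<And>y. y \<in> W \<inter> half_space \<Longrightarrow> hderiv f y = frechet_derivative g (at y)"
    "\<And>y. y \<in> W \<inter> half_space \<Longrightarrow> (f has_derivative hderiv f y) (at y within half_space)"
proof -
  obtain V where V: "open V" "U = half_space \<inter> V" using assms(1) by (auto simp: openin_open)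
  obtain W g where W: "open W" "x \<in> W" "\<And>k. ck_on k W g" "\<And>y. y \<in> W \<Longrightarrow> y \<in> U \<Longrightarrow> g y = f y"
    using smooth_onE[OF assms(2,3)] by blast
  have o: "hopen (half_space \<inter> (W \<inter> V))" using W V by (auto intro: openin_open_Int)
  have d: "(f has_derivative frechet_derivative g (at y)) (at y within half_space)"
    if "y \<in> (W \<inter> V) \<inter> half_space" for y
  proof -
    have "(g has_derivative frechet_derivative g (at y)) (at y within half_space)"
      by (rule has_derivative_at_withinI, rule ck_on_Suc_has_derivative[OF W(3)]) (use that in auto)
    then show ?thesis
      by (subst has_derivative_hcong[OF o, of y f g]) (use that W V in auto)
  qed
  then have e: "hderiv f y = frechet_derivative g (at y)" if "y \<in> (W \<inter> V) \<inter> half_space" for y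
    using hderiv_eq that by blast
  show ?thesis
    by (rule that[of "W \<inter> V" g]) (use W V assms d e in \<open>auto intro: ck_on_subset\<close>)
qed

lemma smooth_on_has_hderiv:
  assumes "hopen U" "smooth_on U f" "x \<in> U"
  shows "(f has_derivative hderiv f x) (at x within half_space)"
  using smooth_on_extension[OF assms] hopen_subset[OF assms(1)] assms(3) by (metis IntI subsetD)

lemma linear_hderiv: "hopen U \<Longrightarrow> smooth_on U f \<Longrightarrow> x \<in> U \<Longrightarrow> linear (hderiv f x)"
  using smooth_on_has_hderiv has_derivative_linear by blast

lemma smooth_on_hderiv:
  assumes "hopen U" "smooth_on U f"
  shows "smooth_on U (\<lambda>x. hderiv f x v)"
proof (rule smooth_onI)
  fix x assume "x \<in> U"
  from smooth_on_extension[OF assms this] obtain W g where W: "open W" "x \<in> W" "\<And>k. ck_on k W g"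
    "\<And>y. y \<in> W \<inter> half_space \<Longrightarrow> hderiv f y = frechet_derivative g (at y)" by metis
  then show "\<exists>W g. open W \<and> x \<in> W \<and> (\<forall>k. ck_on k W g) \<and> (\<forall>y\<in>W \<inter> U. g y = hderiv f y v)"
    using hopen_subset[OF assms(1)]
    by (intro exI[of _ W] exI[of _ "\<lambda>y. frechet_derivative g (at y) v"]) (auto intro: ck_on_Suc_deriv)
qed

lemma hderiv_commute:
  fixes f :: "real^4 \<Rightarrow> real"
  assumes "hopen U" "smooth_on U f" "x \<in> U"
  shows "hderiv (\<lambda>y. hderiv f y u) x v = hderiv (\<lambda>y. hderiv f y v) x u"
proof -
  from smooth_on_extension[OF assms] obtain W g where W: "open W" "x \<in> W" "\<And>k. ck_on k W g"
    "\<And>y. y \<in> W \<inter> half_space \<Longrightarrow> hderiv f y = frechet_derivative g (at y)" by metis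
  have x: "x \<in> half_space" using assms hopen_subset by blast
  have o: "hopen (half_space \<inter> W)" using W by (auto intro: openin_open_Int)
  have "hderiv (\<lambda>y. hderiv f y u) x = frechet_derivative (\<lambda>y. frechet_derivative g (at y) u) (at x)" for u
  proof -
    have "hderiv (\<lambda>y. hderiv f y u) x = hderiv (\<lambda>y. frechet_derivative g (at y) u) x"
      by (rule hderiv_cong[OF o]) (use W x in auto)
    also have "\<dots> = frechet_derivative (\<lambda>y. frechet_derivative g (at y) u) (at x)"
      by (rule hderiv_eq[OF x has_derivative_at_withinI[OF
              ck_on_Suc_has_derivative[OF ck_on_Suc_deriv[OF W(3)] W(2)]]])
    finally show ?thesis .
  qed
  then show ?thesis using symmetric_second_derivative[OF W(1) W(3) W(2)] by simp
qed

lemma hderiv_const [simp]: "x \<in> half_space \<Longrightarrow> hderiv (\<lambda>y. c) x v = 0"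
  using hderiv_eq[of x "\<lambda>y. c" "\<lambda>v. 0"] by simp

lemma hderiv_add:
  assumes "hopen U" "smooth_on U f" "smooth_on U g" "x \<in> U"
  shows "hderiv (\<lambda>y. f y + g y) x v = hderiv f x v + hderiv g x v"
  using hderiv_eq[OF _ has_derivative_add[OF smooth_on_has_hderiv[OF assms(1,2,4)]
    smooth_on_has_hderiv[OF assms(1,3,4)]]] hopen_subset[OF assms(1)] assms(4) by auto

lemma hderiv_diff:
  assumes "hopen U" "smooth_on U f" "smooth_on U g" "x \<in> U"
  shows "hderiv (\<lambda>y. f y - g y) x v = hderiv f x v - hderiv g x v"
  using hderiv_eq[OF _ has_derivative_diff[OF smooth_on_has_hderiv[OF assms(1,2,4)]
    smooth_on_has_hderiv[OF assms(1,3,4)]]] hopen_subset[OF assms(1)] assms(4) by auto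

lemma hderiv_mult:
  fixes f g :: "real^4 \<Rightarrow> real"
  assumes "hopen U" "smooth_on U f" "smooth_on U g" "x \<in> U"
  shows "hderiv (\<lambda>y. f y * g y) x v = f x * hderiv g x v + hderiv f x v * g x"
  using hderiv_eq[OF _ has_derivative_mult[OF smooth_on_has_hderiv[OF assms(1,2,4)]
    smooth_on_has_hderiv[OF assms(1,3,4)]]] hopen_subset[OF assms(1)] assms(4) by auto

lemma hderiv_cmult:
  fixes f :: "real^4 \<Rightarrow> real"
  assumes "hopen U" "smooth_on U f" "x \<in> U"
  shows "hderiv (\<lambda>y. c * f y) x v = c * hderiv f x v"
  using hderiv_mult[OF assms(1) smooth_on_const assms(2,3), of c v] hopen_subset[OF assms(1)] assms(3)
  by auto

lemma hderiv_sum: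
  assumes "hopen U" "\<And>i. i \<in> I \<Longrightarrow> smooth_on U (f i)" "x \<in> U"
  shows "hderiv (\<lambda>y. \<Sum>i\<in>I. f i y) x v = (\<Sum>i\<in>I. hderiv (f i) x v)"
proof -
  have "((\<lambda>y. \<Sum>i\<in>I. f i y) has_derivative (\<lambda>v. \<Sum>i\<in>I. hderiv (f i) x v)) (at x within half_space)"
    by (rule has_derivative_sum) (rule smooth_on_has_hderiv[OF assms(1,2,3)])
  from hderiv_eq[OF _ this] show ?thesis using assms(3) hopen_subset[OF assms(1)] by auto
qed

text \<open>T is controlled only on U, so the chain rule is applied within U and its image, and the
  result is then read within the half-space.\<close>

lemma has_derivative_compose_half:
  fixes T :: "real^4 \<Rightarrow> real^4"
  assumes "hopen U" "smooth_on U T" "x \<in> U" "T ` U \<subseteq> V" "hopen V" "smooth_on V f"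
  shows "((\<lambda>y. f (T y)) has_derivative (\<lambda>v. hderiv f (T x) (hderiv T x v))) (at x within half_space)"
proof -
  have "(T has_derivative hderiv T x) (at x within U)"
    using smooth_on_has_hderiv[OF assms(1-3)] by (simp add: at_within_hopen[OF assms(1,3)])
  moreover have "(f has_derivative hderiv f (T x)) (at (T x) within T ` U)"
    by (rule has_derivative_subset[OF smooth_on_has_hderiv[OF assms(5,6)]])
      (use assms hopen_subset[OF assms(5)] in auto)
  ultimately have "(f \<circ> T has_derivative hderiv f (T x) \<circ> hderiv T x) (at x within U)"
    by (rule diff_chain_within)
  then show ?thesis by (simp add: o_def at_within_hopen[OF assms(1,3)])
qed

lemma hderiv_compose:
  fixes T :: "real^4 \<Rightarrow> real^4"
  assumes "hopen U" "smooth_on U T" "x \<in> U" "T ` U \<subseteq> V" "hopen V" "smooth_on V f"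
  shows "hderiv (\<lambda>y. f (T y)) x v = hderiv f (T x) (hderiv T x v)"
  using hderiv_eq[OF _ has_derivative_compose_half[OF assms]] assms(3) hopen_subset[OF assms(1)] by auto

section \<open>Bump functions\<close>

text \<open>The powers of 1/t are carried along because they make the family closed under
  differentiation up to linear combinations; smoothness of exp(-1/t) then becomes an induction on
  the order.\<close>

definition flat :: "nat \<Rightarrow> real \<Rightarrow> real" where
  "flat n t = (if 0 < t then exp (- inverse t) * inverse t ^ n else 0)"

lemma flat_tendsto_0: "(flat n \<longlongrightarrow> 0) (at 0)"
  unfolding filterlim_at_split
proof
  show "(flat n \<longlongrightarrow> 0) (at_left 0)"
    by (rule tendsto_eventually) (auto simp: flat_def eventually_at_filter)
  have "((\<lambda>s::real. s ^ n / exp s) \<longlongrightarrow> 0) at_top" by (rule tendsto_power_div_exp_0)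
  from filterlim_compose[OF this filterlim_inverse_at_top_right]
  have "((\<lambda>t::real. inverse t ^ n / exp (inverse t)) \<longlongrightarrow> 0) (at_right 0)" .
  then show "(flat n \<longlongrightarrow> 0) (at_right 0)"
    by (rule Lim_transform_eventually)
      (auto simp: flat_def eventually_at_filter exp_minus divide_inverse)
qed

lemma flat_has_derivative:
  "(flat n has_real_derivative flat (Suc (Suc n)) t - real n * flat (Suc n) t) (at t)"
proof (cases t "0::real" rule: linorder_cases)
  case less
  have "((\<lambda>t. 0) has_real_derivative 0) (at t)" by simp
  then have "(flat n has_real_derivative 0) (at t)"
    by (rule has_field_derivative_transform_within_open[of _ _ _ "{..<0}"]) (use less in \<open>auto simp: flat_def\<close>)
  with less show ?thesis by (simp add: flat_def)
next
  case equal
  \<comment> \<open>At 0 the difference quotient is \<open>flat (Suc n)\<close> itself, whose limit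
    is already known.\<close>
  have "((\<lambda>h. (flat n (0 + h) - flat n 0) / h) \<longlongrightarrow> 0) (at 0)"
    using flat_tendsto_0[of "Suc n"]
    by (rule Lim_transform_eventually) (auto simp: flat_def eventually_at_filter field_simps)
  then show ?thesis unfolding DERIV_def equal by (simp add: flat_def)
next
  case greater
  have "((\<lambda>t. exp (- inverse t) * inverse t ^ n) has_real_derivative
      flat (Suc (Suc n)) t - real n * flat (Suc n) t) (at t)"
    using greater
    by (auto intro!: derivative_eq_intros simp: flat_def)
      (cases n; simp add: field_simps power2_eq_square)
  then show ?thesis
    by (rule has_field_derivative_transform_within_open[of _ _ _ "{0<..}"]) (use greater in \<open>auto simp: flat_def\<close>)
qed

lemma ck_on_flat: "ck_on k UNIV (flat n)"
proof (induction k arbitrary: n)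
  case 0
  show ?case
    using DERIV_isCont[OF flat_has_derivative] by (auto intro!: continuous_at_imp_continuous_on)
next
  case (Suc k)
  show ?case
  proof (rule ck_on_SucI[where f' = "\<lambda>t v. (flat (Suc (Suc n)) t - real n * flat (Suc n) t) * v"])
    show "(flat n has_derivative (*) (flat (Suc (Suc n)) t - real n * flat (Suc n) t)) (at t)" for t
      using flat_has_derivative unfolding has_field_derivative_def .
    have "ck_on k UNIV (\<lambda>t. (flat (Suc (Suc n)) t + (- real n) * flat (Suc n) t) * v)" for v
      by (intro ck_on_mult ck_on_add ck_on_const Suc open_UNIV)
    then show "ck_on k UNIV (\<lambda>t. (flat (Suc (Suc n)) t - real n * flat (Suc n) t) * v)" for v by simp
  qed simp
qed

lemma flat_nonneg: "0 \<le> flat n t" and flat_pos: "0 < t \<Longrightarrow> 0 < flat n t"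
  by (auto simp: flat_def)

definition smooth_step :: "real \<Rightarrow> real" where
  "smooth_step t = flat 0 t * inverse (flat 0 t + flat 0 (1 - t))"

text \<open>The numbers t and 1 - t are not both nonpositive.\<close>

lemma smooth_step_denom: "0 < flat 0 t + flat 0 (1 - t)"
proof (cases "0 < t")
  case True
  then show ?thesis by (intro add_pos_nonneg flat_pos flat_nonneg)
next
  case False
  then show ?thesis by (intro add_nonneg_pos flat_pos flat_nonneg) simp
qed

lemma smooth_step_range: "0 \<le> smooth_step t" "smooth_step t \<le> 1"
  using smooth_step_denom[of t] flat_nonneg[of 0 t] flat_nonneg[of 0 "1 - t"]
  by (auto simp: smooth_step_def field_simps)

lemma smooth_step_0: "t \<le> 0 \<Longrightarrow> smooth_step t = 0" and smooth_step_1: "1 \<le> t \<Longrightarrow> smooth_step t = 1"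
  using flat_pos[of t 0] by (auto simp: smooth_step_def flat_def)

lemma ck_on_smooth_step: "ck_on k UNIV smooth_step"
proof -
  have aff: "ck_on k UNIV (\<lambda>t::real. 1 - t)"
    using ck_on_add[OF open_UNIV ck_on_const[OF open_UNIV, of k "1::real"]
        ck_on_bounded_linear[OF open_UNIV bounded_linear_minus[OF bounded_linear_ident], of k]]
    by simp
  have "ck_on k UNIV (\<lambda>t. flat 0 (1 - t))"
    by (rule ck_on_compose[OF _ _ _ aff ck_on_flat]) auto
  then have "ck_on k UNIV (\<lambda>t. flat 0 t * inverse (flat 0 t + flat 0 (1 - t)))"
    using smooth_step_denom
    by (intro ck_on_mult ck_on_inverse ck_on_add ck_on_flat open_UNIV) (auto simp: less_le)
  then show ?thesis by (simp add: smooth_step_def[abs_def])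
qed

lemma bump_exists:
  fixes x0 :: "'a::euclidean_space"
  assumes "0 < r"
  obtains \<beta> :: "'a \<Rightarrow> real" where "\<And>k. ck_on k UNIV \<beta>" "\<And>x. 0 \<le> \<beta> x" "\<And>x. \<beta> x \<le> 1"
    "\<And>x. dist x0 x < r / 2 \<Longrightarrow> \<beta> x = 1" "\<And>x. r \<le> dist x0 x \<Longrightarrow> \<beta> x = 0"
proof -
  \<comment> \<open>This is 2 - 2 * dist^2 / r^2: at least 1 within r / 2 of the centre and at most
    0 beyond r. Writing the squared distance in coordinates exhibits q as a polynomial.\<close>
  define q where "q x = 2 + (- 2 / r\<^sup>2) * (\<Sum>b\<in>Basis. (x \<bullet> b + - (x0 \<bullet> b)) * (x \<bullet> b + - (x0 \<bullet> b)))" for x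
  have q: "q x = 2 - 2 * (dist x0 x)\<^sup>2 / r\<^sup>2" for x
  proof -
    have "(dist x0 x)\<^sup>2 = (x - x0) \<bullet> (x - x0)" by (subst dist_commute) (simp add: dist_norm power2_norm_eq_inner)
    also have "\<dots> = (\<Sum>b\<in>Basis. (x \<bullet> b + - (x0 \<bullet> b)) * (x \<bullet> b + - (x0 \<bullet> b)))"
      by (subst euclidean_inner) (simp add: inner_diff_left)
    finally show ?thesis by (simp add: q_def)
  qed
  have cq: "ck_on k UNIV q" for k
  proof -
    have "ck_on k UNIV (\<lambda>x. x \<bullet> b)" for b :: 'a
      by (rule ck_on_bounded_linear[OF open_UNIV bounded_linear_inner_left])
    then show ?thesis
      unfolding q_def by (intro ck_on_add ck_on_mult ck_on_sum ck_on_const open_UNIV)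
  qed
  show ?thesis
  proof (rule that[of "\<lambda>x. smooth_step (q x)"])
    show "ck_on k UNIV (\<lambda>x. smooth_step (q x))" for k
      by (rule ck_on_compose[OF _ _ _ cq ck_on_smooth_step]) auto
    show "smooth_step (q x) = 1" if "dist x0 x < r / 2" for x
    proof (rule smooth_step_1)
      have "(dist x0 x)\<^sup>2 \<le> (r / 2)\<^sup>2" by (rule power_mono) (use that in auto)
      then have "4 * (dist x0 x)\<^sup>2 \<le> r\<^sup>2" by (simp add: power_divide)
      then have "2 * (dist x0 x)\<^sup>2 \<le> r\<^sup>2" using zero_le_power2[of "dist x0 x"] by linarith
      then show "1 \<le> q x" using assms by (simp add: q divide_le_eq)
    qed
    show "smooth_step (q x) = 0" if "r \<le> dist x0 x" for x
    proof (rule smooth_step_0)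
      have "r\<^sup>2 \<le> (dist x0 x)\<^sup>2" by (rule power_mono) (use that assms in auto)
      then show "q x \<le> 0" using assms by (simp add: q le_divide_eq)
    qed
  qed (auto simp: smooth_step_range)
qed

section \<open>Exterior algebra\<close>

lemma alternating_cong: "alternating k f \<Longrightarrow> (\<And>i. i < k \<Longrightarrow> vs i = ws i) \<Longrightarrow> f vs = f ws"
  by (simp add: alternating_def)

lemma alternating_linear: "alternating k f \<Longrightarrow> i < k \<Longrightarrow> linear (\<lambda>v. f (vs(i := v)))"
  by (simp add: alternating_def)

lemma alternating_eq_0: "alternating k f \<Longrightarrow> i < k \<Longrightarrow> j < k \<Longrightarrow> i \<noteq> j \<Longrightarrow> vs i = vs j \<Longrightarrow> f vs = 0"
  by (simp add: alternating_def)

lemma alternatingI: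
  assumes "\<And>vs ws. (\<And>i. i < k \<Longrightarrow> vs i = ws i) \<Longrightarrow> f vs = f ws"
    and "\<And>vs i. i < k \<Longrightarrow> linear (\<lambda>v. f (vs(i := v)))"
    and "\<And>vs i j. i < k \<Longrightarrow> j < k \<Longrightarrow> i \<noteq> j \<Longrightarrow> vs i = vs j \<Longrightarrow> f vs = 0"
  shows "alternating k f"
  unfolding alternating_def using assms by (intro conjI allI impI) blast+

lemma linear_cmult: "linear f \<Longrightarrow> linear (\<lambda>x. c * f x :: real)"
  using linear_compose_scale_right[of f c] by simp

lemma alternating_zero: "alternating k (\<lambda>vs. 0)"
  by (rule alternatingI) (auto simp: linear_zero)

lemma alternating_add:
  assumes "alternating k f" "alternating k g"
  shows "alternating k (\<lambda>vs. f vs + g vs)"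
proof (rule alternatingI)
  show "f vs + g vs = f ws + g ws" if "\<And>i. i < k \<Longrightarrow> vs i = ws i" for vs ws
    using alternating_cong[OF assms(1) that] alternating_cong[OF assms(2) that] by simp
  show "linear (\<lambda>v. f (vs(i := v)) + g (vs(i := v)))" if "i < k" for vs i
    by (intro linear_compose_add alternating_linear[OF assms(1) that] alternating_linear[OF assms(2) that])
qed (use alternating_eq_0[OF assms(1)] alternating_eq_0[OF assms(2)] in auto)

lemma alternating_cmult:
  assumes "alternating k f"
  shows "alternating k (\<lambda>vs. c * f vs)"
proof (rule alternatingI)
  show "c * f vs = c * f ws" if "\<And>i. i < k \<Longrightarrow> vs i = ws i" for vs ws
    using alternating_cong[OF assms that] by simp
  show "linear (\<lambda>v. c * f (vs(i := v)))" if "i < k" for vs i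
    by (intro linear_cmult alternating_linear[OF assms that])
qed (use alternating_eq_0[OF assms] in auto)

lemma alternating_compose_linear:
  assumes "alternating k f" "linear L"
  shows "alternating k (\<lambda>vs. f (\<lambda>i. L (vs i)))"
proof -
  have "linear (\<lambda>v. f (\<lambda>j. L ((vs(i := v)) j)))" if "i < k" for vs i
  proof -
    have "(\<lambda>j. L ((vs(i := v)) j)) = (\<lambda>j. L (vs j))(i := L v)" for v by auto
    then show ?thesis
      using linear_compose[OF assms(2) alternating_linear[OF assms(1) that]] by (simp add: o_def)
  qed
  then show ?thesis
    by (intro alternatingI) (auto intro: alternating_cong[OF assms(1)] alternating_eq_0[OF assms(1)])
qed

text \<open>Polarisation: the form vanishes when both slots hold the sum of the two vectors.\<close>

lemma alternating_swap:
  assumes f: "alternating k f" and "i < k" "j < k" "i \<noteq> j"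
  shows "f (vs(i := vs j, j := vs i)) = - f vs"
proof -
  define F where "F u v = f (vs(i := u, j := v))" for u v
  have lin2: "linear (F u)" for u
    unfolding F_def by (rule alternating_linear[OF f \<open>j < k\<close>])
  have lin1: "linear (\<lambda>u. F u v)" for v
    unfolding F_def fun_upd_twist[OF \<open>i \<noteq> j\<close>] by (rule alternating_linear[OF f \<open>i < k\<close>])
  have 0: "F u u = 0" for u
    unfolding F_def by (rule alternating_eq_0[OF f assms(2-4)]) (use assms in auto)
  have "F (vs i + vs j) (vs i + vs j) = F (vs i) (vs i) + F (vs j) (vs i) + (F (vs i) (vs j) + F (vs j) (vs j))"
    using linear_add[OF lin1] linear_add[OF lin2] by simp
  then have "F (vs j) (vs i) = - F (vs i) (vs j)" by (simp add: 0)
  then show ?thesis by (simp add: F_def)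
qed

text \<open>Composing with the transposition reverses every sign and leaves \<open>h\<close>
  unchanged, so the sum equals its own negative.\<close>

lemma sum_signed_permutations_eq_0:
  assumes "i \<in> S" "j \<in> S" "i \<noteq> j" "finite S"
    and h: "\<And>\<sigma>. \<sigma> permutes S \<Longrightarrow> h (Transposition.transpose i j \<circ> \<sigma>) = h \<sigma>"
  shows "(\<Sum>\<sigma> | \<sigma> permutes S. of_int (sign \<sigma>) * h \<sigma> :: real) = 0"
proof -
  have \<tau>: "Transposition.transpose i j permutes S" using assms by (simp add: permutes_swap_id)
  have "(\<Sum>\<sigma> | \<sigma> permutes S. of_int (sign \<sigma>) * h \<sigma>)
      = (\<Sum>\<sigma> | \<sigma> permutes S. of_int (sign (Transposition.transpose i j \<circ> \<sigma>)) * h (Transposition.transpose i j \<circ> \<sigma>))"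
    by (rule setum_permutations_compose_left[OF \<tau>])
  also have "\<dots> = (\<Sum>\<sigma> | \<sigma> permutes S. - (of_int (sign \<sigma>) * h \<sigma>))"
  proof (rule sum.cong)
    fix \<sigma> assume "\<sigma> \<in> {\<sigma>. \<sigma> permutes S}"
    then have "sign (Transposition.transpose i j \<circ> \<sigma>) = - sign \<sigma>"
      using sign_compose[OF permutation_swap_id[of i j] permutes_imp_permutation[OF assms(4)], of \<sigma>] assms(3)
      by (simp add: sign_swap_id)
    with \<open>\<sigma> \<in> _\<close> show "of_int (sign (Transposition.transpose i j \<circ> \<sigma>)) * h (Transposition.transpose i j \<circ> \<sigma>) = - (of_int (sign \<sigma>) * h \<sigma>)"
      using h by simp
  qed simp
  finally show ?thesis by (simp add: sum_negf)
qed

lemma alternating_alt_wedge: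
  assumes f: "alternating p f" and g: "alternating q g"
  shows "alternating (p + q) (alt_wedge p q f g)"
proof (rule alternatingI)
  fix vs ws :: "nat \<Rightarrow> real^'a" assume eq: "\<And>i. i < p + q \<Longrightarrow> vs i = ws i"
  have "f (\<lambda>i. vs (\<sigma> i)) = f (\<lambda>i. ws (\<sigma> i)) \<and> g (\<lambda>i. vs (\<sigma> (p + i))) = g (\<lambda>i. ws (\<sigma> (p + i)))"
    if "\<sigma> permutes {..<p + q}" for \<sigma>
  proof -
    have "\<sigma> i < p + q" if "i < p + q" for i using permutes_in_image[OF \<open>\<sigma> permutes _\<close>, of i] that by simp
    then show ?thesis by (intro conjI alternating_cong[OF f] alternating_cong[OF g] eq) auto
  qed
  then show "alt_wedge p q f g vs = alt_wedge p q f g ws" by (simp add: alt_wedge_def)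
next
  fix vs :: "nat \<Rightarrow> real^'a" and i assume i: "i < p + q"
  have lin: "linear (\<lambda>v. f (\<lambda>k. (vs(i := v)) (\<sigma> k)) * g (\<lambda>k. (vs(i := v)) (\<sigma> (p + k))))"
    if \<sigma>: "\<sigma> permutes {..<p + q}" for \<sigma>
  proof -
    \<comment> \<open>The vector in slot i reaches exactly one position of the product, namely j,
      which belongs to f if j < p and to g otherwise.\<close>
    define j where "j = inv \<sigma> i"
    have j: "j < p + q" using permutes_in_image[OF permutes_inv[OF \<sigma>], of i] i by (simp add: j_def)
    have ij: "\<sigma> k = i \<longleftrightarrow> k = j" for k
      using permutes_inverses[OF \<sigma>] by (auto simp: j_def)
    show ?thesis
    proof (cases "j < p")
      case True
      have "(\<lambda>k. (vs(i := v)) (\<sigma> k)) = (\<lambda>k. vs (\<sigma> k))(j := v)" for v by (auto simp: ij)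
      moreover have "(\<lambda>k. (vs(i := v)) (\<sigma> (p + k))) = (\<lambda>k. vs (\<sigma> (p + k)))" for v
        using True by (auto simp: ij)
      ultimately show ?thesis
        using linear_compose_scale_right[OF alternating_linear[OF f True], where c = "g (\<lambda>k. vs (\<sigma> (p + k)))"]
        by (simp add: mult.commute[of _ "g _"])
    next
      case False
      then have jq: "j - p < q" using j by auto
      have "(\<lambda>k. (vs(i := v)) (\<sigma> (p + k))) = (\<lambda>k. vs (\<sigma> (p + k)))(j - p := v)" for v
        using False by (intro ext) (auto simp: ij)
      moreover have "f (\<lambda>k. (vs(i := v)) (\<sigma> k)) = f (\<lambda>k. vs (\<sigma> k))" for v
        by (rule alternating_cong[OF f]) (use False in \<open>auto simp: ij\<close>)
      ultimately show ?thesis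
        using linear_compose_scale_right[OF alternating_linear[OF g jq], where c = "f (\<lambda>k. vs (\<sigma> k))"]
        by simp
    qed
  qed
  show "linear (\<lambda>v. alt_wedge p q f g (vs(i := v)))"
    unfolding alt_wedge_def divide_inverse mult.assoc mult.commute[of _ "inverse _"]
    by (intro linear_cmult linear_compose_sum ballI) (use lin in \<open>auto intro: linear_cmult\<close>)
next
  fix vs :: "nat \<Rightarrow> real^'a" and i j
  assume ij: "i < p + q" "j < p + q" "i \<noteq> j" "vs i = vs j"
  then have "vs (Transposition.transpose i j m) = vs m" for m by (simp add: Transposition.transpose_def)
  then have "(\<Sum>\<sigma> | \<sigma> permutes {..<p + q}.
      of_int (sign \<sigma>) * (f (\<lambda>i. vs (\<sigma> i)) * g (\<lambda>i. vs (\<sigma> (p + i))))) = 0"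
    using sum_signed_permutations_eq_0[of i "{..<p + q}" j "\<lambda>\<sigma>. f (\<lambda>i. vs (\<sigma> i)) * g (\<lambda>i. vs (\<sigma> (p + i)))"] ij
    by simp
  then show "alt_wedge p q f g vs = 0" by (simp add: alt_wedge_def mult.assoc)
qed

section \<open>Explicit wedge products in low degree\<close>

lemma sum_permutations_2:
  "(\<Sum>\<sigma> | \<sigma> permutes {..<2}. of_int (sign \<sigma>) * h (\<sigma> 0) (\<sigma> (Suc 0)) :: real) = h 0 1 - h 1 0"
proof -
  have eq: "{..<2::nat} = insert 0 {1}" by auto
  show ?thesis
    unfolding eq by (subst sum_over_permutations_insert; simp add: permutes_sing sign_swap_id sign_id Transposition.transpose_def)
qed

lemma sum_permutations_3:
  "(\<Sum>\<sigma> | \<sigma> permutes {..<3}. of_int (sign \<sigma>) * h (\<sigma> 0) (\<sigma> (Suc 0)) (\<sigma> 2) :: real)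
   = h 0 1 2 - h 0 2 1 - h 1 0 2 + h 1 2 0 + h 2 0 1 - h 2 1 0"
proof -
  have eq: "{..<3::nat} = insert 0 (insert 1 {2})" by auto
  have f: "finite {1::nat, 2}" "0 \<notin> {1::nat, 2}" "finite {2::nat}" "1 \<notin> {2::nat}" by auto
  show ?thesis
    unfolding eq sum_over_permutations_insert[OF f(1,2)] sum_over_permutations_insert[OF f(3,4)] permutes_sing
    by (simp add: sign_swap_id permutation_swap_id sign_compose sign_id Transposition.transpose_def)
qed

lemma sum_permutations_4:
  "(\<Sum>\<sigma> | \<sigma> permutes {..<4}. of_int (sign \<sigma>) * h (\<sigma> 0) (\<sigma> (Suc 0)) (\<sigma> 2) (\<sigma> 3) :: real)
   = h 0 1 2 3 - h 0 1 3 2 - h 0 2 1 3 + h 0 2 3 1 + h 0 3 1 2 - h 0 3 2 1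
   - h 1 0 2 3 + h 1 0 3 2 + h 1 2 0 3 - h 1 2 3 0 - h 1 3 0 2 + h 1 3 2 0
   + h 2 0 1 3 - h 2 0 3 1 - h 2 1 0 3 + h 2 1 3 0 + h 2 3 0 1 - h 2 3 1 0
   - h 3 0 1 2 + h 3 0 2 1 + h 3 1 0 2 - h 3 1 2 0 - h 3 2 0 1 + h 3 2 1 0"
proof -
  have eq: "{..<4::nat} = insert 0 (insert 1 (insert 2 {3}))" by auto
  have f: "finite {1::nat, 2, 3}" "0 \<notin> {1::nat, 2, 3}" "finite {2::nat, 3}" "1 \<notin> {2::nat, 3}"
    "finite {3::nat}" "2 \<notin> {3::nat}" by auto
  show ?thesis
    unfolding eq sum_over_permutations_insert[OF f(1,2)] sum_over_permutations_insert[OF f(3,4)]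
      sum_over_permutations_insert[OF f(5,6)] permutes_sing
    by (simp add: sign_swap_id permutation_swap_id permutation_compose sign_compose sign_id Transposition.transpose_def)
qed

text \<open>An alternating form is evaluated on a finite list of vectors as \<open>f ((!) [u, v, \<dots>])\<close>.\<close>

lemma alternating_nth1: "alternating 1 f \<Longrightarrow> f vs = f ((!) [vs 0])"
  by (rule alternating_cong) auto

lemma alternating_nth2: "alternating 2 f \<Longrightarrow> f vs = f ((!) [vs 0, vs 1])"
  by (rule alternating_cong) (auto simp: less_Suc_eq numeral_eq_Suc)

lemma alternating_nth3: "alternating 3 f \<Longrightarrow> f vs = f ((!) [vs 0, vs 1, vs 2])"
  by (rule alternating_cong) (auto simp: less_Suc_eq numeral_eq_Suc)

lemma alternating2_swap: "alternating 2 f \<Longrightarrow> f ((!) [v, u]) = - f ((!) [u, v])"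
  using alternating_swap[of 2 f 0 1 "(!) [u, v]"] alternating_nth2[of f "((!) [u, v])(0 := v, 1 := u)"]
  by simp

lemma alternating3_swap:
  assumes "alternating 3 f"
  shows "f ((!) [v, u, w]) = - f ((!) [u, v, w])" "f ((!) [u, w, v]) = - f ((!) [u, v, w])"
  using alternating_swap[OF assms, of 0 1 "(!) [u, v, w]"] alternating_swap[OF assms, of 1 2 "(!) [u, v, w]"]
    alternating_nth3[OF assms, of "((!) [u, v, w])(0 := v, 1 := u)"]
    alternating_nth3[OF assms, of "((!) [u, v, w])(1 := w, 2 := v)"]
  by simp_all

lemma alt_wedge_11:
  assumes f: "alternating 1 f" and g: "alternating 1 g"
  shows "alt_wedge 1 1 f g vs = f ((!) [vs 0]) * g ((!) [vs 1]) - f ((!) [vs 1]) * g ((!) [vs 0])"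
proof -
  have A: "alt_wedge 1 1 f g vs = (\<Sum>\<sigma> | \<sigma> permutes {..<2}.
      of_int (sign \<sigma>) * (f ((!) [vs (\<sigma> 0)]) * g ((!) [vs (\<sigma> (Suc 0))])))"
    unfolding alt_wedge_def
    by (subst alternating_nth1[OF f], subst alternating_nth1[OF g]) (simp add: mult.assoc numeral_eq_Suc)
  show ?thesis unfolding A sum_permutations_2[of "\<lambda>a b. f ((!) [vs a]) * g ((!) [vs b])"] by simp
qed

text \<open>The six permutations pair up under swapping the two arguments of g; antisymmetry makes
  the members of a pair equal, which absorbs the factor 1/2.\<close>

lemma alt_wedge_12:
  assumes f: "alternating 1 f" and g: "alternating 2 g"
  shows "alt_wedge 1 2 f g vs = f ((!) [vs 0]) * g ((!) [vs 1, vs 2])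
    - f ((!) [vs 1]) * g ((!) [vs 0, vs 2]) + f ((!) [vs 2]) * g ((!) [vs 0, vs 1])"
proof -
  have A: "alt_wedge 1 2 f g vs = (\<Sum>\<sigma> | \<sigma> permutes {..<3}. of_int (sign \<sigma>) *
      (f ((!) [vs (\<sigma> 0)]) * g ((!) [vs (\<sigma> (Suc 0)), vs (\<sigma> 2)]))) / 2"
    unfolding alt_wedge_def
    by (subst alternating_nth1[OF f], subst alternating_nth2[OF g]) (simp add: mult.assoc numeral_eq_Suc)
  show ?thesis unfolding A sum_permutations_3[of "\<lambda>a b c. f ((!) [vs a]) * g ((!) [vs b, vs c])"]
    using alternating2_swap[OF g, of "vs (Suc 0)" "vs 0"] alternating2_swap[OF g, of "vs 2" "vs 0"]
      alternating2_swap[OF g, of "vs 2" "vs (Suc 0)"] by simp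
qed

lemma alt_wedge_21:
  assumes f: "alternating 2 f" and g: "alternating 1 g"
  shows "alt_wedge 2 1 f g vs = f ((!) [vs 0, vs 1]) * g ((!) [vs 2])
    - f ((!) [vs 0, vs 2]) * g ((!) [vs 1]) + f ((!) [vs 1, vs 2]) * g ((!) [vs 0])"
proof -
  have A: "alt_wedge 2 1 f g vs = (\<Sum>\<sigma> | \<sigma> permutes {..<3}. of_int (sign \<sigma>) *
      (f ((!) [vs (\<sigma> 0), vs (\<sigma> (Suc 0))]) * g ((!) [vs (\<sigma> 2)]))) / 2"
    unfolding alt_wedge_def
    by (subst alternating_nth2[OF f], subst alternating_nth1[OF g]) (simp add: mult.assoc numeral_eq_Suc)
  show ?thesis unfolding A sum_permutations_3[of "\<lambda>a b c. f ((!) [vs a, vs b]) * g ((!) [vs c])"]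
    using alternating2_swap[OF f, of "vs (Suc 0)" "vs 0"] alternating2_swap[OF f, of "vs 2" "vs 0"]
      alternating2_swap[OF f, of "vs 2" "vs (Suc 0)"] by simp
qed

lemma alt_wedge_22:
  assumes f: "alternating 2 f" and g: "alternating 2 g"
  shows "alt_wedge 2 2 f g vs =
    f ((!) [vs 0, vs 1]) * g ((!) [vs 2, vs 3]) - f ((!) [vs 0, vs 2]) * g ((!) [vs 1, vs 3])
    + f ((!) [vs 0, vs 3]) * g ((!) [vs 1, vs 2]) + f ((!) [vs 1, vs 2]) * g ((!) [vs 0, vs 3])
    - f ((!) [vs 1, vs 3]) * g ((!) [vs 0, vs 2]) + f ((!) [vs 2, vs 3]) * g ((!) [vs 0, vs 1])"
proof -
  have A: "alt_wedge 2 2 f g vs = (\<Sum>\<sigma> | \<sigma> permutes {..<4}. of_int (sign \<sigma>) *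
      (f ((!) [vs (\<sigma> 0), vs (\<sigma> (Suc 0))]) * g ((!) [vs (\<sigma> 2), vs (\<sigma> 3)]))) / 4"
    unfolding alt_wedge_def
    by (subst alternating_nth2[OF f], subst alternating_nth2[OF g]) (simp add: mult.assoc numeral_eq_Suc)
  note swaps = alternating2_swap[OF f, of "vs (Suc 0)" "vs 0"] alternating2_swap[OF f, of "vs 2" "vs 0"]
      alternating2_swap[OF f, of "vs 2" "vs (Suc 0)"] alternating2_swap[OF f, of "vs 3" "vs 0"]
      alternating2_swap[OF f, of "vs 3" "vs (Suc 0)"] alternating2_swap[OF f, of "vs 3" "vs 2"]
      alternating2_swap[OF g, of "vs (Suc 0)" "vs 0"] alternating2_swap[OF g, of "vs 2" "vs 0"]
      alternating2_swap[OF g, of "vs 2" "vs (Suc 0)"] alternating2_swap[OF g, of "vs 3" "vs 0"]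
      alternating2_swap[OF g, of "vs 3" "vs (Suc 0)"] alternating2_swap[OF g, of "vs 3" "vs 2"]
  show ?thesis unfolding A sum_permutations_4[of "\<lambda>a b c d. f ((!) [vs a, vs b]) * g ((!) [vs c, vs d])"] by (simp add: swaps)
qed

lemma alternating3_permutations:
  assumes "alternating 3 f"
  shows "f ((!) [v, u, w]) = - f ((!) [u, v, w])" "f ((!) [u, w, v]) = - f ((!) [u, v, w])"
    "f ((!) [v, w, u]) = f ((!) [u, v, w])" "f ((!) [w, u, v]) = f ((!) [u, v, w])"
    "f ((!) [w, v, u]) = - f ((!) [u, v, w])"
  using alternating3_swap[OF assms] by (metis minus_minus)+

lemma alt_wedge_13:
  assumes f: "alternating 1 f" and g: "alternating 3 g"
  shows "alt_wedge 1 3 f g vs =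
    f ((!) [vs 0]) * g ((!) [vs 1, vs 2, vs 3]) - f ((!) [vs 1]) * g ((!) [vs 0, vs 2, vs 3])
    + f ((!) [vs 2]) * g ((!) [vs 0, vs 1, vs 3]) - f ((!) [vs 3]) * g ((!) [vs 0, vs 1, vs 2])"
proof -
  have A: "alt_wedge 1 3 f g vs = (\<Sum>\<sigma> | \<sigma> permutes {..<4}. of_int (sign \<sigma>) *
      (f ((!) [vs (\<sigma> 0)]) * g ((!) [vs (\<sigma> (Suc 0)), vs (\<sigma> 2), vs (\<sigma> 3)]))) / 6"
    unfolding alt_wedge_def
    by (subst alternating_nth1[OF f], subst alternating_nth3[OF g]) (simp add: mult.assoc numeral_eq_Suc)
  show ?thesis unfolding A sum_permutations_4[of "\<lambda>a b c d. f ((!) [vs a]) * g ((!) [vs b, vs c, vs d])"]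
    by (simp add: alternating3_permutations[OF g, where u = "vs (Suc 0)" and v = "vs 2" and w = "vs 3"]
        alternating3_permutations[OF g, where u = "vs 0" and v = "vs (Suc 0)" and w = "vs 3"]
        alternating3_permutations[OF g, where u = "vs 0" and v = "vs 2" and w = "vs 3"]
        alternating3_permutations[OF g, where u = "vs 0" and v = "vs (Suc 0)" and w = "vs 2"])
qed

lemma alt_wedge_31:
  assumes f: "alternating 3 f" and g: "alternating 1 g"
  shows "alt_wedge 3 1 f g vs =
    f ((!) [vs 0, vs 1, vs 2]) * g ((!) [vs 3]) - f ((!) [vs 0, vs 1, vs 3]) * g ((!) [vs 2])
    + f ((!) [vs 0, vs 2, vs 3]) * g ((!) [vs 1]) - f ((!) [vs 1, vs 2, vs 3]) * g ((!) [vs 0])"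
proof -
  have A: "alt_wedge 3 1 f g vs = (\<Sum>\<sigma> | \<sigma> permutes {..<4}. of_int (sign \<sigma>) *
      (f ((!) [vs (\<sigma> 0), vs (\<sigma> (Suc 0)), vs (\<sigma> 2)]) * g ((!) [vs (\<sigma> 3)]))) / 6"
    unfolding alt_wedge_def
    by (subst alternating_nth3[OF f], subst alternating_nth1[OF g]) (simp add: mult.assoc numeral_eq_Suc)
  show ?thesis unfolding A sum_permutations_4[of "\<lambda>a b c d. f ((!) [vs a, vs b, vs c]) * g ((!) [vs d])"]
    by (simp add: alternating3_permutations[OF f, where u = "vs (Suc 0)" and v = "vs 2" and w = "vs 3"]
        alternating3_permutations[OF f, where u = "vs 0" and v = "vs (Suc 0)" and w = "vs 3"]
        alternating3_permutations[OF f, where u = "vs 0" and v = "vs 2" and w = "vs 3"]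
        alternating3_permutations[OF f, where u = "vs 0" and v = "vs (Suc 0)" and w = "vs 2"])
qed

section \<open>Top-degree forms and determinants\<close>

definition frame :: "nat \<Rightarrow> real^4" where
  "frame = (!) [axis 1 1, axis 2 1, axis 3 1, axis 4 1]"

text \<open>Forms number their arguments by naturals, matrices number their rows by the type
  \<open>4\<close>; \<open>slot\<close> and \<open>unslot\<close> translate between the two.\<close>

definition slot :: "4 \<Rightarrow> nat" where
  "slot k = (if k = 1 then 0 else if k = 2 then 1 else if k = 3 then 2 else 3)"

definition unslot :: "nat \<Rightarrow> 4" where
  "unslot = (!) [1, 2, 3, 4]"

lemma less_4_cases: "i < 4 \<Longrightarrow> (i::nat) = 0 \<or> i = 1 \<or> i = 2 \<or> i = 3"
  by auto

lemma slot_less: "slot k < 4" and unslot_slot [simp]: "unslot (slot k) = k"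
  and slot_unslot: "i < 4 \<Longrightarrow> slot (unslot i) = i"
  and frame_unslot: "i < 4 \<Longrightarrow> frame i = axis (unslot i) 1"
  using exhaust_4[of k] less_4_cases[of i] by (auto simp: slot_def unslot_def frame_def)

lemma slot_inj: "slot m = slot n \<longleftrightarrow> m = n"
  by (metis unslot_slot)

lemma alternating_rows_upd:
  fixes A A' :: "real^4^4"
  assumes "alternating 4 f" "\<And>k. k \<noteq> m \<Longrightarrow> row k A' = row k A"
  shows "f (\<lambda>i. row (unslot i) A') = f ((\<lambda>i. row (unslot i) A)(slot m := row m A'))"
proof (rule alternating_cong[OF assms(1)])
  fix i :: nat assume "i < 4"
  then show "row (unslot i) A' = ((\<lambda>i. row (unslot i) A)(slot m := row m A')) i"
    using assms(2) slot_unslot by (cases "unslot i = m") auto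
qed

lemma alternating_frame_rows: "alternating 4 f \<Longrightarrow> f frame = f (\<lambda>i. row (unslot i) (mat 1))"
  by (rule alternating_cong) (auto simp: frame_unslot row_def mat_def axis_def vec_eq_iff)

text \<open>Both sides are compatible with products of matrices, so it suffices to compare them on
  elementary matrices.\<close>

lemma alternating_rows_det:
  fixes A :: "real^4^4"
  assumes "alternating 4 f"
  shows "f (\<lambda>i. row (unslot i) A) = det A * f frame"
  using assms
proof (induction A arbitrary: f rule: induct_matrix_elementary[case_names mult zero_row diagonal swap1 idplus])
  case (mult A B)
  have rows: "row k (A ** B) = transpose B *v row k A" for k
    by (simp add: vec_eq_iff row_def matrix_matrix_mult_def matrix_vector_mult_def transpose_def mult.commute)
  have rB: "transpose B *v frame i = row (unslot i) B" if "i < 4" for i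
    using that by (simp add: frame_unslot matrix_vector_mul_component vec_eq_iff row_def transpose_def
        matrix_vector_mult_basis column_def)
  \<comment> \<open>Right multiplication by B acts on rows as a linear map. Composing f with this
    map gives another alternating form, to which the hypothesis for A applies.\<close>
  have alt: "alternating 4 (\<lambda>vs. f (\<lambda>i. transpose B *v vs i))"
    by (rule alternating_compose_linear[OF mult.prems matrix_vector_mul_linear])
  have "f (\<lambda>i. row (unslot i) (A ** B)) = det A * f (\<lambda>i. transpose B *v frame i)"
    unfolding rows by (rule mult.IH(1)[OF alt])
  also have "f (\<lambda>i. transpose B *v frame i) = f (\<lambda>i. row (unslot i) B)"
    by (rule alternating_cong[OF mult.prems rB])
  finally show ?case using mult.IH(2)[OF mult.prems] by (simp add: det_mul)
next
  case (zero_row A m)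
  have "f ((\<lambda>i. row (unslot i) A)(slot m := row m A)) = 0"
    unfolding zero_row(1) by (rule linear_0[OF alternating_linear[OF zero_row(2) slot_less]])
  moreover have "det A = 0" by (rule det_zero_row[OF zero_row(1)])
  ultimately show ?case unfolding alternating_rows_upd[OF zero_row(2), of m A A, OF refl] by simp
next
  case (diagonal A)
  \<comment> \<open>Starting from the identity matrix, the diagonal entries are switched on one row
    at a time.\<close>
  define D where "D S = (\<chi> i j. if i = j then (if i \<in> S then A $ i $ i else 1) else (0 :: real))" for S :: "4 set"
  have rowD: "row m (D S) = (if m \<in> S then A $ m $ m else 1) *\<^sub>R axis m 1" for m S
    by (auto simp: D_def row_def vec_eq_iff axis_def)
  have fD: "f (\<lambda>i. row (unslot i) (D S)) = (\<Prod>k\<in>S. A $ k $ k) * f frame" for S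
  proof (induction S rule: infinite_finite_induct)
    case empty
    have "D {} = mat 1" by (auto simp: D_def mat_def)
    then show ?case using alternating_frame_rows[OF diagonal(2)] by simp
  next
    case (insert m S)
    have "f (\<lambda>i. row (unslot i) (D (insert m S)))
        = f ((\<lambda>i. row (unslot i) (D S))(slot m := row m (D (insert m S))))"
      by (rule alternating_rows_upd[OF diagonal(2)]) (simp add: rowD)
    also have "row m (D (insert m S)) = A $ m $ m *\<^sub>R row m (D S)"
      using insert by (simp add: rowD)
    also have "f ((\<lambda>i. row (unslot i) (D S))(slot m := A $ m $ m *\<^sub>R row m (D S)))
        = A $ m $ m * f ((\<lambda>i. row (unslot i) (D S))(slot m := row m (D S)))"
      by (subst linear_scale[OF alternating_linear[OF diagonal(2) slot_less]]) (simp only: real_scaleR_def)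
    also have "(\<lambda>i. row (unslot i) (D S))(slot m := row m (D S)) = (\<lambda>i. row (unslot i) (D S))"
      by auto
    finally show ?case using insert by simp
  qed simp
  have "D UNIV = A" using diagonal(1) by (auto simp: D_def vec_eq_iff)
  moreover have "det A = (\<Prod>k\<in>UNIV. A $ k $ k)" by (rule det_diagonal) (rule diagonal(1))
  ultimately show ?case using fD[of UNIV] by (simp only:)
next
  case (swap1 m n)
  let ?A = "(\<chi> i j. mat 1 $ i $ Transposition.transpose m n j) :: real^4^4"
  have rw: "row k ?A = axis (Transposition.transpose m n k) 1" for k
    by (auto simp: row_def vec_eq_iff mat_def axis_def Transposition.transpose_def)
  have sl: "slot m < 4" "slot n < 4" "slot m \<noteq> slot n" using swap1(1) by (auto simp: slot_less slot_inj)
  have "f (\<lambda>i. row (unslot i) ?A) = f (frame(slot m := frame (slot n), slot n := frame (slot m)))"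
  proof (rule alternating_cong[OF swap1(2)])
    fix i :: nat assume "i < 4"
    then show "row (unslot i) ?A = (frame(slot m := frame (slot n), slot n := frame (slot m))) i"
      unfolding rw using slot_unslot[of i]
      by (auto simp: frame_unslot slot_less Transposition.transpose_def)
  qed
  also have "\<dots> = - f frame" by (rule alternating_swap[OF swap1(2) sl])
  finally have 1: "f (\<lambda>i. row (unslot i) ?A) = - f frame" .
  have "?A = (\<chi> i. (mat 1 :: real^4^4) $ Transposition.transpose m n i)"
    by (auto simp: vec_eq_iff mat_def Transposition.transpose_def)
  then have "det ?A = of_int (sign (Transposition.transpose m n))"
    using det_permute_rows[of "Transposition.transpose m n" "mat 1 :: real^4^4"]
    by (simp add: permutes_swap_id)
  then show ?case using 1 swap1(1) by (simp add: sign_swap_id)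
next
  case (idplus m n c)
  let ?A = "(\<chi> i j. if i = m \<and> j = n then c else of_bool (i = j)) :: real^4^4"
  have sl: "slot m < 4" "slot n < 4" "slot m \<noteq> slot n" using idplus(1) by (auto simp: slot_less slot_inj)
  have rm: "row m ?A = row m (mat 1) + c *\<^sub>R axis n 1"
    using idplus(1) by (auto simp: row_def vec_eq_iff mat_def axis_def)
  let ?R = "\<lambda>i. row (unslot i) (mat 1 :: real^4^4)"
  have "f (\<lambda>i. row (unslot i) ?A) = f (?R(slot m := row m ?A))"
    by (rule alternating_rows_upd[OF idplus(2)]) (auto simp: row_def vec_eq_iff mat_def)
  also have "\<dots> = f (?R(slot m := row m (mat 1))) + c * f (?R(slot m := axis n 1))"
    unfolding rm
    by (subst linear_add[OF alternating_linear[OF idplus(2) sl(1)]],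
        subst linear_scale[OF alternating_linear[OF idplus(2) sl(1)]]) (simp only: real_scaleR_def)
  also have "?R(slot m := row m (mat 1)) = ?R" by auto
  \<comment> \<open>Slots m and n both hold the n-th axis vector.\<close>
  also have "f (?R(slot m := axis n 1)) = 0"
    by (rule alternating_eq_0[OF idplus(2) sl]) (use sl in \<open>auto simp: row_def mat_def axis_def vec_eq_iff\<close>)
  finally have 1: "f (\<lambda>i. row (unslot i) ?A) = f frame" using alternating_frame_rows[OF idplus(2)] by simp
  have "?A = (\<chi> k. if k = m then row m (mat 1) + c *s row n (mat 1) else row k (mat 1 :: real^4^4))"
    using idplus(1) by (auto simp: vec_eq_iff row_def mat_def)
  then have "det ?A = 1" using det_row_operation[OF idplus(1), of "mat 1 :: real^4^4" c] by simp
  with 1 show ?case by simp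
qed

text \<open>The transformation law of 4-forms thereby matches the Jacobian in the change of
  variables formula.\<close>

lemma alternating_det:
  assumes f: "alternating 4 f" and L: "linear L"
  shows "f (\<lambda>i. L (frame i)) = det (matrix L) * f frame"
proof -
  have "f (\<lambda>i. L (frame i)) = f (\<lambda>i. row (unslot i) (transpose (matrix L)))"
    by (rule alternating_cong[OF f])
      (simp add: frame_unslot row_transpose column_def matrix_def vec_eq_iff)
  also have "\<dots> = det (transpose (matrix L)) * f frame" by (rule alternating_rows_det[OF f])
  finally show ?thesis by (simp only: det_transpose)
qed

section \<open>Tests for the vanishing of a form\<close>

lemma alternating4_eq_0:
  fixes f :: "(nat \<Rightarrow> real^4) \<Rightarrow> real"
  assumes f: "alternating 4 f" and "f frame = 0"
  shows "f vs = 0"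
proof -
  define A :: "real^4^4" where "A = (\<chi> k. vs (slot k))"
  have "f vs = f (\<lambda>i. row (unslot i) A)"
    by (rule alternating_cong[OF f]) (simp add: A_def row_def slot_unslot)
  then show ?thesis using alternating_rows_det[OF f] assms(2) by simp
qed

lemma alternating_eq_0_on_Basis:
  fixes f :: "(nat \<Rightarrow> real^'n) \<Rightarrow> real"
  assumes f: "alternating k f" and 0: "\<And>vs. (\<And>i. i < k \<Longrightarrow> vs i \<in> Basis) \<Longrightarrow> f vs = 0"
  shows "f vs = 0"
proof -
  \<comment> \<open>Here m counts the leading arguments that need not be basis vectors yet;
    linearity expands the last of them.\<close>
  have "f vs = 0" if "m \<le> k" "\<And>i. m \<le> i \<Longrightarrow> i < k \<Longrightarrow> vs i \<in> Basis" for m vs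
    using that
  proof (induction m arbitrary: vs)
    case 0
    then show ?case using assms(2) by blast
  next
    case (Suc m)
    then have m: "m < k" by simp
    interpret linear "\<lambda>v. f (vs(m := v))" by (rule alternating_linear[OF f m])
    have "f (vs(m := b)) = 0" if "b \<in> Basis" for b
      by (rule Suc.IH) (use Suc.prems that in \<open>auto simp: Suc_le_eq\<close>)
    moreover have "f (vs(m := vs m)) = (\<Sum>b\<in>Basis. (vs m \<bullet> b) * f (vs(m := b)))"
      using sum[of "\<lambda>b. (vs m \<bullet> b) *\<^sub>R b" Basis] by (simp add: euclidean_representation scale)
    ultimately show ?case by simp
  qed
  from this[of k vs] show ?thesis by simp
qed

text \<open>The coordinate covector dx_a. In their own chart the test variations are scalar
  multiples of it.\<close>

definition covec :: "4 \<Rightarrow> (nat \<Rightarrow> real^4) \<Rightarrow> real" where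
  "covec a vs = vs 0 $ a"

lemma alternating_covec: "alternating 1 (covec a)"
  by (rule alternatingI) (auto simp: covec_def linear_iff)

text \<open>Three basis vectors miss some direction b, and dx_b \<and> g evaluated on that direction
  followed by the three vectors returns g on them.\<close>

lemma alternating3_eq_0:
  assumes g: "alternating 3 g" and 0: "\<And>a. alt_wedge 1 3 (covec a) g frame = 0"
  shows "g vs = 0"
proof (rule alternating_eq_0_on_Basis[OF g])
  fix vs :: "nat \<Rightarrow> real^4" assume vs: "\<And>i. i < 3 \<Longrightarrow> vs i \<in> Basis"
  have W: "alternating 4 (alt_wedge 1 3 (covec a) g)" for a
    using alternating_alt_wedge[OF alternating_covec g] by simp
  have "\<exists>j. vs i = axis j 1" if "i < 3" for i using vs[OF that] by (auto simp: Basis_vec_def)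
  then obtain a0 a1 a2 where a: "vs 0 = axis a0 1" "vs 1 = axis a1 1" "vs 2 = axis a2 1"
    by (metis one_less_numeral_iff semiring_norm(77) zero_less_numeral lessI numeral_2_eq_2 numeral_3_eq_3)
  \<comment> \<open>Three indices cannot exhaust a type with four elements.\<close>
  have "card {a0, a1, a2} \<noteq> card (UNIV :: 4 set)" using card_insert_le_m1[of 3] by (simp add: card_insert_if)
  then have "{a0, a1, a2} \<noteq> UNIV" by auto
  then obtain b where b: "b \<noteq> a0" "b \<noteq> a1" "b \<noteq> a2" by auto
  have "alt_wedge 1 3 (covec b) g ((!) [axis b 1, vs 0, vs 1, vs 2]) = 0"
    by (rule alternating4_eq_0[OF W 0])
  moreover have "alt_wedge 1 3 (covec b) g ((!) [axis b 1, vs 0, vs 1, vs 2]) = g ((!) [vs 0, vs 1, vs 2])"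
    unfolding alt_wedge_13[OF alternating_covec g] a using b by (simp add: covec_def axis_def)
  ultimately show "g vs = 0" using alternating_nth3[OF g] by metis
qed

text \<open>On the frame of the boundary hyperplane the covectors dx_2, dx_3 and dx_4 isolate one
  tangential component of g each. Components involving the normal direction stay unconstrained,
  hence the condition on the arguments.\<close>

lemma alternating2_boundary_eq_0:
  assumes g: "alternating 2 g"
    and 0: "\<And>a. alt_wedge 1 2 (covec a) g ((!) [axis 2 1, axis 3 1, axis 4 1]) = 0"
    and vs: "vs 0 $ 1 = 0" "vs 1 $ 1 = 0"
  shows "g vs = 0"
proof -
  let ?e = "\<lambda>a. axis a 1 :: real^4"
  have e: "g ((!) [?e 3, ?e 4]) = 0" "g ((!) [?e 2, ?e 4]) = 0" "g ((!) [?e 2, ?e 3]) = 0"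
    using 0[of 2] 0[of 3] 0[of 4] unfolding alt_wedge_12[OF alternating_covec g] by (auto simp: covec_def axis_def)
  have z: "g ((!) [0, w]) = 0" "g ((!) [w, 0]) = 0" "g ((!) [w, w]) = 0" for w
    using linear_0[OF alternating_linear[OF g, of 0 "(!) [0, w]"]] alternating2_swap[OF g, of 0 w]
      alternating2_swap[OF g, of w w] alternating_nth2[OF g, of "((!) [0, w])(0 := 0)"] by simp_all
  have s: "g ((!) [?e 4, ?e 3]) = 0" "g ((!) [?e 4, ?e 2]) = 0" "g ((!) [?e 3, ?e 2]) = 0"
    using e alternating2_swap[OF g] by (metis neg_equal_0_iff_equal)+
  \<comment> \<open>Projection onto the tangent hyperplane: composing g with it gives a form that
    vanishes on all vectors, so that testing on the basis is possible.\<close>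
  define L where "L v = (\<chi> i. if i = 1 then 0 else v $ i)" for v :: "real^4"
  have L: "linear L" by (auto simp: linear_iff L_def vec_eq_iff)
  have Le: "L (?e a) = (if a = 1 then 0 else ?e a)" for a by (auto simp: L_def vec_eq_iff axis_def)
  have "g (\<lambda>i. L (ws i)) = 0" for ws
  proof (rule alternating_eq_0_on_Basis[OF alternating_compose_linear[OF g L]])
    fix ws :: "nat \<Rightarrow> real^4" assume "\<And>i. i < 2 \<Longrightarrow> ws i \<in> Basis"
    from this[of 0] this[of 1] obtain a b where ab: "ws 0 = ?e a" "ws 1 = ?e b" by (auto simp: Basis_vec_def)
    have "g (\<lambda>i. L (ws i)) = g ((!) [L (ws 0), L (ws 1)])" by (subst alternating_nth2[OF g]) simp
    also have "\<dots> = 0" unfolding ab Le using exhaust_4[of a] exhaust_4[of b] e s z by auto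
    finally show "g (\<lambda>i. L (ws i)) = 0" .
  qed
  moreover have "g (\<lambda>i. L (vs i)) = g vs"
  proof (rule alternating_cong[OF g])
    fix i :: nat assume "i < 2"
    then have "vs i $ 1 = 0" using vs by (cases i) auto
    then show "L (vs i) = vs i" by (simp add: L_def vec_eq_iff)
  qed
  ultimately show ?thesis by metis
qed

section \<open>Forms on an oriented manifold\<close>

lemma alternating2I:
  fixes D :: "real^'n \<Rightarrow> real^'n \<Rightarrow> real"
  assumes l: "\<And>u. linear (D u)" and r: "\<And>v. linear (\<lambda>u. D u v)"
  shows "alternating 2 (\<lambda>vs. D (vs 0) (vs 1) - D (vs 1) (vs 0))"
proof (rule alternatingI)
  fix vs :: "nat \<Rightarrow> real^'n" and i :: nat assume "i < 2"
  then consider "i = 0" | "i = 1" by linarith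
  then show "linear (\<lambda>v. D ((vs(i := v)) 0) ((vs(i := v)) 1) - D ((vs(i := v)) 1) ((vs(i := v)) 0))"
    by cases (auto intro!: linear_compose_sub l r)
next
  fix vs :: "nat \<Rightarrow> real^'n" and i j :: nat assume "i < 2" "j < 2" "i \<noteq> j" "vs i = vs j"
  then have "vs 0 = vs 1" by (cases "i = 0"; cases "j = 0") (auto simp: less_2_cases_iff)
  then show "D (vs 0) (vs 1) - D (vs 1) (vs 0) = 0" by simp
qed auto

lemma one_form_expand:
  fixes f :: "(nat \<Rightarrow> real^4) \<Rightarrow> real"
  assumes "alternating 1 f"
  shows "f vs = (\<Sum>a\<in>UNIV. vs 0 $ a * f ((!) [axis a 1]))"
proof -
  have eq: "f ((!) [w]) = f (vs(0 := w))" for w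
    by (subst alternating_nth1[OF assms, of "vs(0 := w)"]) simp
  interpret linear "\<lambda>w. f ((!) [w])"
    unfolding eq by (rule alternating_linear[OF assms]) simp
  have "f vs = f ((!) [\<Sum>a\<in>UNIV. vs 0 $ a *\<^sub>R axis a 1])"
    by (subst alternating_nth1[OF assms]) (simp add: basis_expansion flip: scalar_mult_eq_scaleR)
  then show ?thesis by (simp add: sum scale)
qed

locale oriented_manifold =
  fixes \<A> :: "'m::{t2_space, second_countable_topology} chart set"
  assumes manifold: "oriented_smooth_manifold \<A>"
begin

lemma chart: "c \<in> \<A> \<Longrightarrow> is_chart c"
  using manifold by (simp add: oriented_smooth_manifold_def)

lemma chart_exists: "\<exists>c\<in>\<A>. p \<in> chart_dom c"
  using manifold unfolding oriented_smooth_manifold_def by blast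

lemma open_chart_dom: "c \<in> \<A> \<Longrightarrow> open (chart_dom c)"
  and hopen_chart_img: "c \<in> \<A> \<Longrightarrow> hopen (chart_img c)"
  and chart_homeo: "c \<in> \<A> \<Longrightarrow> homeomorphism (chart_dom c) (chart_img c) (snd c) (chart_inv c)"
  using chart unfolding is_chart_def by blast+

lemma chart_inv_chart: "c \<in> \<A> \<Longrightarrow> p \<in> chart_dom c \<Longrightarrow> chart_inv c (snd c p) = p"
  and chart_chart_inv: "c \<in> \<A> \<Longrightarrow> x \<in> chart_img c \<Longrightarrow> snd c (chart_inv c x) = x"
  and chart_inv_dom: "c \<in> \<A> \<Longrightarrow> x \<in> chart_img c \<Longrightarrow> chart_inv c x \<in> chart_dom c"
  using chart_homeo unfolding homeomorphism_def by blast+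

lemma overlap_iff:
  assumes "c \<in> \<A>"
  shows "x \<in> overlap c c' \<longleftrightarrow> x \<in> chart_img c \<and> chart_inv c x \<in> chart_dom c'"
proof
  assume "x \<in> overlap c c'"
  then obtain p where "p \<in> chart_dom c" "p \<in> chart_dom c'" "x = snd c p" by (auto simp: overlap_def)
  then show "x \<in> chart_img c \<and> chart_inv c x \<in> chart_dom c'" by (simp add: chart_inv_chart[OF assms])
next
  assume x: "x \<in> chart_img c \<and> chart_inv c x \<in> chart_dom c'"
  then have "snd c (chart_inv c x) \<in> overlap c c'"
    unfolding overlap_def by (intro imageI) (simp add: chart_inv_dom[OF assms])
  then show "x \<in> overlap c c'" using x by (simp add: chart_chart_inv[OF assms])
qed

lemma overlap_self: "c \<in> \<A> \<Longrightarrow> overlap c c = chart_img c"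
  by (simp add: overlap_def)

lemma hopen_preimage:
  assumes "c \<in> \<A>" "open V"
  shows "hopen {x \<in> chart_img c. chart_inv c x \<in> V}"
proof -
  have "continuous_on (chart_img c) (chart_inv c)" using chart_homeo[OF assms(1)] homeomorphism_cont2 by blast
  then have "openin (top_of_set (chart_img c)) (chart_img c \<inter> chart_inv c -` V)"
    using assms(2) continuous_openin_preimage_gen by blast
  then have "hopen (chart_img c \<inter> chart_inv c -` V)" using hopen_chart_img[OF assms(1)] openin_trans by blast
  then show ?thesis by (simp add: vimage_def Int_def)
qed

lemma hopen_overlap:
  assumes "c \<in> \<A>" "c' \<in> \<A>"
  shows "hopen (overlap c c')"
proof -
  have "overlap c c' = {x \<in> chart_img c. chart_inv c x \<in> chart_dom c'}" using overlap_iff[OF assms(1)] by blast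
  then show ?thesis using hopen_preimage[OF assms(1) open_chart_dom[OF assms(2)]] by simp
qed

lemma overlap_subset: "overlap c c' \<subseteq> chart_img c"
  by (auto simp: overlap_def)

lemma transition_eq: "transition c c' x = snd c' (chart_inv c x)"
  by (simp add: transition_def)

lemma transition_overlap: "c \<in> \<A> \<Longrightarrow> c' \<in> \<A> \<Longrightarrow> x \<in> overlap c c' \<Longrightarrow> transition c c' x \<in> overlap c' c"
  by (simp add: overlap_iff chart_inv_chart transition_eq chart_inv_dom)

lemma chart_inv_transition:
  "c \<in> \<A> \<Longrightarrow> c' \<in> \<A> \<Longrightarrow> x \<in> overlap c c' \<Longrightarrow> chart_inv c' (transition c c' x) = chart_inv c x"
  by (simp add: overlap_iff transition_eq chart_inv_chart)

lemma transition_inverse: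
  "c \<in> \<A> \<Longrightarrow> c' \<in> \<A> \<Longrightarrow> x \<in> overlap c c' \<Longrightarrow> transition c' c (transition c c' x) = x"
  using chart_inv_transition[of c c' x] by (simp add: transition_eq[of c' c] overlap_iff chart_chart_inv)

lemma transition_image: "c \<in> \<A> \<Longrightarrow> c' \<in> \<A> \<Longrightarrow> transition c c' ` overlap c c' = overlap c' c"
  using transition_overlap[of c c'] transition_overlap[of c' c] transition_inverse[of c' c]
  by (auto intro!: image_eqI[of _ _ "transition c' c _"])

lemma inj_on_transition: "c \<in> \<A> \<Longrightarrow> c' \<in> \<A> \<Longrightarrow> inj_on (transition c c') (overlap c c')"
  by (metis inj_on_def transition_inverse)

lemma smooth_transition: "c \<in> \<A> \<Longrightarrow> c' \<in> \<A> \<Longrightarrow> smooth_on (overlap c c') (transition c c')"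
  and det_transition: "c \<in> \<A> \<Longrightarrow> c' \<in> \<A> \<Longrightarrow> x \<in> overlap c c' \<Longrightarrow> 0 < det (matrix (hderiv (transition c c') x))"
  using manifold unfolding oriented_smooth_manifold_def by blast+

lemma linear_transition: "c \<in> \<A> \<Longrightarrow> c' \<in> \<A> \<Longrightarrow> x \<in> overlap c c' \<Longrightarrow> linear (hderiv (transition c c') x)"
  using linear_hderiv hopen_overlap smooth_transition by blast

lemma smooth_form_alternating: "smooth_form \<A> k \<omega> \<Longrightarrow> c \<in> \<A> \<Longrightarrow> x \<in> chart_img c \<Longrightarrow> alternating k (\<omega> c x)"
  and smooth_form_smooth: "smooth_form \<A> k \<omega> \<Longrightarrow> c \<in> \<A> \<Longrightarrow> smooth_on (chart_img c) (\<lambda>x. \<omega> c x vs)"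
  unfolding smooth_form_def by blast+

lemma smooth_form_transition:
  "smooth_form \<A> k \<omega> \<Longrightarrow> c \<in> \<A> \<Longrightarrow> c' \<in> \<A> \<Longrightarrow> x \<in> overlap c c' \<Longrightarrow>
    \<omega> c x vs = \<omega> c' (transition c c' x) (\<lambda>i. hderiv (transition c c') x (vs i))"
  unfolding smooth_form_def by (simp add: pullback_def fun_eq_iff)

lemma smooth_formI:
  assumes "\<And>c x. c \<in> \<A> \<Longrightarrow> x \<in> chart_img c \<Longrightarrow> alternating k (\<omega> c x)"
    and "\<And>c vs. c \<in> \<A> \<Longrightarrow> smooth_on (chart_img c) (\<lambda>x. \<omega> c x vs)"
    and "\<And>c c' x vs. c \<in> \<A> \<Longrightarrow> c' \<in> \<A> \<Longrightarrow> x \<in> overlap c c' \<Longrightarrow>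
      \<omega> c x vs = \<omega> c' (transition c c' x) (\<lambda>i. hderiv (transition c c') x (vs i))"
  shows "smooth_form \<A> k \<omega>"
  unfolding smooth_form_def using assms by (auto simp: pullback_def fun_eq_iff)

lemma smooth_form_zero: "smooth_form \<A> k (\<lambda>c x vs. 0)"
  by (rule smooth_formI) (auto simp: alternating_zero)

lemma smooth_form_add:
  assumes "smooth_form \<A> k \<omega>" "smooth_form \<A> k \<eta>"
  shows "smooth_form \<A> k (\<lambda>c x vs. \<omega> c x vs + \<eta> c x vs)"
proof (rule smooth_formI)
  show "\<omega> c x vs + \<eta> c x vs = \<omega> c' (transition c c' x) (\<lambda>i. hderiv (transition c c') x (vs i))
      + \<eta> c' (transition c c' x) (\<lambda>i. hderiv (transition c c') x (vs i))"
    if "c \<in> \<A>" "c' \<in> \<A>" "x \<in> overlap c c'" for c c' x vs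
    using smooth_form_transition[OF assms(1) that] smooth_form_transition[OF assms(2) that] by metis
qed (use assms in \<open>auto intro: alternating_add smooth_on_add smooth_form_alternating smooth_form_smooth\<close>)

lemma smooth_form_cmult:
  assumes "smooth_form \<A> k \<omega>"
  shows "smooth_form \<A> k (\<lambda>c x vs. r * \<omega> c x vs)"
proof (rule smooth_formI)
  show "r * \<omega> c x vs = r * \<omega> c' (transition c c' x) (\<lambda>i. hderiv (transition c c') x (vs i))"
    if "c \<in> \<A>" "c' \<in> \<A>" "x \<in> overlap c c'" for c c' x vs
    using smooth_form_transition[OF assms(1) that] by metis
qed (use assms in \<open>auto intro: alternating_cmult smooth_on_mult smooth_form_alternating smooth_form_smooth\<close>)

lemma smooth_form_sum:
  "(\<And>i. i \<in> I \<Longrightarrow> smooth_form \<A> k (\<omega> i)) \<Longrightarrow> smooth_form \<A> k (\<lambda>c x vs. \<Sum>i\<in>I. \<omega> i c x vs)"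
  by (induction I rule: infinite_finite_induct) (auto intro: smooth_form_add smooth_form_zero)

lemma smooth_form_wedge:
  assumes "smooth_form \<A> p \<omega>" "smooth_form \<A> q \<eta>"
  shows "smooth_form \<A> (p + q) (wedge p q \<omega> \<eta>)"
proof (rule smooth_formI)
  show "wedge p q \<omega> \<eta> c x vs = wedge p q \<omega> \<eta> c' (transition c c' x) (\<lambda>i. hderiv (transition c c') x (vs i))"
    if "c \<in> \<A>" "c' \<in> \<A>" "x \<in> overlap c c'" for c c' x vs
    unfolding wedge_def alt_wedge_def
    using smooth_form_transition[OF assms(1) that] smooth_form_transition[OF assms(2) that] by simp
  show "smooth_on (chart_img c) (\<lambda>x. wedge p q \<omega> \<eta> c x vs)" if "c \<in> \<A>" for c vs
    unfolding wedge_def alt_wedge_def divide_inverse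
    by (intro smooth_on_mult smooth_on_sum smooth_on_const smooth_form_smooth[OF assms(1) that]
        smooth_form_smooth[OF assms(2) that])
  show "alternating (p + q) (wedge p q \<omega> \<eta> c x)" if "c \<in> \<A>" "x \<in> chart_img c" for c x
    unfolding wedge_def
    by (intro alternating_alt_wedge smooth_form_alternating[OF assms(1) that] smooth_form_alternating[OF assms(2) that])
qed

lemma smooth_form_smooth_function:
  assumes "smooth_function \<A> \<rho>" "smooth_form \<A> k \<omega>"
  shows "smooth_form \<A> k (\<lambda>c x vs. \<rho> (chart_inv c x) * \<omega> c x vs)"
proof (rule smooth_formI)
  show "\<rho> (chart_inv c x) * \<omega> c x vs = \<rho> (chart_inv c' (transition c c' x))
      * \<omega> c' (transition c c' x) (\<lambda>i. hderiv (transition c c') x (vs i))"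
    if "c \<in> \<A>" "c' \<in> \<A>" "x \<in> overlap c c'" for c c' x vs
    using smooth_form_transition[OF assms(2) that] chart_inv_transition[OF that] by metis
  show "smooth_on (chart_img c) (\<lambda>x. \<rho> (chart_inv c x) * \<omega> c x vs)" if "c \<in> \<A>" for c vs
    using assms(1) that by (intro smooth_on_mult smooth_form_smooth[OF assms(2)]) (auto simp: smooth_function_def o_def)
qed (use assms in \<open>auto intro: alternating_cmult smooth_form_alternating\<close>)

section \<open>Exterior derivative of a 1-form across charts\<close>

lemma ext_deriv_1:
  assumes "smooth_form \<A> 1 \<omega>" "c \<in> \<A>" "x \<in> chart_img c"
  shows "ext_deriv 1 \<omega> c x vs = hderiv (\<lambda>y. \<omega> c y ((!) [vs 1])) x (vs 0) - hderiv (\<lambda>y. \<omega> c y ((!) [vs 0])) x (vs 1)"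
proof -
  have "hderiv (\<lambda>y. \<omega> c y ws) x = hderiv (\<lambda>y. \<omega> c y ((!) [ws 0])) x" for ws
    by (rule hderiv_cong[OF hopen_chart_img[OF assms(2)] assms(3)])
      (rule alternating_nth1[OF smooth_form_alternating[OF assms(1,2)]])
  from this[of "\<lambda>j. if j < 0 then vs j else vs (Suc j)"] this[of "\<lambda>j. if j < 1 then vs j else vs (Suc j)"]
  show ?thesis by (simp add: ext_deriv_def atMost_Suc)
qed

text \<open>The derivative falls on the coefficients alone, which shows linearity in the argument v
  of the form besides linearity in the direction u.\<close>

lemma hderiv_one_form_expand:
  assumes "smooth_form \<A> 1 \<omega>" "c \<in> \<A>" "x \<in> chart_img c"
  shows "hderiv (\<lambda>y. \<omega> c y ((!) [v])) x u = (\<Sum>a\<in>UNIV. v $ a * hderiv (\<lambda>y. \<omega> c y ((!) [axis a 1])) x u)"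
proof -
  note o = hopen_chart_img[OF assms(2)]
  have "\<omega> c y ((!) [v]) = (\<Sum>a\<in>UNIV. v $ a * \<omega> c y ((!) [axis a 1]))" if "y \<in> chart_img c" for y
    using one_form_expand[OF smooth_form_alternating[OF assms(1,2) that], of "(!) [v]"] by simp
  then have "hderiv (\<lambda>y. \<omega> c y ((!) [v])) x u = hderiv (\<lambda>y. \<Sum>a\<in>UNIV. v $ a * \<omega> c y ((!) [axis a 1])) x u"
    by (intro fun_cong[OF hderiv_cong[OF o assms(3)]])
  also have "\<dots> = (\<Sum>a\<in>UNIV. hderiv (\<lambda>y. v $ a * \<omega> c y ((!) [axis a 1])) x u)"
    by (rule hderiv_sum[OF o _ assms(3)]) (intro smooth_on_mult smooth_on_const smooth_form_smooth[OF assms(1,2)])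
  also have "\<dots> = (\<Sum>a\<in>UNIV. v $ a * hderiv (\<lambda>y. \<omega> c y ((!) [axis a 1])) x u)"
    by (intro sum.cong refl hderiv_cmult[OF o _ assms(3)] smooth_form_smooth[OF assms(1,2)])
  finally show ?thesis .
qed

text \<open>The second derivatives of the transition map cancel because they are symmetric.\<close>

lemma smooth_form_ext_deriv_1:
  assumes \<omega>: "smooth_form \<A> 1 \<omega>"
  shows "smooth_form \<A> 2 (ext_deriv 1 \<omega>)"
proof (rule smooth_formI)
  fix c and x :: "real^4" assume c: "c \<in> \<A>" "x \<in> chart_img c"
  note o = hopen_chart_img[OF c(1)]
  show "alternating 2 (ext_deriv 1 \<omega> c x)"
  proof -
    have "alternating 2 (\<lambda>vs. hderiv (\<lambda>y. \<omega> c y ((!) [vs 1])) x (vs 0) - hderiv (\<lambda>y. \<omega> c y ((!) [vs 0])) x (vs 1))"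
    proof (rule alternating2I[where D = "\<lambda>u v. hderiv (\<lambda>y. \<omega> c y ((!) [v])) x u"])
      have "linear (\<lambda>v. \<Sum>a\<in>UNIV. v $ a * hderiv (\<lambda>y. \<omega> c y ((!) [axis a 1])) x u)" for u
        by (auto simp: linear_iff sum.distrib distrib_right sum_distrib_left mult.assoc)
      then show "linear (\<lambda>v. hderiv (\<lambda>y. \<omega> c y ((!) [v])) x u)" for u
        by (subst hderiv_one_form_expand[OF \<omega> c])
      show "linear (\<lambda>u. hderiv (\<lambda>y. \<omega> c y ((!) [v])) x u)" for v
        by (rule linear_hderiv[OF o smooth_form_smooth[OF \<omega> c(1)] c(2)])
    qed
    moreover have "ext_deriv 1 \<omega> c x
        = (\<lambda>vs. hderiv (\<lambda>y. \<omega> c y ((!) [vs 1])) x (vs 0) - hderiv (\<lambda>y. \<omega> c y ((!) [vs 0])) x (vs 1))"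
      by (rule ext) (rule ext_deriv_1[OF \<omega> c])
    ultimately show ?thesis by (simp only:)
  qed
next
  fix c and vs :: "nat \<Rightarrow> real^4" assume c: "c \<in> \<A>"
  note o = hopen_chart_img[OF c]
  have "smooth_on (chart_img c) (\<lambda>x. hderiv (\<lambda>y. \<omega> c y ((!) [vs 1])) x (vs 0) - hderiv (\<lambda>y. \<omega> c y ((!) [vs 0])) x (vs 1))"
    by (intro smooth_on_diff smooth_on_hderiv[OF o smooth_form_smooth[OF \<omega> c]])
  then show "smooth_on (chart_img c) (\<lambda>x. ext_deriv 1 \<omega> c x vs)"
    by (subst smooth_on_cong[OF ext_deriv_1[OF \<omega> c]])
next
  fix c c' x and vs :: "nat \<Rightarrow> real^4" assume c: "c \<in> \<A>" "c' \<in> \<A>" "x \<in> overlap c c'"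
  define T where "T = transition c c'"
  note oO = hopen_overlap[OF c(1,2)]
  have T: "smooth_on (overlap c c') T" unfolding T_def by (rule smooth_transition[OF c(1,2)])
  have TO: "T ` overlap c c' \<subseteq> chart_img c'"
    using transition_image[OF c(1,2)] overlap_subset[of c' c] by (simp add: T_def)
  have x: "x \<in> chart_img c" "T x \<in> chart_img c'" 
    using c(3) TO subsetD[OF overlap_subset c(3)] by blast+
  note o' = hopen_chart_img[OF c(2)]
  let ?w = "\<lambda>a z. \<omega> c' z ((!) [axis a 1])"
  have w: "smooth_on (chart_img c') (?w a)" for a by (rule smooth_form_smooth[OF \<omega> c(2)])
  have wT: "smooth_on (overlap c c') (\<lambda>y. ?w a (T y))" for a by (rule smooth_on_compose[OF T w TO])
  have Ta: "smooth_on (overlap c c') (\<lambda>y. T y $ a)" for a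
    by (rule smooth_on_bounded_linear_compose[OF bounded_linear_vec_nth T])
  have DTa: "hderiv T y v $ a = hderiv (\<lambda>y. T y $ a) y v" if "y \<in> overlap c c'" for y v a
    using hderiv_eq[OF subsetD[OF hopen_subset[OF oO] that]
      bounded_linear.has_derivative[OF bounded_linear_vec_nth smooth_on_has_hderiv[OF oO T that]]] by simp
  \<comment> \<open>The product rule gives the derivative of the coefficient in the other chart plus
    a term with second derivatives of T. Only the latter fails to be tensorial.\<close>
  have D: "hderiv (\<lambda>y. \<omega> c y ((!) [v])) x u = hderiv (\<lambda>z. \<omega> c' z ((!) [hderiv T x v])) (T x) (hderiv T x u)
      + (\<Sum>a\<in>UNIV. hderiv (\<lambda>y. hderiv (\<lambda>y. T y $ a) y v) x u * ?w a (T x))" for u v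
  proof -
    have "hderiv (\<lambda>y. \<omega> c y ((!) [v])) x u = hderiv (\<lambda>y. \<Sum>a\<in>UNIV. hderiv (\<lambda>y. T y $ a) y v * ?w a (T y)) x u"
    proof (rule fun_cong[OF hderiv_cong[OF oO c(3)]])
      fix y assume y: "y \<in> overlap c c'"
      have "\<omega> c y ((!) [v]) = \<omega> c' (T y) (\<lambda>i. hderiv T y ((!) [v] i))"
        unfolding T_def by (rule smooth_form_transition[OF \<omega> c(1,2) y])
      also have "\<dots> = (\<Sum>a\<in>UNIV. hderiv T y v $ a * ?w a (T y))"
        using one_form_expand[OF smooth_form_alternating[OF \<omega> c(2)], of "T y" "\<lambda>i. hderiv T y ((!) [v] i)"] TO y
        by auto
      finally show "\<omega> c y ((!) [v]) = (\<Sum>a\<in>UNIV. hderiv (\<lambda>y. T y $ a) y v * ?w a (T y))"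
        by (simp add: DTa[OF y])
    qed
    also have "\<dots> = (\<Sum>a\<in>UNIV. hderiv (\<lambda>y. hderiv (\<lambda>y. T y $ a) y v * ?w a (T y)) x u)"
      by (rule hderiv_sum[OF oO _ c(3)]) (intro smooth_on_mult smooth_on_hderiv[OF oO Ta] wT)
    also have "\<dots> = (\<Sum>a\<in>UNIV. hderiv (\<lambda>y. T y $ a) x v * hderiv (?w a) (T x) (hderiv T x u)
        + hderiv (\<lambda>y. hderiv (\<lambda>y. T y $ a) y v) x u * ?w a (T x))"
      by (simp add: hderiv_mult[OF oO smooth_on_hderiv[OF oO Ta] wT c(3)] hderiv_compose[OF oO T c(3) TO o' w])
    also have "\<dots> = (\<Sum>a\<in>UNIV. hderiv T x v $ a * hderiv (?w a) (T x) (hderiv T x u))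
      + (\<Sum>a\<in>UNIV. hderiv (\<lambda>y. hderiv (\<lambda>y. T y $ a) y v) x u * ?w a (T x))"
      by (simp add: sum.distrib DTa[OF c(3)])
    also have "(\<Sum>a\<in>UNIV. hderiv T x v $ a * hderiv (?w a) (T x) (hderiv T x u))
      = hderiv (\<lambda>z. \<omega> c' z ((!) [hderiv T x v])) (T x) (hderiv T x u)"
      by (rule hderiv_one_form_expand[OF \<omega> c(2) x(2), symmetric])
    finally show ?thesis .
  qed
  have sym: "hderiv (\<lambda>y. hderiv (\<lambda>y. T y $ a) y v) x u = hderiv (\<lambda>y. hderiv (\<lambda>y. T y $ a) y u) x v" for a u v
    by (rule hderiv_commute[OF oO Ta c(3)])
  have "ext_deriv 1 \<omega> c x vs = ext_deriv 1 \<omega> c' (T x) (\<lambda>i. hderiv T x (vs i))"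
    unfolding ext_deriv_1[OF \<omega> c(1) x(1)] ext_deriv_1[OF \<omega> c(2) x(2)] D using sym by simp
  then show "ext_deriv 1 \<omega> c x vs = ext_deriv 1 \<omega> c' (transition c c' x) (\<lambda>i. hderiv (transition c c') x (vs i))"
    by (simp add: T_def)
qed

end

section \<open>Integration by parts on the half-space\<close>

lemma closed_half_space: "closed half_space"
proof -
  have "half_space = {x. 0 \<le> axis 1 1 \<bullet> x}" by (auto simp: half_space_def inner_axis')
  then show ?thesis using closed_halfspace_ge[of 0 "axis 1 1 :: real^4"] by simp
qed

text \<open>Continuity is asked on the compact carrier only, so functions that jump at the edge of
  K, such as those cut off at a shifted half-space, are covered.\<close>

lemma absolutely_integrable_on_compact_support:
  fixes f :: "'a::euclidean_space \<Rightarrow> real"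
  assumes "compact K" "continuous_on K f" "K \<subseteq> S" "\<And>x. x \<in> S - K \<Longrightarrow> f x = 0"
  shows "f absolutely_integrable_on S"
proof -
  have 1: "integrable lborel (\<lambda>x. indicator K x *\<^sub>R f x)" by (rule borel_integrable_compact[OF assms(1,2)])
  then have "integrable lebesgue (\<lambda>x. indicator K x *\<^sub>R f x)"
    using integrable_completion by blast
  moreover have "indicator K x *\<^sub>R f x = indicator S x *\<^sub>R f x" for x
    using assms(3,4) by (auto simp: indicator_def)
  ultimately show ?thesis by (simp only: set_integrable_def)
qed

text \<open>The cut-off function may be discontinuous but is Borel. Translation invariance holds for
  the Lebesgue integral over \<open>lborel\<close> and is transferred from there to the gauge
  integral.\<close>

lemma integral_shift_compact_support:
  fixes f :: "'a::euclidean_space \<Rightarrow> real"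
  assumes "compact K" "continuous_on K f"
  shows "integral UNIV (\<lambda>x. indicator K (v + x) * f (v + x)) = integral UNIV (\<lambda>x. indicator K x * f x)"
proof -
  let ?F = "\<lambda>x. indicator K x * f x"
  have F: "integrable lborel ?F" using borel_integrable_compact[OF assms] by simp
  then have meas: "?F \<in> borel_measurable borel" using borel_measurable_integrable by force
  from F have "integrable (distr lborel borel ((+) v)) ?F" by (simp add: lborel_distr_plus)
  then have Fv: "integrable lborel (\<lambda>x. ?F (v + x))" using meas by (subst (asm) integrable_distr_eq) auto
  have "integral\<^sup>L lborel ?F = integral\<^sup>L (distr lborel borel ((+) v)) ?F" by (simp add: lborel_distr_plus)
  also have "\<dots> = integral\<^sup>L lborel (\<lambda>x. ?F (v + x))" by (rule integral_distr) (use meas in auto)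
  finally show ?thesis using integral_lborel[OF F] integral_lborel[OF Fv] by simp
qed

locale half_space_compact_support =
  fixes f :: "real^4 \<Rightarrow> real" and C :: "(real^4) set"
  assumes smooth: "smooth_on half_space f" and C: "compact C"
    and support: "\<And>x. x \<in> half_space \<Longrightarrow> x \<notin> C \<Longrightarrow> f x = 0"
begin

lemma hopen_half_space: "hopen half_space" by simp

lemma compact_half_space_Int: "compact (half_space \<inter> C)"
  using closed_half_space C by (rule closed_Int_compact)

lemma support_hderiv: "x \<in> half_space \<Longrightarrow> x \<notin> C \<Longrightarrow> hderiv f x v = 0"
proof -
  assume x: "x \<in> half_space" "x \<notin> C"
  have "hopen (half_space \<inter> - C)" using C by (simp add: openin_open_Int compact_imp_closed open_Compl)
  from hderiv_cong[OF this, of x f "\<lambda>y. 0"] x support show ?thesis by auto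
qed

lemma hderiv_bounded:
  obtains B where "0 \<le> B" "\<And>x. x \<in> half_space \<Longrightarrow> \<bar>hderiv f x v\<bar> \<le> B"
proof -
  have "continuous_on (half_space \<inter> C) (\<lambda>x. hderiv f x v)"
    using smooth_on_continuous[OF smooth_on_hderiv[OF hopen_half_space smooth]] by (rule continuous_on_subset) simp
  then have "bounded ((\<lambda>x. hderiv f x v) ` (half_space \<inter> C))"
    by (intro compact_imp_bounded compact_continuous_image compact_half_space_Int)
  then obtain B where "\<forall>x\<in>half_space \<inter> C. \<bar>hderiv f x v\<bar> \<le> B" by (auto simp: bounded_iff)
  \<comment> \<open>Off C the derivative is 0, which B need not dominate if the compact set is
    empty; hence the maximum.\<close>
  then have "\<bar>hderiv f x v\<bar> \<le> max B 0" if "x \<in> half_space" for x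
    using support_hderiv[OF that] that by (cases "x \<in> C") force+
  then show ?thesis by (intro that[of "max B 0"]) auto
qed

lemma half_space_ray: "x \<in> half_space \<Longrightarrow> 0 \<le> s \<Longrightarrow> x + s *\<^sub>R axis a 1 \<in> half_space"
  by (auto simp: half_space_def axis_def)

lemma ray_derivative:
  assumes "x \<in> half_space" "0 \<le> s"
  shows "((\<lambda>s. f (x + s *\<^sub>R axis a 1)) has_real_derivative hderiv f (x + s *\<^sub>R axis a 1) (axis a 1)) (at s within {0..})"
proof -
  let ?y = "x + s *\<^sub>R axis a (1::real)"
  have y: "?y \<in> half_space" by (rule half_space_ray[OF assms])
  have f: "(f has_derivative hderiv f ?y) (at ?y within half_space)"
    by (rule smooth_on_has_hderiv[OF hopen_half_space smooth y])
  have "((\<lambda>s. x + s *\<^sub>R axis a (1::real)) has_derivative (\<lambda>r. r *\<^sub>R axis a 1)) (at s within {0..})"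
    by (auto intro!: derivative_eq_intros)
  moreover have "(f has_derivative hderiv f ?y) (at ?y within (\<lambda>s. x + s *\<^sub>R axis a (1::real)) ` {0..})"
    by (rule has_derivative_subset[OF f]) (use half_space_ray[OF assms(1)] in auto)
  ultimately have "(f \<circ> (\<lambda>s. x + s *\<^sub>R axis a (1::real)) has_derivative hderiv f ?y \<circ> (\<lambda>r. r *\<^sub>R axis a 1)) (at s within {0..})"
    by (rule diff_chain_within)
  moreover have "hderiv f ?y \<circ> (\<lambda>r. r *\<^sub>R axis a 1) = (*) (hderiv f ?y (axis a 1))"
    using linear_scale[OF has_derivative_linear[OF f]] by (auto simp: mult.commute)
  ultimately show ?thesis by (simp add: has_field_derivative_def o_def)
qed

lemma ray_mvt:
  assumes "x \<in> half_space" "0 < h"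
  shows "\<exists>s. 0 < s \<and> s < h \<and> f (x + h *\<^sub>R axis a 1) - f x = h * hderiv f (x + s *\<^sub>R axis a 1) (axis a 1)"
proof -
  have "\<exists>s\<in>{0<..<h}. (\<lambda>s. f (x + s *\<^sub>R axis a 1)) h - (\<lambda>s. f (x + s *\<^sub>R axis a 1)) 0
      = (\<lambda>r. hderiv f (x + s *\<^sub>R axis a 1) (axis a 1) * r) (h - 0)"
  proof (rule mvt_simple[OF assms(2)])
    show "((\<lambda>s. f (x + s *\<^sub>R axis a 1)) has_derivative (*) (hderiv f (x + s *\<^sub>R axis a 1) (axis a 1))) (at s within {0..h})"
      if "0 \<le> s" "s \<le> h" for s
      by (rule has_derivative_subset[OF ray_derivative[OF assms(1) that(1), unfolded has_field_derivative_def]]) auto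
  qed
  then show ?thesis by (auto simp: mult.commute)
qed

text \<open>Dominated convergence runs along a sequence. The values are at most 1, so that all
  shifted supports lie in one ball.\<close>

definition step :: "nat \<Rightarrow> real" where "step n = inverse (real (Suc n))"

lemma step_pos: "0 < step n" by (simp add: step_def)

lemma step_tendsto: "step \<longlonglongrightarrow> 0" unfolding step_def using LIMSEQ_inverse_real_of_nat .

section \<open>Difference quotients and the boundary layer\<close>

lemma integrable_f: "f integrable_on half_space"
  using absolutely_integrable_on_compact_support[OF compact_half_space_Int, of f half_space]
    smooth_on_continuous[OF smooth] continuous_on_subset support set_lebesgue_integral_eq_integral(1) by blast

lemma shifted_half_space: "closed {y. y - h *\<^sub>R axis a 1 \<in> half_space}"
  using continuous_closed_vimage[OF closed_half_space, of "\<lambda>y. y - h *\<^sub>R axis a 1"]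
  by (simp add: vimage_def continuous_intros)

text \<open>The shift maps the half-space onto the points whose back-shift lies in the half-space.
  Translation invariance thus turns the integral of the shifted function into that of f over this
  set.\<close>

lemma integral_shifted:
  fixes a :: 4
  assumes "0 \<le> h"
  defines "g \<equiv> \<lambda>y. if y - h *\<^sub>R axis a 1 \<in> half_space then f y else 0"
  shows "g integrable_on half_space" "(\<lambda>x. f (x + h *\<^sub>R axis a 1)) integrable_on half_space"
    "integral half_space (\<lambda>x. f (x + h *\<^sub>R axis a 1)) = integral half_space g"
proof -
  define K where "K = (half_space \<inter> C) \<inter> {y. y - h *\<^sub>R axis a 1 \<in> half_space}"
  have K: "compact K" unfolding K_def
    by (rule compact_Int_closed[OF compact_half_space_Int shifted_half_space])
  have fK: "continuous_on K f"
    using smooth_on_continuous[OF smooth] by (rule continuous_on_subset) (auto simp: K_def)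
  have "g absolutely_integrable_on half_space"
    by (rule absolutely_integrable_on_compact_support[OF K])
      (use fK support in \<open>auto simp: g_def K_def cong: continuous_on_cong_simp\<close>)
  then show "g integrable_on half_space" using set_lebesgue_integral_eq_integral(1) by blast
  have g: "(if y \<in> half_space then g y else 0) = indicator K y * f y" for y
    using support[of y] by (auto simp: g_def K_def indicator_def)
  have fx: "(if x \<in> half_space then f (x + h *\<^sub>R axis a 1) else 0)
      = indicator K (h *\<^sub>R axis a 1 + x) * f (h *\<^sub>R axis a 1 + x)" for x
    using half_space_ray[OF _ assms(1), of x a] support[of "x + h *\<^sub>R axis a 1"]
    by (auto simp: K_def add.commute indicator_def)
  let ?K = "(\<lambda>y. - (h *\<^sub>R axis a 1) + y) ` K"
  have "(\<lambda>x. f (x + h *\<^sub>R axis a 1)) absolutely_integrable_on half_space"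
  proof (rule absolutely_integrable_on_compact_support)
    show "compact ?K" by (rule compact_translation[OF K])
    show "?K \<subseteq> half_space" by (auto simp: K_def)
    show "continuous_on ?K (\<lambda>x. f (x + h *\<^sub>R axis a 1))"
      by (rule continuous_on_compose2[OF fK]) (auto intro!: continuous_intros)
    fix x assume x: "x \<in> half_space - ?K"
    have "x + h *\<^sub>R axis a 1 \<notin> K"
    proof
      assume "x + h *\<^sub>R axis a 1 \<in> K"
      then have "- (h *\<^sub>R axis a 1) + (x + h *\<^sub>R axis a 1) \<in> ?K" by (rule imageI)
      then show False using x by simp
    qed
    then show "f (x + h *\<^sub>R axis a 1) = 0"
      using x half_space_ray[OF _ assms(1), of x a] support[of "x + h *\<^sub>R axis a 1"] by (auto simp: K_def)
  qed
  then show "(\<lambda>x. f (x + h *\<^sub>R axis a 1)) integrable_on half_space"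
    using set_lebesgue_integral_eq_integral(1) by blast
  have "integral half_space (\<lambda>x. f (x + h *\<^sub>R axis a 1))
      = integral UNIV (\<lambda>x. indicator K (h *\<^sub>R axis a 1 + x) * f (h *\<^sub>R axis a 1 + x))"
    by (subst integral_restrict_UNIV[symmetric]) (simp only: fx)
  also have "\<dots> = integral UNIV (\<lambda>x. indicator K x * f x)" by (rule integral_shift_compact_support[OF K fK])
  also have "\<dots> = integral half_space g"
    by (subst (2) integral_restrict_UNIV[symmetric]) (simp only: g)
  finally show "integral half_space (\<lambda>x. f (x + h *\<^sub>R axis a 1)) = integral half_space g" .
qed


text \<open>The part of f / h that is lost when the half-space is moved by h along axis a: the slab
  of points with first coordinate below h if a = 1, and nothing for any other axis.\<close>

definition layer :: "4 \<Rightarrow> real \<Rightarrow> real^4 \<Rightarrow> real" where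
  "layer a h y = (if y - h *\<^sub>R axis a 1 \<in> half_space then 0 else f y / h)"

lemma layer_integrable: "0 < h \<Longrightarrow> layer a h integrable_on half_space"
  and integral_quotient: "0 < h \<Longrightarrow>
    integral half_space (\<lambda>x. (f (x + h *\<^sub>R axis a 1) - f x) / h) = - integral half_space (layer a h)"
proof -
  assume h: "0 < h"
  note s = integral_shifted[OF less_imp_le[OF h], of a]
  have "(\<lambda>y. (f y - (if y - h *\<^sub>R axis a 1 \<in> half_space then f y else 0)) / h) integrable_on half_space"
    by (intro integrable_on_divide integrable_diff integrable_f s)
  moreover have l: "layer a h = (\<lambda>y. (f y - (if y - h *\<^sub>R axis a 1 \<in> half_space then f y else 0)) / h)"
    by (auto simp: layer_def)
  ultimately show "layer a h integrable_on half_space" by simp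
  show "integral half_space (\<lambda>x. (f (x + h *\<^sub>R axis a 1) - f x) / h) = - integral half_space (layer a h)"
    unfolding l integral_divide integral_diff[OF s(2) integrable_f] integral_diff[OF integrable_f s(1)] s(3)
    by (simp only: minus_divide_left minus_diff_eq)
qed

lemma radius_exists:
  obtains R where "\<And>x. x \<in> half_space \<Longrightarrow> x \<notin> cball 0 R \<Longrightarrow> f x = 0"
    "\<And>x s. x \<in> half_space \<Longrightarrow> x \<notin> cball 0 R \<Longrightarrow> 0 \<le> s \<Longrightarrow> s \<le> 1 \<Longrightarrow> f (x + s *\<^sub>R axis a 1) = 0"
proof -
  obtain r where r: "\<And>x. x \<in> C \<Longrightarrow> norm x \<le> r" using C compact_imp_bounded bounded_iff by metis
  \<comment> \<open>The extra 1 in the radius leaves room for shifts of length at most 1.\<close>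
  have 1: "f x = 0" if "x \<in> half_space" "x \<notin> cball 0 (r + 1)" for x
    using support[OF that(1)] r[of x] that(2) by (auto simp: not_le)
  have 2: "f (x + s *\<^sub>R axis a 1) = 0" if "x \<in> half_space" "x \<notin> cball 0 (r + 1)" "0 \<le> s" "s \<le> 1" for x s
  proof (rule support)
    show "x + s *\<^sub>R axis a 1 \<in> half_space" by (rule half_space_ray[OF that(1,3)])
    have "norm x \<le> norm (x + s *\<^sub>R axis a (1::real)) + norm (s *\<^sub>R axis a (1::real) :: real^4)"
      using norm_triangle_ineq4[of "x + s *\<^sub>R axis a 1" "s *\<^sub>R axis a (1::real)"] by simp
    also have "norm (s *\<^sub>R axis a (1::real) :: real^4) \<le> 1" using that by (simp add: norm_axis_1)
    finally have "r < norm (x + s *\<^sub>R axis a (1::real))" using that(2) by (simp add: not_le)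
    then show "x + s *\<^sub>R axis a 1 \<notin> C" using r by force
  qed
  show ?thesis by (rule that[OF 1 2])
qed

lemma cball_indicator_integrable:
  fixes B :: real
  shows "(\<lambda>x. if x \<in> cball 0 R then B else 0) integrable_on half_space"
proof -
  have "(\<lambda>x. if x \<in> cball 0 R then B else 0) absolutely_integrable_on half_space"
    by (rule absolutely_integrable_on_compact_support[of "half_space \<inter> cball 0 R"])
      (auto intro: closed_Int_compact closed_half_space intro!: continuous_on_eq[OF continuous_on_const[of _ B]])
  then show ?thesis using set_lebesgue_integral_eq_integral(1) by blast
qed

text \<open>By the mean value theorem every difference quotient is bounded by the bound for the
  derivative, and one ball contains all supports; this dominates the sequence.\<close>

lemma integral_hderiv_limit:
  "(\<lambda>n. - integral half_space (layer a (step n))) \<longlonglongrightarrow> integral half_space (\<lambda>x. hderiv f x (axis a 1))"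
proof -
  obtain R where R: "\<And>x. x \<in> half_space \<Longrightarrow> x \<notin> cball 0 R \<Longrightarrow> f x = 0"
    "\<And>x s. x \<in> half_space \<Longrightarrow> x \<notin> cball 0 R \<Longrightarrow> 0 \<le> s \<Longrightarrow> s \<le> 1 \<Longrightarrow> f (x + s *\<^sub>R axis a 1) = 0"
    using radius_exists[of a] by metis
  obtain B where B: "0 \<le> B" "\<And>x. x \<in> half_space \<Longrightarrow> \<bar>hderiv f x (axis a 1)\<bar> \<le> B"
    using hderiv_bounded[of "axis a 1"] by metis
  let ?q = "\<lambda>n x. (f (x + step n *\<^sub>R axis a 1) - f x) / step n"
  have "(\<lambda>n. integral half_space (?q n)) \<longlonglongrightarrow> integral half_space (\<lambda>x. hderiv f x (axis a 1))"
  proof (rule dominated_convergence(2))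
    show "?q n integrable_on half_space" for n
      using integral_shifted[OF less_imp_le[OF step_pos]] integrable_f
      by (intro integrable_on_divide integrable_diff)
    show "(\<lambda>x. if x \<in> cball 0 R then B else 0) integrable_on half_space" by (rule cball_indicator_integrable)
    show "norm (?q n x) \<le> (if x \<in> cball 0 R then B else 0)" if x: "x \<in> half_space" for n x
    proof (cases "x \<in> cball 0 R")
      case True
      obtain s where s: "0 < s" "f (x + step n *\<^sub>R axis a 1) - f x = step n * hderiv f (x + s *\<^sub>R axis a 1) (axis a 1)"
        using ray_mvt[OF x step_pos] by blast
      then have "?q n x = hderiv f (x + s *\<^sub>R axis a 1) (axis a 1)" using step_pos[of n] by simp
      then show ?thesis using B(2)[OF half_space_ray[OF x less_imp_le[OF s(1)]]] True by simp
    next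
      case False
      have "step n \<le> 1" by (simp add: step_def inverse_le_1_iff)
      then show ?thesis using R(1)[OF x False] R(2)[OF x False less_imp_le[OF step_pos]] False by simp
    qed
    show "(\<lambda>n. ?q n x) \<longlonglongrightarrow> hderiv f x (axis a 1)" if x: "x \<in> half_space" for x
    proof -
      have "((\<lambda>s. (f (x + s *\<^sub>R axis a 1) - f x) / s) \<longlongrightarrow> hderiv f x (axis a 1)) (at 0 within {0..})"
        using ray_derivative[OF x order_refl, of a] by (simp add: has_field_derivative_iff)
      moreover have "filterlim step (at 0 within {0..}) sequentially"
        using step_tendsto step_pos by (auto simp: filterlim_at less_le intro!: always_eventually)
      ultimately show ?thesis by (rule filterlim_compose)
    qed
  qed
  then show ?thesis by (simp only: integral_quotient[OF step_pos])
qed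

text \<open>Tangential shifts preserve the half-space, so the layer is empty for every step.\<close>

lemma integral_hderiv_tangential: "a \<noteq> 1 \<Longrightarrow> integral half_space (\<lambda>x. hderiv f x (axis a 1)) = 0"
proof -
  assume "a \<noteq> 1"
  then have "integral half_space (layer a (step n)) = integral half_space (\<lambda>x. 0)" for n
    by (intro integral_cong) (auto simp: layer_def half_space_def axis_def)
  then show ?thesis using integral_hderiv_limit[of a] LIMSEQ_unique[OF _ tendsto_const[of 0]] by simp
qed

lemma layer_normal: "y \<in> half_space \<Longrightarrow> layer 1 h y = (if h \<le> y $ 1 then 0 else f y / h)"
  by (simp add: layer_def half_space_def axis_def)

text \<open>Despite the factor 1/h the layer functions stay bounded, since f vanishes on the
  hyperplane and hence is at most h times the derivative bound inside the layer. Every interior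
  point leaves the layers eventually, so they converge to 0 pointwise.\<close>

lemma integral_hderiv_normal_0:
  assumes bd: "\<And>x. x $ 1 = 0 \<Longrightarrow> f x = 0"
  shows "integral half_space (\<lambda>x. hderiv f x (axis 1 1)) = 0"
proof -
  obtain R where R: "\<And>x. x \<in> half_space \<Longrightarrow> x \<notin> cball 0 R \<Longrightarrow> f x = 0" using radius_exists by metis
  obtain B where B: "0 \<le> B" "\<And>x. x \<in> half_space \<Longrightarrow> \<bar>hderiv f x (axis 1 1)\<bar> \<le> B"
    using hderiv_bounded[of "axis 1 1"] by metis
  have "(\<lambda>n. integral half_space (layer 1 (step n))) \<longlonglongrightarrow> integral half_space (\<lambda>x. 0)"
  proof (rule dominated_convergence(2))
    show "layer 1 (step n) integrable_on half_space" for n by (rule layer_integrable[OF step_pos])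
    show "(\<lambda>x. if x \<in> cball 0 R then B else 0) integrable_on half_space" by (rule cball_indicator_integrable)
    show "norm (layer 1 (step n) x) \<le> (if x \<in> cball 0 R then B else 0)" if x: "x \<in> half_space" for n x
    proof (cases "x \<in> cball 0 R \<and> 0 < x $ 1 \<and> x $ 1 < step n")
      case True
      \<comment> \<open>Foot of the perpendicular from x on the boundary hyperplane, where f
        vanishes.\<close>
      let ?z = "x - x $ 1 *\<^sub>R axis 1 1"
      have z: "?z \<in> half_space" "f ?z = 0" using bd[of ?z] by (auto simp: half_space_def axis_def)
      obtain s where s: "0 < s" "f (?z + x $ 1 *\<^sub>R axis 1 1) - f ?z = x $ 1 * hderiv f (?z + s *\<^sub>R axis 1 1) (axis 1 1)"
        using ray_mvt[OF z(1), of "x $ 1"] True by blast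
      then have "\<bar>f x\<bar> = x $ 1 * \<bar>hderiv f (?z + s *\<^sub>R axis 1 1) (axis 1 1)\<bar>"
        using z(2) True by (simp add: abs_mult)
      also have "\<dots> \<le> step n * B"
        by (intro mult_mono B(2) half_space_ray z(1)) (use True s step_pos[of n] in auto)
      finally show ?thesis using True step_pos[of n] by (simp add: layer_normal[OF x] divide_le_eq mult.commute)
    next
      case False
      then have "layer 1 (step n) x = 0"
        using R[OF x] bd[of x] x by (auto simp: layer_normal[OF x] half_space_def)
      then show ?thesis using B(1) by simp
    qed
    show "(\<lambda>n. layer 1 (step n) x) \<longlonglongrightarrow> 0" if x: "x \<in> half_space" for x
    proof (cases "x $ 1 = 0")
      case True
      then have "layer 1 (step n) x = 0" for n using bd[of x] by (auto simp: layer_normal[OF x])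
      then show ?thesis by simp
    next
      case False
      then have "0 < x $ 1" using x by (simp add: half_space_def)
      then have "eventually (\<lambda>n. step n < x $ 1) sequentially" using order_tendstoD(2)[OF step_tendsto] by blast
      then show ?thesis
        by (intro tendsto_eventually) (auto simp: layer_normal[OF x] elim: eventually_mono)
    qed
  qed
  then have "(\<lambda>n. - integral half_space (layer 1 (step n))) \<longlonglongrightarrow> 0" using tendsto_minus by fastforce
  then show ?thesis using LIMSEQ_unique[OF integral_hderiv_limit] by blast
qed

text \<open>The layer of thickness h contains a box of thickness h / 2 over a fixed cube of the
  hyperplane, on which f is at least half its value at x0. The factor 1/h cancels the thickness, so
  the lower bound for the layer integral does not depend on h.\<close>

lemma integral_hderiv_normal_neg:
  assumes nonneg: "\<And>x. x \<in> half_space \<Longrightarrow> 0 \<le> f x" and x0: "x0 $ 1 = 0" "0 < f x0"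
  shows "integral half_space (\<lambda>x. hderiv f x (axis 1 1)) < 0"
proof -
  have x0H: "x0 \<in> half_space" using x0 by (simp add: half_space_def)
  have "continuous (at x0 within half_space) f"
    using smooth_on_continuous[OF smooth] x0H by (simp add: continuous_on_eq_continuous_within)
  then obtain d where d: "0 < d" "\<And>x. x \<in> half_space \<Longrightarrow> dist x x0 < d \<Longrightarrow> dist (f x) (f x0) < f x0 / 2"
    using x0(2) unfolding continuous_within_eps_delta by (metis half_gt_zero)
  \<comment> \<open>The distance to x0 is at most the sum of four coordinate differences, each at
    most r, so 4 * r < d is required.\<close>
  define r where "r = min (d / 4) 1 / 2"
  have r: "0 < r" "4 * r < d" "r \<le> 1" using d by (auto simp: r_def min_def)
  define lo hi where "lo = (\<chi> i. if i = 1 then 0 else x0 $ i - r)"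
    and "hi h = (\<chi> i. if i = 1 then h / 2 else x0 $ i + r)" for h :: real
  \<comment> \<open>The number 4 * r^3 is the volume (h / 2) * (2 * r)^3 of the box divided by
    h.\<close>
  have "(f x0 / 2) * (4 * r ^ 3) \<le> integral half_space (layer 1 (step n))" if n: "step n < r" for n
  proof -
    let ?b = "cbox lo (hi (step n))"
    have b: "x \<in> ?b \<longleftrightarrow> 0 \<le> x $ 1 \<and> x $ 1 \<le> step n / 2 \<and> (\<forall>i. i \<noteq> 1 \<longrightarrow> x0 $ i - r \<le> x $ i \<and> x $ i \<le> x0 $ i + r)" for x
      unfolding mem_box_cart lo_def hi_def by auto
    have sub: "?b \<subseteq> half_space" using b by (auto simp: half_space_def)
    have ne: "?b \<noteq> {}" unfolding interval_ne_empty_cart using step_pos[of n] r by (auto simp: lo_def hi_def)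
    have val: "(f x0 / 2) / step n \<le> layer 1 (step n) x" if x: "x \<in> ?b" for x
    proof -
      have "dist x x0 \<le> (\<Sum>i\<in>UNIV. \<bar>(x - x0) $ i\<bar>)" unfolding dist_norm by (rule norm_le_l1_cart)
      also have "\<dots> \<le> (\<Sum>i\<in>(UNIV::4 set). r)"
      proof (rule sum_mono)
        fix i :: 4 show "\<bar>(x - x0) $ i\<bar> \<le> r"
          using x n x0 unfolding b by (cases "i = 1") (auto simp: abs_le_iff algebra_simps)
      qed
      also have "\<dots> < d" using r by simp
      finally have "dist (f x) (f x0) < f x0 / 2" using d sub x by blast
      then have "f x0 / 2 \<le> f x" unfolding dist_real_def by linarith
      moreover have "x $ 1 < step n" using x step_pos[of n] unfolding b by linarith
      moreover have "x \<in> half_space" using sub x by blast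
      ultimately show ?thesis using step_pos[of n] by (simp add: layer_normal field_simps)
    qed
    have "measure lborel ?b = (\<Prod>i\<in>UNIV. hi (step n) $ i - lo $ i)" by (rule content_cbox_cart[OF ne])
    also have "\<dots> = step n / 2 * (2 * r) ^ 3"
      unfolding UNIV_4 by (simp add: lo_def hi_def power3_eq_cube)
    finally have "(f x0 / 2) * (4 * r ^ 3) = integral ?b (\<lambda>x. (f x0 / 2) / step n)"
      using step_pos[of n] by (simp add: field_simps)
    also have "\<dots> \<le> integral ?b (layer 1 (step n))"
      by (rule integral_le[OF _ integrable_on_subcbox[OF layer_integrable[OF step_pos] sub] val]) auto
    also have "\<dots> \<le> integral half_space (layer 1 (step n))"
      by (rule integral_subset_le[OF sub integrable_on_subcbox[OF layer_integrable[OF step_pos] sub] layer_integrable[OF step_pos]])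
        (use nonneg step_pos[of n] in \<open>auto simp: layer_normal\<close>)
    finally show ?thesis .
  qed
  then have "eventually (\<lambda>n. - integral half_space (layer 1 (step n)) \<le> - ((f x0 / 2) * (4 * r ^ 3))) sequentially"
    using order_tendstoD(2)[OF step_tendsto r(1)] by (auto elim: eventually_mono)
  then have "integral half_space (\<lambda>x. hderiv f x (axis 1 1)) \<le> - ((f x0 / 2) * (4 * r ^ 3))"
    by (rule tendsto_upperbound[OF integral_hderiv_limit]) simp
  also have "\<dots> < 0" using x0 r by simp
  finally show ?thesis .
qed

end

section \<open>Partitions of unity and the integral of a 4-form\<close>

lemma smooth_on_hopen_cover:
  assumes "hopen U" "\<And>x. x \<in> U \<Longrightarrow> \<exists>V. hopen V \<and> x \<in> V \<and> smooth_on (U \<inter> V) f"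
  shows "smooth_on U f"
proof (rule smooth_on_local)
  fix x assume "x \<in> U"
  then obtain V where V: "hopen V" "x \<in> V" "smooth_on (U \<inter> V) f" using assms by blast
  then obtain W where W: "open W" "V = half_space \<inter> W" by (auto simp: openin_open)
  have "U \<inter> W = U \<inter> V" using W hopen_subset[OF assms(1)] by auto
  then show "\<exists>W. open W \<and> x \<in> W \<and> smooth_on (U \<inter> W) f" using V W by (intro exI[of _ W]) auto
qed

text \<open>Separated from \<open>has_form_integral\<close> so that one partition can serve several
  forms.\<close>

definition partition_of_unity ::
  "'m::topological_space chart set \<Rightarrow> 'm set \<Rightarrow> nat \<Rightarrow> (nat \<Rightarrow> 'm chart) \<Rightarrow> (nat \<Rightarrow> 'm \<Rightarrow> real) \<Rightarrow> bool" where
  "partition_of_unity \<A> K n c \<rho> \<longleftrightarrow>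
     (\<forall>i<n. c i \<in> \<A> \<and> smooth_function \<A> (\<rho> i) \<and> (\<forall>p. 0 \<le> \<rho> i p) \<and>
               (\<exists>C. compact C \<and> C \<subseteq> chart_dom (c i) \<and> (\<forall>p. p \<notin> C \<longrightarrow> \<rho> i p = 0))) \<and>
     (\<forall>p\<in>K. (\<Sum>i<n. \<rho> i p) = 1)"

lemma has_form_integral_iff:
  "has_form_integral \<A> \<omega> I \<longleftrightarrow> (\<exists>K n c \<rho>. compact K \<and> vanishes_off \<A> K \<omega> \<and>
     partition_of_unity \<A> K n c \<rho> \<and> I = (\<Sum>i<n. chart_integral (c i) (\<rho> i) \<omega>))"
  unfolding has_form_integral_def partition_of_unity_def by blast


definition push :: "'m chart \<Rightarrow> (real^4 \<Rightarrow> real) \<Rightarrow> 'm \<Rightarrow> real" where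
  "push c \<beta> p = (if p \<in> chart_dom c then \<beta> (snd c p) else 0)"

context oriented_manifold
begin

lemma hopen_off_compact:
  assumes "c \<in> \<A>" "compact C"
  shows "hopen {x \<in> chart_img c. chart_inv c x \<notin> C}"
  using hopen_preimage[OF assms(1), of "- C"] compact_imp_closed[OF assms(2)] by (simp add: open_Compl)

text \<open>Inside the domain of c smoothness comes from the transition map. Near a point outside it
  the function is identically 0, because the compact set C is closed in a Hausdorff space and lies
  within that domain.\<close>

lemma smooth_function_push:
  assumes c: "c \<in> \<A>" and \<beta>: "smooth_on (chart_img c) \<beta>" and C: "compact C" "C \<subseteq> chart_dom c"
    and 0: "\<And>p. p \<in> chart_dom c \<Longrightarrow> p \<notin> C \<Longrightarrow> \<beta> (snd c p) = 0"
  shows "smooth_function \<A> (push c \<beta>)" "p \<notin> C \<Longrightarrow> push c \<beta> p = 0"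
proof -
  show 1: "push c \<beta> p = 0" if "p \<notin> C" for p using that 0 by (auto simp: push_def)
  show "smooth_function \<A> (push c \<beta>)"
    unfolding smooth_function_def
  proof
    fix c' assume c': "c' \<in> \<A>"
    show "smooth_on (chart_img c') (push c \<beta> \<circ> chart_inv c')"
    proof (rule smooth_on_hopen_cover[OF hopen_chart_img[OF c']])
      fix x assume x: "x \<in> chart_img c'"
      show "\<exists>V. hopen V \<and> x \<in> V \<and> smooth_on (chart_img c' \<inter> V) (push c \<beta> \<circ> chart_inv c')"
      proof (cases "chart_inv c' x \<in> chart_dom c")
        case True
        have eq: "chart_img c' \<inter> overlap c' c = overlap c' c" using overlap_subset[of c' c] by blast
        have "smooth_on (overlap c' c) (\<lambda>y. \<beta> (transition c' c y))"
          by (rule smooth_on_compose[OF smooth_transition[OF c' c] \<beta>])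
            (use transition_image[OF c' c] overlap_subset[of c c'] in blast)
        moreover have "\<beta> (transition c' c y) = (push c \<beta> \<circ> chart_inv c') y" if "y \<in> overlap c' c" for y
          using that by (simp add: push_def transition_eq overlap_iff[OF c'])
        ultimately have "smooth_on (overlap c' c) (push c \<beta> \<circ> chart_inv c')" by (simp cong: smooth_on_cong)
        then show ?thesis
          using True x eq hopen_overlap[OF c' c] overlap_iff[OF c'] by (intro exI[of _ "overlap c' c"]) simp
      next
        case False
        let ?V = "{x \<in> chart_img c'. chart_inv c' x \<notin> C}"
        have "smooth_on (chart_img c' \<inter> ?V) (push c \<beta> \<circ> chart_inv c') = smooth_on (chart_img c' \<inter> ?V) (\<lambda>y. 0 :: real)"
          by (rule smooth_on_cong) (auto simp: 1)
        then show ?thesis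
          using hopen_off_compact[OF c' C(1)] False C(2) x by (intro exI[of _ ?V]) auto
      qed
    qed
  qed
qed

lemma compact_chart_inv_image:
  assumes "c \<in> \<A>" "compact K" "K \<subseteq> chart_img c"
  shows "compact (chart_inv c ` K)" "chart_inv c ` K \<subseteq> chart_dom c"
proof -
  have "continuous_on K (chart_inv c)"
    using homeomorphism_cont2[OF chart_homeo[OF assms(1)]] assms(3) by (rule continuous_on_subset)
  then show "compact (chart_inv c ` K)" using assms(2) by (rule compact_continuous_image)
  show "chart_inv c ` K \<subseteq> chart_dom c" using chart_inv_dom[OF assms(1)] assms(3) by blast
qed

lemma compact_chart_image:
  assumes "c \<in> \<A>" "compact C" "C \<subseteq> chart_dom c"
  shows "compact (snd c ` C)" "snd c ` C \<subseteq> chart_img c"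
proof -
  have "continuous_on C (snd c)"
    using homeomorphism_cont1[OF chart_homeo[OF assms(1)]] assms(3) by (rule continuous_on_subset)
  then show "compact (snd c ` C)" using assms(2) by (rule compact_continuous_image)
  show "snd c ` C \<subseteq> chart_img c" using assms(3) by blast
qed

text \<open>The extra open set W lets the support avoid the boundary or stay where a coefficient
  keeps its sign. The compact carrier may touch the boundary, being a ball cut by the
  half-space.\<close>

lemma chart_bump:
  assumes "c \<in> \<A>" "x0 \<in> chart_img c" "open W" "x0 \<in> W"
  obtains \<beta> :: "real^4 \<Rightarrow> real" and K r where "\<And>S. smooth_on S \<beta>" "\<And>x. 0 \<le> \<beta> x" "\<And>x. \<beta> x \<le> 1" "0 < r"
    "\<And>x. dist x0 x < r \<Longrightarrow> \<beta> x = 1" "compact K" "K \<subseteq> chart_img c \<inter> W"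
    "\<And>x. x \<in> half_space \<Longrightarrow> x \<notin> K \<Longrightarrow> \<beta> x = 0"
proof -
  obtain V where V: "open V" "chart_img c = half_space \<inter> V"
    using hopen_chart_img[OF assms(1)] by (auto simp: openin_open)
  have "open (V \<inter> W)" "x0 \<in> V \<inter> W" using V assms by auto
  then obtain d where d: "0 < d" "cball x0 d \<subseteq> V \<inter> W" using open_contains_cball by metis
  obtain \<beta> :: "real^4 \<Rightarrow> real" where \<beta>: "\<And>k. ck_on k UNIV \<beta>" "\<And>x. 0 \<le> \<beta> x" "\<And>x. \<beta> x \<le> 1"
    "\<And>x. dist x0 x < d / 2 \<Longrightarrow> \<beta> x = 1" "\<And>x. d \<le> dist x0 x \<Longrightarrow> \<beta> x = 0"
    using bump_exists[OF d(1), of x0] by metis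
  show ?thesis
  proof (rule that[of \<beta> "d / 2" "half_space \<inter> cball x0 d"])
    show "smooth_on S \<beta>" for S by (rule smooth_on_ck[OF open_UNIV]) (use \<beta>(1) in auto)
    show "compact (half_space \<inter> cball x0 d)" by (rule closed_Int_compact[OF closed_half_space compact_cball])
  qed (use \<beta> d V in \<open>auto simp: not_le less_imp_le\<close>)
qed

lemma smooth_function_continuous: "smooth_function \<A> \<rho> \<Longrightarrow> c \<in> \<A> \<Longrightarrow> smooth_on (chart_img c) (\<lambda>x. \<rho> (chart_inv c x))"
  by (auto simp: smooth_function_def o_def)

lemma smooth_function_mult: "smooth_function \<A> \<rho> \<Longrightarrow> smooth_function \<A> \<sigma> \<Longrightarrow> smooth_function \<A> (\<lambda>p. \<rho> p * \<sigma> p)"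
  by (auto simp: smooth_function_def o_def intro: smooth_on_mult)

lemma sum_telescoping_partition: "(\<Sum>i<(n::nat). \<theta> i * (\<Prod>j<i. 1 - \<theta> j)) = 1 - (\<Prod>j<n. 1 - \<theta> j :: real)"
  by (induction n) (auto simp: algebra_simps)

text \<open>The charts are prescribed through \<open>cc\<close>, so that a constant
  \<open>cc\<close> yields a partition inside a single chart.\<close>

lemma partition_of_unity_exists:
  assumes K: "compact K" and cc: "\<And>p. p \<in> K \<Longrightarrow> cc p \<in> \<A> \<and> p \<in> chart_dom (cc p)"
  obtains n c \<rho> where "partition_of_unity \<A> K n c \<rho>" "\<And>i. i < n \<Longrightarrow> c i \<in> cc ` K"
proof -
  have "\<exists>\<theta> N C. smooth_function \<A> \<theta> \<and> (\<forall>q. 0 \<le> \<theta> q \<and> \<theta> q \<le> 1) \<and> open N \<and> p \<in> N \<and> (\<forall>q\<in>N. \<theta> q = 1)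
      \<and> compact C \<and> C \<subseteq> chart_dom (cc p) \<and> (\<forall>q. q \<notin> C \<longrightarrow> \<theta> q = (0::real))" if p: "p \<in> K" for p
  proof -
    let ?c = "cc p"
    have c: "?c \<in> \<A>" "p \<in> chart_dom ?c" using cc[OF p] by auto
    obtain \<beta> :: "real^4 \<Rightarrow> real" and L r where \<beta>: "\<And>S. smooth_on S \<beta>" "\<And>x. 0 \<le> \<beta> x" "\<And>x. \<beta> x \<le> 1" "0 < r"
      "\<And>x. dist (snd ?c p) x < r \<Longrightarrow> \<beta> x = 1" "compact L" "L \<subseteq> chart_img ?c \<inter> UNIV"
      "\<And>x. x \<in> half_space \<Longrightarrow> x \<notin> L \<Longrightarrow> \<beta> x = 0"
      by (rule chart_bump[OF c(1) imageI[OF c(2)] open_UNIV UNIV_I], rule that)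
    have L: "L \<subseteq> chart_img ?c" using \<beta>(7) by simp
    let ?C = "chart_inv ?c ` L"
    have 0: "\<beta> (snd ?c q) = 0" if "q \<in> chart_dom ?c" "q \<notin> ?C" for q
    proof (rule \<beta>(8))
      show "snd ?c q \<in> half_space" using hopen_subset[OF hopen_chart_img[OF c(1)]] that by auto
      show "snd ?c q \<notin> L" using that chart_inv_chart[OF c(1) that(1)] by (metis imageI)
    qed
    note sf = smooth_function_push[OF c(1) \<beta>(1) compact_chart_inv_image[OF c(1) \<beta>(6) L] 0]
    let ?N = "chart_dom ?c \<inter> snd ?c -` ball (snd ?c p) r"
    have "open ?N"
      by (rule continuous_open_preimage[OF homeomorphism_cont1[OF chart_homeo[OF c(1)]] open_chart_dom[OF c(1)] open_ball])
    moreover have "p \<in> ?N" using c \<beta>(4) by simp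
    moreover have "\<forall>q\<in>?N. push ?c \<beta> q = 1" using \<beta>(5) by (simp add: push_def)
    moreover have "\<forall>q. 0 \<le> push ?c \<beta> q \<and> push ?c \<beta> q \<le> 1" using \<beta>(2,3) by (simp add: push_def)
    moreover have "\<forall>q. q \<notin> ?C \<longrightarrow> push ?c \<beta> q = 0" using sf(2) by blast
    ultimately show ?thesis
      using sf(1) compact_chart_inv_image[OF c(1) \<beta>(6) L]
      by (intro exI[of _ "push ?c \<beta>"] exI[of _ ?N] exI[of _ ?C] conjI)
  qed
  then obtain \<theta> N C where \<theta>: "\<And>p. p \<in> K \<Longrightarrow> smooth_function \<A> (\<theta> p) \<and> (\<forall>q. 0 \<le> \<theta> p q \<and> \<theta> p q \<le> 1) \<and> open (N p)
      \<and> p \<in> N p \<and> (\<forall>q\<in>N p. \<theta> p q = 1) \<and> compact (C p) \<and> C p \<subseteq> chart_dom (cc p) \<and> (\<forall>q. q \<notin> C p \<longrightarrow> \<theta> p q = (0::real))"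
    by metis
  obtain D where D: "D \<subseteq> K" "finite D" "K \<subseteq> (\<Union>p\<in>D. N p)"
    using compactE_image[OF K, of K N] \<theta> by blast
  obtain h n where h: "bij_betw h {0..<n::nat} D" using ex_bij_betw_nat_finite[OF D(2)] by blast
  have hK: "h i \<in> K" if "i < n" for i using bij_betwE[OF h] D(1) that by auto
  \<comment> \<open>Each bump is multiplied by what the earlier ones left over. The sum telescopes
    to 1 minus the product of all 1 - \<theta>, and this product vanishes wherever some bump equals
    1.\<close>
  define \<rho> where "\<rho> i p = \<theta> (h i) p * (\<Prod>j<i. 1 - \<theta> (h j) p)" for i p
  show ?thesis
  proof (rule that[of n "\<lambda>i. cc (h i)" \<rho>])
    show "cc (h i) \<in> cc ` K" if "i < n" for i using hK[OF that] by blast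
    have sm: "smooth_function \<A> (\<rho> i)" if "i < n" for i
      unfolding smooth_function_def o_def \<rho>_def
      using \<theta>[OF hK] that
      by (intro ballI smooth_on_mult smooth_on_prod smooth_on_diff smooth_on_const smooth_function_continuous) auto
    have nn: "0 \<le> \<rho> i p" if "i < n" for i p
      unfolding \<rho>_def using \<theta>[OF hK] that by (intro mult_nonneg_nonneg prod_nonneg) auto
    have supp: "\<exists>C. compact C \<and> C \<subseteq> chart_dom (cc (h i)) \<and> (\<forall>p. p \<notin> C \<longrightarrow> \<rho> i p = 0)" if "i < n" for i
      using \<theta>[OF hK[OF that]] by (intro exI[of _ "C (h i)"]) (auto simp: \<rho>_def)
    have one: "(\<Sum>i<n. \<rho> i p) = 1" if pK: "p \<in> K" for p
    proof -
      obtain q where q: "q \<in> D" "p \<in> N q" using D(3) pK by blast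
      then obtain j where j: "j < n" "h j = q" using h by (auto simp: bij_betw_def)
      have "\<theta> q p = 1" using \<theta>[OF subsetD[OF D(1) q(1)]] q(2) by blast
      then have "\<exists>j\<in>{..<n}. 1 - \<theta> (h j) p = 0" using j by (intro bexI[of _ j]) auto
      then have "(\<Prod>j<n. 1 - \<theta> (h j) p) = 0" by (intro prod_zero) auto
      then show ?thesis unfolding \<rho>_def sum_telescoping_partition by simp
    qed
    show "partition_of_unity \<A> K n (\<lambda>i. cc (h i)) \<rho>"
      unfolding partition_of_unity_def
      by (intro conjI allI impI ballI sm nn supp one conjunct1[OF cc[OF hK]])
  qed
qed

section \<open>Independence of the integral from charts and partitions\<close>

lemma chart_integral_frame:
  "chart_integral c \<rho> \<omega> = integral (chart_img c) (\<lambda>x. \<rho> (chart_inv c x) * \<omega> c x frame)"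
  by (simp add: chart_integral_def frame_def)

lemma chart_integrand_integrable:
  assumes \<omega>: "smooth_form \<A> 4 \<omega>" and c: "c \<in> \<A>" and \<rho>: "smooth_function \<A> \<rho>"
    and C: "compact C" "C \<subseteq> chart_dom c" "\<And>p. p \<notin> C \<Longrightarrow> \<rho> p = 0"
  shows "(\<lambda>x. \<rho> (chart_inv c x) * \<omega> c x frame) absolutely_integrable_on (chart_img c)"
proof (rule absolutely_integrable_on_compact_support[of "snd c ` C"])
  show "compact (snd c ` C)" "snd c ` C \<subseteq> chart_img c" by (rule compact_chart_image[OF c C(1,2)])+
  then show "continuous_on (snd c ` C) (\<lambda>x. \<rho> (chart_inv c x) * \<omega> c x frame)"
    by (intro continuous_on_subset[OF smooth_on_continuous[OF smooth_on_mult[OF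
            smooth_function_continuous[OF \<rho> c] smooth_form_smooth[OF \<omega> c]]]])
  fix x assume x: "x \<in> chart_img c - snd c ` C"
  have "chart_inv c x \<notin> C"
  proof
    assume "chart_inv c x \<in> C"
    then have "snd c (chart_inv c x) \<in> snd c ` C" by (rule imageI)
    then show False using x chart_chart_inv[OF c, of x] by simp
  qed
  then show "\<rho> (chart_inv c x) * \<omega> c x frame = 0" by (simp add: C(3))
qed

lemma smooth_form_det:
  assumes "smooth_form \<A> 4 \<omega>" "c \<in> \<A>" "c' \<in> \<A>" "x \<in> overlap c c'"
  shows "\<omega> c x frame = det (matrix (hderiv (transition c c') x)) * \<omega> c' (transition c c' x) frame"
proof -
  have "transition c c' x \<in> chart_img c'" using transition_overlap[OF assms(2-4)] overlap_subset by blast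
  then show ?thesis
    unfolding smooth_form_transition[OF assms]
    by (rule alternating_det[OF smooth_form_alternating[OF assms(1,3)] linear_transition[OF assms(2-4)]])
qed

text \<open>The weight vanishes off C, so both integrals may be restricted to the overlap. There the
  transition map is injective and the form changes by exactly its Jacobian.\<close>

lemma chart_integral_change:
  assumes \<omega>: "smooth_form \<A> 4 \<omega>" and c: "c \<in> \<A>" "c' \<in> \<A>" and \<phi>: "smooth_function \<A> \<phi>"
    and C: "compact C" "C \<subseteq> chart_dom c" "C \<subseteq> chart_dom c'" "\<And>p. p \<notin> C \<Longrightarrow> \<phi> p = 0"
  shows "chart_integral c \<phi> \<omega> = chart_integral c' \<phi> \<omega>"
proof -
  let ?g = "\<lambda>c x. \<phi> (chart_inv c x) * \<omega> c x frame"
  let ?T = "transition c c'"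
  let ?O = "overlap c c'"
  have restrict: "(?g d) absolutely_integrable_on overlap d d'" "integral (chart_img d) (?g d) = integral (overlap d d') (?g d)"
    if "d \<in> \<A>" "d' \<in> \<A>" "C \<subseteq> chart_dom d" "C \<subseteq> chart_dom d'" for d d'
  proof -
    have ai: "(?g d) absolutely_integrable_on chart_img d"
      by (rule chart_integrand_integrable[OF \<omega> that(1) \<phi> C(1) that(3) C(4)])
    have 0: "?g d x = 0" if x: "x \<in> chart_img d - overlap d d'" for x
    proof -
      have "chart_inv d x \<notin> chart_dom d'" using x overlap_iff[OF \<open>d \<in> \<A>\<close>, of x d'] by blast
      then have "chart_inv d x \<notin> C" using \<open>C \<subseteq> chart_dom d'\<close> by blast
      then show ?thesis by (simp add: C(4))
    qed
    have eq: "(if x \<in> chart_img d then ?g d x else 0) = (if x \<in> overlap d d' then ?g d x else 0)" for x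
      using 0[of x] overlap_subset[of d d'] by auto
    show "integral (chart_img d) (?g d) = integral (overlap d d') (?g d)"
      by (subst (1 2) integral_restrict_UNIV[symmetric]) (simp only: eq)
    show "(?g d) absolutely_integrable_on overlap d d'"
      using ai by (subst (asm) absolutely_integrable_restrict_UNIV[symmetric], subst absolutely_integrable_restrict_UNIV[symmetric])
        (simp only: eq)
  qed
  \<comment> \<open>Orientation enters here: the Jacobian is positive and so equals its absolute
    value in the change of variables formula.\<close>
  have inv: "?g c x = \<bar>det (matrix (hderiv ?T x))\<bar> * ?g c' (?T x)" if x: "x \<in> ?O" for x
    using smooth_form_det[OF \<omega> c x] chart_inv_transition[OF c x] det_transition[OF c x] by simp
  \<comment> \<open>The change of variables formula concerns values in \<open>real^'n\<close>, so
    the scalar integrand is carried in \<open>real^1\<close>.\<close>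
  let ?v = "\<lambda>x. (vec (?g c' x) :: real^1)"
  have bl: "bounded_linear (vec :: real \<Rightarrow> real^1)"
    by (intro linear_conv_bounded_linear[THEN iffD1]) (auto simp: linear_iff vec_eq_iff)
  have "?v absolutely_integrable_on overlap c' c"
    using absolutely_integrable_linear[OF restrict(1)[OF c(2,1) C(3,2)] bl] by (simp add: o_def)
  then have v: "?v absolutely_integrable_on ?T ` ?O" by (simp add: transition_image[OF c])
  have meas: "?O \<in> sets lebesgue"
  proof -
    obtain V where "open V" "?O = half_space \<inter> V" using hopen_overlap[OF c] by (auto simp: openin_open)
    then have "?O \<in> sets borel" using closed_half_space by auto
    then show ?thesis by simp
  qed
  have "integral ?O (\<lambda>x. \<bar>det (matrix (hderiv ?T x))\<bar> *\<^sub>R ?v (?T x)) = integral (?T ` ?O) ?v"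
  proof -
    have "(?T has_derivative hderiv ?T x) (at x within ?O)" if "x \<in> ?O" for x
      by (rule has_derivative_subset[OF smooth_on_has_hderiv[OF hopen_overlap[OF c] smooth_transition[OF c] that]
            hopen_subset[OF hopen_overlap[OF c]]])
    from has_absolute_integral_change_of_variables[OF meas this inj_on_transition[OF c], of ?v "integral (?T ` ?O) ?v"]
    show ?thesis using v by blast
  qed
  moreover have "integral ?O (\<lambda>x. \<bar>det (matrix (hderiv ?T x))\<bar> *\<^sub>R ?v (?T x)) = integral ?O (\<lambda>x. vec (?g c x) :: real^1)"
    by (rule integral_cong) (simp add: inv vec_eq_iff)
  ultimately have "integral ?O (\<lambda>x. vec (?g c x) :: real^1) = integral (overlap c' c) ?v"
    by (simp only: transition_image[OF c])
  moreover have "integral S (\<lambda>x. vec (h x) :: real^1) = vec (integral S h)" if "h absolutely_integrable_on S" for h :: "real^4 \<Rightarrow> real" and S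
    using integral_linear[OF set_lebesgue_integral_eq_integral(1)[OF that] bl] by (simp add: o_def)
  ultimately have "integral ?O (?g c) = integral (overlap c' c) (?g c')"
    using restrict(1)[OF c C(2,3)] restrict(1)[OF c(2,1) C(3,2)] by (simp add: vec_eq_iff)
  then show ?thesis
    unfolding chart_integral_frame using restrict(2)[OF c C(2,3)] restrict(2)[OF c(2,1) C(3,2)] by simp
qed

lemma partition_of_unityD:
  assumes "partition_of_unity \<A> K n c \<rho>" "i < n"
  shows "c i \<in> \<A>" "smooth_function \<A> (\<rho> i)" "\<And>p. 0 \<le> \<rho> i p"
    "\<exists>C. compact C \<and> C \<subseteq> chart_dom (c i) \<and> (\<forall>p. p \<notin> C \<longrightarrow> \<rho> i p = 0)"
  using assms unfolding partition_of_unity_def by blast+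

lemma vanishes_offD:
  assumes "vanishes_off \<A> K \<omega>" "c \<in> \<A>" "x \<in> chart_img c" "chart_inv c x \<notin> K"
  shows "\<omega> c x vs = 0"
proof -
  have "\<omega> c (snd c (chart_inv c x)) vs = 0"
    using assms(1,2) DiffI[OF chart_inv_dom[OF assms(2,3)] assms(4)] unfolding vanishes_off_def by blast
  then show ?thesis by (simp only: chart_chart_inv[OF assms(2,3)])
qed

lemma chart_integral_partition:
  assumes \<omega>: "smooth_form \<A> 4 \<omega>" "vanishes_off \<A> K \<omega>" and P: "partition_of_unity \<A> K n c \<rho>"
    and d: "d \<in> \<A>" "smooth_function \<A> \<sigma>" "compact C" "C \<subseteq> chart_dom d" "\<And>p. p \<notin> C \<Longrightarrow> \<sigma> p = 0"
  shows "chart_integral d \<sigma> \<omega> = (\<Sum>j<n. chart_integral d (\<lambda>p. \<sigma> p * \<rho> j p) \<omega>)"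
proof -
  have "chart_integral d \<sigma> \<omega> = integral (chart_img d) (\<lambda>x. \<Sum>j<n. \<sigma> (chart_inv d x) * \<rho> j (chart_inv d x) * \<omega> d x frame)"
    unfolding chart_integral_frame
  proof (rule integral_cong)
    fix x assume x: "x \<in> chart_img d"
    show "\<sigma> (chart_inv d x) * \<omega> d x frame = (\<Sum>j<n. \<sigma> (chart_inv d x) * \<rho> j (chart_inv d x) * \<omega> d x frame)"
    proof (cases "chart_inv d x \<in> K")
      case True
      then have "(\<Sum>j<n. \<rho> j (chart_inv d x)) = 1" using P by (simp add: partition_of_unity_def)
      then show ?thesis by (simp flip: sum_distrib_left sum_distrib_right)
    next
      case False
      then show ?thesis using vanishes_offD[OF \<omega>(2) d(1) x] by simp
    qed
  qed
  also have "\<dots> = (\<Sum>j<n. integral (chart_img d) (\<lambda>x. \<sigma> (chart_inv d x) * \<rho> j (chart_inv d x) * \<omega> d x frame))"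
  proof (rule integral_sum)
    fix j assume "j \<in> {..<n}"
    then have j: "j < n" by simp
    have "(\<lambda>x. \<sigma> (chart_inv d x) * \<rho> j (chart_inv d x) * \<omega> d x frame) absolutely_integrable_on chart_img d"
      by (rule chart_integrand_integrable[OF \<omega>(1) d(1) smooth_function_mult[OF d(2) partition_of_unityD(2)[OF P j]] d(3,4)])
        (simp add: d(5))
    then show "(\<lambda>x. \<sigma> (chart_inv d x) * \<rho> j (chart_inv d x) * \<omega> d x frame) integrable_on chart_img d"
      by (rule set_lebesgue_integral_eq_integral(1))
  qed simp
  finally show ?thesis by (simp add: chart_integral_frame)
qed

text \<open>Both partitions are refined by the products of their functions. A product is supported
  in both charts, so its two chart integrals agree, and the double sum can be read in either
  order.\<close>

lemma partition_integral_unique: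
  assumes \<omega>: "smooth_form \<A> 4 \<omega>"
    and K: "vanishes_off \<A> K \<omega>" "partition_of_unity \<A> K n c \<rho>"
    and K': "vanishes_off \<A> K' \<omega>" "partition_of_unity \<A> K' n' c' \<rho>'"
  shows "(\<Sum>i<n. chart_integral (c i) (\<rho> i) \<omega>) = (\<Sum>j<n'. chart_integral (c' j) (\<rho>' j) \<omega>)"
proof -
  have "(\<Sum>i<n. chart_integral (c i) (\<rho> i) \<omega>) = (\<Sum>i<n. \<Sum>j<n'. chart_integral (c i) (\<lambda>p. \<rho> i p * \<rho>' j p) \<omega>)"
  proof (rule sum.cong)
    fix i assume "i \<in> {..<n}"
    then have i: "i < n" by simp
    then obtain C where "compact C" "C \<subseteq> chart_dom (c i)" "\<forall>p. p \<notin> C \<longrightarrow> \<rho> i p = 0"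
      using partition_of_unityD(4)[OF K(2)] by blast
    then show "chart_integral (c i) (\<rho> i) \<omega> = (\<Sum>j<n'. chart_integral (c i) (\<lambda>p. \<rho> i p * \<rho>' j p) \<omega>)"
      using partition_of_unityD(1,2)[OF K(2) i] by (intro chart_integral_partition[OF \<omega> K']) auto
  qed simp
  also have "\<dots> = (\<Sum>i<n. \<Sum>j<n'. chart_integral (c' j) (\<lambda>p. \<rho>' j p * \<rho> i p) \<omega>)"
  proof (intro sum.cong refl)
    fix i j assume "i \<in> {..<n}" "j \<in> {..<n'}"
    then have i: "i < n" and j: "j < n'" by auto
    obtain C where C: "compact C" "C \<subseteq> chart_dom (c i)" "\<forall>p. p \<notin> C \<longrightarrow> \<rho> i p = 0"
      using partition_of_unityD(4)[OF K(2) i] by blast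
    obtain C' where C': "compact C'" "C' \<subseteq> chart_dom (c' j)" "\<forall>p. p \<notin> C' \<longrightarrow> \<rho>' j p = 0"
      using partition_of_unityD(4)[OF K'(2) j] by blast
    have "chart_integral (c i) (\<lambda>p. \<rho> i p * \<rho>' j p) \<omega> = chart_integral (c' j) (\<lambda>p. \<rho> i p * \<rho>' j p) \<omega>"
      by (rule chart_integral_change[OF \<omega> partition_of_unityD(1)[OF K(2) i] partition_of_unityD(1)[OF K'(2) j]
            smooth_function_mult[OF partition_of_unityD(2)[OF K(2) i] partition_of_unityD(2)[OF K'(2) j]], of "C \<inter> C'"])
        (use C C' in \<open>auto intro: compact_Int\<close>)
    then show "chart_integral (c i) (\<lambda>p. \<rho> i p * \<rho>' j p) \<omega> = chart_integral (c' j) (\<lambda>p. \<rho>' j p * \<rho> i p) \<omega>"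
      by (simp add: mult.commute)
  qed
  also have "\<dots> = (\<Sum>j<n'. \<Sum>i<n. chart_integral (c' j) (\<lambda>p. \<rho>' j p * \<rho> i p) \<omega>)" by (rule sum.swap)
  also have "\<dots> = (\<Sum>j<n'. chart_integral (c' j) (\<rho>' j) \<omega>)"
  proof (rule sum.cong)
    fix j assume "j \<in> {..<n'}"
    then have j: "j < n'" by simp
    then obtain C where "compact C" "C \<subseteq> chart_dom (c' j)" "\<forall>p. p \<notin> C \<longrightarrow> \<rho>' j p = 0"
      using partition_of_unityD(4)[OF K'(2)] by blast
    then show "(\<Sum>i<n. chart_integral (c' j) (\<lambda>p. \<rho>' j p * \<rho> i p) \<omega>) = chart_integral (c' j) (\<rho>' j) \<omega>"
      using partition_of_unityD(1,2)[OF K'(2) j] by (intro chart_integral_partition[OF \<omega> K, symmetric]) auto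
  qed simp
  finally show ?thesis .
qed

lemma form_integral_partition:
  assumes "smooth_form \<A> 4 \<omega>" "compact K" "vanishes_off \<A> K \<omega>" "partition_of_unity \<A> K n c \<rho>"
  shows "form_integral \<A> \<omega> = (\<Sum>i<n. chart_integral (c i) (\<rho> i) \<omega>)"
  unfolding form_integral_def
proof (rule the_equality)
  show "has_form_integral \<A> \<omega> (\<Sum>i<n. chart_integral (c i) (\<rho> i) \<omega>)"
    unfolding has_form_integral_iff using assms by blast
next
  fix I assume "has_form_integral \<A> \<omega> I"
  then show "I = (\<Sum>i<n. chart_integral (c i) (\<rho> i) \<omega>)"
    unfolding has_form_integral_iff using partition_integral_unique[OF assms(1) _ _ assms(3,4)] by blast
qed

lemma has_form_integral_cong:
  assumes "\<And>c x vs. c \<in> \<A> \<Longrightarrow> x \<in> chart_img c \<Longrightarrow> \<omega> c x vs = \<eta> c x vs"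
    and "has_form_integral \<A> \<omega> I"
  shows "has_form_integral \<A> \<eta> I"
proof -
  obtain K n c \<rho> where K: "compact K" "vanishes_off \<A> K \<omega>" "partition_of_unity \<A> K n c \<rho>"
    "I = (\<Sum>i<n. chart_integral (c i) (\<rho> i) \<omega>)"
    using assms(2) unfolding has_form_integral_iff by blast
  have "vanishes_off \<A> K \<eta>"
    using K(2) assms(1) unfolding vanishes_off_def by auto
  moreover have "chart_integral d \<sigma> \<omega> = chart_integral d \<sigma> \<eta>" if "d \<in> \<A>" for d \<sigma>
    unfolding chart_integral_frame using assms(1)[OF that] by (intro integral_cong) simp
  then have "I = (\<Sum>i<n. chart_integral (c i) (\<rho> i) \<eta>)"
    using partition_of_unityD(1)[OF K(3)] K(4) by simp
  ultimately show ?thesis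
    unfolding has_form_integral_iff using K(1,3) by (intro exI conjI)
qed

lemma form_integral_cong:
  assumes "\<And>c x vs. c \<in> \<A> \<Longrightarrow> x \<in> chart_img c \<Longrightarrow> \<omega> c x vs = \<eta> c x vs"
  shows "form_integral \<A> \<omega> = form_integral \<A> \<eta>"
proof -
  have "has_form_integral \<A> \<omega> I = has_form_integral \<A> \<eta> I" for I
    using has_form_integral_cong[of \<omega> \<eta>] has_form_integral_cong[of \<eta> \<omega>] assms by auto
  then show ?thesis by (simp add: form_integral_def)
qed

text \<open>One compact set carries all the forms, so a single partition evaluates every
  integral.\<close>

lemma form_integral_sum:
  assumes "compact K" "\<And>m. m \<in> M \<Longrightarrow> smooth_form \<A> 4 (\<omega> m)" "\<And>m. m \<in> M \<Longrightarrow> vanishes_off \<A> K (\<omega> m)" "finite M"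
  shows "form_integral \<A> (\<lambda>c x vs. \<Sum>m\<in>M. \<omega> m c x vs) = (\<Sum>m\<in>M. form_integral \<A> (\<omega> m))"
proof -
  have "\<forall>p. \<exists>c. c \<in> \<A> \<and> p \<in> chart_dom c" using chart_exists by blast
  then obtain cc where cc: "\<forall>p. cc p \<in> \<A> \<and> p \<in> chart_dom (cc p)" by (rule choice[THEN exE])
  obtain n c \<rho> where P: "partition_of_unity \<A> K n c \<rho>"
    by (rule partition_of_unity_exists[OF assms(1) spec[OF cc]], rule that)
  have "vanishes_off \<A> K (\<lambda>c x vs. \<Sum>m\<in>M. \<omega> m c x vs)"
    using assms(3) unfolding vanishes_off_def by (auto intro!: sum.neutral)
  then have "form_integral \<A> (\<lambda>c x vs. \<Sum>m\<in>M. \<omega> m c x vs)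
      = (\<Sum>i<n. chart_integral (c i) (\<rho> i) (\<lambda>c x vs. \<Sum>m\<in>M. \<omega> m c x vs))"
    by (intro form_integral_partition[OF _ assms(1) _ P] smooth_form_sum assms(2))
  also have "\<dots> = (\<Sum>i<n. \<Sum>m\<in>M. chart_integral (c i) (\<rho> i) (\<omega> m))"
  proof (rule sum.cong)
    fix i assume "i \<in> {..<n}"
    then have i: "i < n" by simp
    obtain C where C: "compact C" "C \<subseteq> chart_dom (c i)" "\<forall>p. p \<notin> C \<longrightarrow> \<rho> i p = 0"
      using partition_of_unityD(4)[OF P i] by blast
    have "(\<lambda>x. \<rho> i (chart_inv (c i) x) * \<omega> m (c i) x frame) integrable_on chart_img (c i)" if "m \<in> M" for m
      by (rule set_lebesgue_integral_eq_integral(1)[OF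
            chart_integrand_integrable[OF assms(2)[OF that] partition_of_unityD(1,2)[OF P i] C(1,2)]])
        (use C(3) in blast)
    then show "chart_integral (c i) (\<rho> i) (\<lambda>c x vs. \<Sum>m\<in>M. \<omega> m c x vs) = (\<Sum>m\<in>M. chart_integral (c i) (\<rho> i) (\<omega> m))"
      unfolding chart_integral_frame sum_distrib_left by (intro integral_sum assms(4))
  qed simp
  also have "\<dots> = (\<Sum>m\<in>M. \<Sum>i<n. chart_integral (c i) (\<rho> i) (\<omega> m))" by (rule sum.swap)
  also have "\<dots> = (\<Sum>m\<in>M. form_integral \<A> (\<omega> m))"
    using assms by (intro sum.cong refl form_integral_partition[OF _ _ _ P, symmetric]) auto
  finally show ?thesis .
qed

lemma form_integral_chart:
  assumes \<omega>: "smooth_form \<A> 4 \<omega>" "vanishes_off \<A> K \<omega>" and K: "compact K" "K \<subseteq> chart_dom c" and c: "c \<in> \<A>"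
  shows "form_integral \<A> \<omega> = integral (chart_img c) (\<lambda>x. \<omega> c x frame)"
proof -
  have cK: "c \<in> \<A> \<and> p \<in> chart_dom c" if "p \<in> K" for p using that K(2) c by blast
  \<comment> \<open>The constant assignment forces every piece of the partition into the chart
    c.\<close>
  obtain n c' \<rho> where P: "partition_of_unity \<A> K n c' \<rho>" and c': "\<And>i. i < n \<Longrightarrow> c' i \<in> (\<lambda>p. c) ` K"
    by (rule partition_of_unity_exists[OF K(1), of "\<lambda>p. c", OF cK], assumption, rule that)
  have [simp]: "c' i = c" if "i < n" for i using c'[OF that] by auto
  have "form_integral \<A> \<omega> = (\<Sum>i<n. chart_integral c (\<rho> i) \<omega>)"
    unfolding form_integral_partition[OF \<omega>(1) K(1) \<omega>(2) P] by simp
  also have "\<dots> = integral (chart_img c) (\<lambda>x. \<Sum>i<n. \<rho> i (chart_inv c x) * \<omega> c x frame)"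
    unfolding chart_integral_frame
  proof (rule integral_sum[symmetric])
    fix i assume "i \<in> {..<n}"
    then have i: "i < n" by simp
    then obtain C where C: "compact C" "C \<subseteq> chart_dom c" "\<forall>p. p \<notin> C \<longrightarrow> \<rho> i p = 0"
      using partition_of_unityD(4)[OF P i] by auto
    show "(\<lambda>x. \<rho> i (chart_inv c x) * \<omega> c x frame) integrable_on chart_img c"
      by (rule set_lebesgue_integral_eq_integral(1)[OF
            chart_integrand_integrable[OF \<omega>(1) c partition_of_unityD(2)[OF P i] C(1,2)]]) (use C(3) in blast)
  qed simp
  also have "\<dots> = integral (chart_img c) (\<lambda>x. \<omega> c x frame)"
  proof (rule integral_cong)
    fix x assume x: "x \<in> chart_img c"
    show "(\<Sum>i<n. \<rho> i (chart_inv c x) * \<omega> c x frame) = \<omega> c x frame"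
    proof (cases "chart_inv c x \<in> K")
      case True
      then have "(\<Sum>j<n. \<rho> j (chart_inv c x)) = 1" using P by (simp add: partition_of_unity_def)
      then show ?thesis by (simp flip: sum_distrib_right)
    next
      case False
      then show ?thesis using vanishes_offD[OF \<omega>(2) c x] by simp
    qed
  qed
  finally show ?thesis .
qed

end

section \<open>Component calculus\<close>

type_synonym cov1 = "real^4 \<Rightarrow> real"
type_synonym cov2 = "real^4 \<Rightarrow> real^4 \<Rightarrow> real"
type_synonym cov3 = "real^4 \<Rightarrow> real^4 \<Rightarrow> real^4 \<Rightarrow> real"

text \<open>Components are functions of vectors that are constant in the chart. The exterior
  derivative is then an alternating sum of directional derivatives without bracket terms, and
  identities of forms become polynomial identities.\<close>

definition w11 :: "cov1 \<Rightarrow> cov1 \<Rightarrow> cov2" where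
  "w11 f g a b = f a * g b - f b * g a"

definition w12 :: "cov1 \<Rightarrow> cov2 \<Rightarrow> cov3" where
  "w12 f G a b c = f a * G b c - f b * G a c + f c * G a b"

definition w22 :: "cov2 \<Rightarrow> cov2 \<Rightarrow> real^4 \<Rightarrow> cov3" where
  "w22 G H a b c d = G a b * H c d - G a c * H b d + G a d * H b c + G b c * H a d - G b d * H a c + G c d * H a b"

definition w13 :: "cov1 \<Rightarrow> cov3 \<Rightarrow> real^4 \<Rightarrow> cov3" where
  "w13 f T a b c d = f a * T b c d - f b * T a c d + f c * T a b d - f d * T a b c"

definition d1 :: "(real^4 \<Rightarrow> cov1) \<Rightarrow> real^4 \<Rightarrow> cov2" where
  "d1 f x a b = hderiv (\<lambda>y. f y b) x a - hderiv (\<lambda>y. f y a) x b"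

definition d2 :: "(real^4 \<Rightarrow> cov2) \<Rightarrow> real^4 \<Rightarrow> cov3" where
  "d2 G x a b c = hderiv (\<lambda>y. G y b c) x a - hderiv (\<lambda>y. G y a c) x b + hderiv (\<lambda>y. G y a b) x c"

definition d3 :: "(real^4 \<Rightarrow> cov3) \<Rightarrow> real^4 \<Rightarrow> real^4 \<Rightarrow> cov3" where
  "d3 T x a b c d = hderiv (\<lambda>y. T y b c d) x a - hderiv (\<lambda>y. T y a c d) x b
     + hderiv (\<lambda>y. T y a b d) x c - hderiv (\<lambda>y. T y a b c) x d"

definition eps :: "(3 \<Rightarrow> 3 \<Rightarrow> real) \<Rightarrow> 3 \<Rightarrow> real" where
  "eps f i = (\<Sum>j\<in>UNIV. \<Sum>k\<in>UNIV. levi_civita i j k * f j k)"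

lemma eps_simps: "eps f 1 = f 2 3 - f 3 2" "eps f 2 = f 3 1 - f 1 3" "eps f 3 = f 1 2 - f 2 1"
  by (simp_all add: eps_def sum_3 levi_civita_def)

abbreviation cr11 :: "(3 \<Rightarrow> cov1) \<Rightarrow> (3 \<Rightarrow> cov1) \<Rightarrow> 3 \<Rightarrow> cov2" where
  "cr11 f g i \<equiv> \<lambda>a b. eps (\<lambda>j k. w11 (f j) (g k) a b) i"

abbreviation cr12 :: "(3 \<Rightarrow> cov1) \<Rightarrow> (3 \<Rightarrow> cov2) \<Rightarrow> 3 \<Rightarrow> cov3" where
  "cr12 f G i \<equiv> \<lambda>a b c. eps (\<lambda>j k. w12 (f j) (G k) a b c) i"

definition cF :: "(3 \<Rightarrow> real^4 \<Rightarrow> cov1) \<Rightarrow> 3 \<Rightarrow> real^4 \<Rightarrow> cov2" where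
  "cF A i y a b = d1 (A i) y a b + 1/2 * cr11 (\<lambda>i. A i y) (\<lambda>i. A i y) i a b"

definition cD :: "(3 \<Rightarrow> real^4 \<Rightarrow> cov1) \<Rightarrow> (3 \<Rightarrow> real^4 \<Rightarrow> cov1) \<Rightarrow> 3 \<Rightarrow> real^4 \<Rightarrow> cov2" where
  "cD A \<phi> i y a b = d1 (\<phi> i) y a b + cr11 (\<lambda>i. A i y) (\<lambda>i. \<phi> i y) i a b"

definition cE :: "(3 \<Rightarrow> real^4 \<Rightarrow> cov1) \<Rightarrow> 3 \<Rightarrow> real^4 \<Rightarrow> cov2" where
  "cE e i y a b = cr11 (\<lambda>i. e i y) (\<lambda>i. e i y) i a b"

text \<open>The formal derivative of the Lagrangian with respect to De, as \<open>cY\<close> is that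
  with respect to F. These momenta are the factors that integration by parts leaves on the
  boundary.\<close>

definition cX :: "(3 \<Rightarrow> real^4 \<Rightarrow> cov1) \<Rightarrow> (3 \<Rightarrow> real^4 \<Rightarrow> cov1) \<Rightarrow> real \<Rightarrow> real \<Rightarrow> real \<Rightarrow> 3 \<Rightarrow> real^4 \<Rightarrow> cov2" where
  "cX A e \<alpha>2 \<alpha>4 \<alpha>5 i y a b = 2 * \<alpha>2 * cD A e i y a b + \<alpha>4 * cE e i y a b + \<alpha>5 * cF A i y a b"

definition cY :: "(3 \<Rightarrow> real^4 \<Rightarrow> cov1) \<Rightarrow> (3 \<Rightarrow> real^4 \<Rightarrow> cov1) \<Rightarrow> real \<Rightarrow> real \<Rightarrow> real \<Rightarrow> 3 \<Rightarrow> real^4 \<Rightarrow> cov2" where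
  "cY A e \<alpha>1 \<alpha>3 \<alpha>5 i y a b = \<alpha>1 * cE e i y a b + 2 * \<alpha>3 * cF A i y a b + \<alpha>5 * cD A e i y a b"

lemma cF_simps:
  "cF A 1 y a b = d1 (A 1) y a b + w11 (A 2 y) (A 3 y) a b"
  "cF A 2 y a b = d1 (A 2) y a b + w11 (A 3 y) (A 1 y) a b"
  "cF A 3 y a b = d1 (A 3) y a b + w11 (A 1 y) (A 2 y) a b"
  by (simp_all add: cF_def eps_simps w11_def)

lemma cr11_commute: "cr11 f g i a b = cr11 g f i a b"
  using exhaust_3[of i] by (auto simp: eps_simps w11_def)


text \<open>The scalar triple product (f \<times> g) \<bullet> G = f \<bullet> (g \<times> G) for
  forms; it frees the variation from a cross product.\<close>

lemma triple_product:
  "(\<Sum>i\<in>UNIV. w22 (cr11 f g i) (G i) a b c d) = (\<Sum>i\<in>UNIV. w13 (f i) (cr12 g G i) a b c d)"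
  unfolding sum_3 eps_simps w22_def w13_def w12_def w11_def by algebra

lemma w13_add: "w13 f (\<lambda>a b c. S a b c + T a b c) a b c d = w13 f S a b c d + w13 f T a b c d"
  and w13_cmult: "w13 f (\<lambda>a b c. r * T a b c) a b c d = r * w13 f T a b c d"
  by (simp_all add: w13_def algebra_simps)

text \<open>The graded Jacobi identity for a one-form with itself.\<close>

lemma cr12_cr11_self: "cr12 f (cr11 f f) i a b c = 0"
  using exhaust_3[of i] by (auto simp: eps_simps w12_def w11_def algebra_simps)

section \<open>Leibniz rules and Bianchi identities\<close>

context
  fixes U :: "(real^4) set" and x :: "real^4"
  assumes U: "hopen U" and x: "x \<in> U"
begin

text \<open>The graded Leibniz rule. In df \<and> g the one-form is moved to the front, which costs
  no sign against a 2-form.\<close>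

lemma d2_w11:
  assumes f: "\<And>v. smooth_on U (\<lambda>y. f y v)" and g: "\<And>v. smooth_on U (\<lambda>y. g y v)"
  shows "d2 (\<lambda>y. w11 (f y) (g y)) x a b c = w12 (g x) (d1 f x) a b c - w12 (f x) (d1 g x) a b c"
  unfolding d2_def w11_def
  by (simp add: hderiv_diff[OF U smooth_on_mult[OF f g] smooth_on_mult[OF f g] x] hderiv_mult[OF U f g x]
      w12_def d1_def algebra_simps)

lemma d3_w12:
  assumes f: "\<And>v. smooth_on U (\<lambda>y. f y v)" and G: "\<And>u v. smooth_on U (\<lambda>y. G y u v)"
  shows "d3 (\<lambda>y. w12 (f y) (G y)) x a b c d = w22 (d1 f x) (G x) a b c d - w13 (f x) (d2 G x) a b c d"
proof -
  have D: "hderiv (\<lambda>y. f y b * G y c d - f y c * G y b d + f y d * G y b c) x a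
    = f x b * hderiv (\<lambda>y. G y c d) x a + hderiv (\<lambda>y. f y b) x a * G x c d
    - (f x c * hderiv (\<lambda>y. G y b d) x a + hderiv (\<lambda>y. f y c) x a * G x b d)
    + (f x d * hderiv (\<lambda>y. G y b c) x a + hderiv (\<lambda>y. f y d) x a * G x b c)" for a b c d
    by (simp add: hderiv_add[OF U smooth_on_diff[OF smooth_on_mult[OF f G] smooth_on_mult[OF f G]] smooth_on_mult[OF f G] x]
      hderiv_diff[OF U smooth_on_mult[OF f G] smooth_on_mult[OF f G] x] hderiv_mult[OF U f G x])
  show ?thesis unfolding d3_def w12_def D w22_def w13_def d1_def d2_def
    by (simp add: algebra_simps)
qed

lemma d2_d1:
  assumes f: "\<And>v. smooth_on U (\<lambda>y. f y v)"
  shows "d2 (d1 f) x a b c = 0"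
  unfolding d2_def d1_def
  using hderiv_commute[OF U f x]
  by (simp add: hderiv_diff[OF U smooth_on_hderiv[OF U f] smooth_on_hderiv[OF U f] x])

lemma d2_add:
  assumes G: "\<And>u v. smooth_on U (\<lambda>y. G y u v)" and H: "\<And>u v. smooth_on U (\<lambda>y. H y u v)"
  shows "d2 (\<lambda>y a b. G y a b + H y a b) x a b c = d2 G x a b c + d2 H x a b c"
  unfolding d2_def by (simp add: hderiv_add[OF U G H x])

lemma d2_diff:
  assumes G: "\<And>u v. smooth_on U (\<lambda>y. G y u v)" and H: "\<And>u v. smooth_on U (\<lambda>y. H y u v)"
  shows "d2 (\<lambda>y a b. G y a b - H y a b) x a b c = d2 G x a b c - d2 H x a b c"
  unfolding d2_def by (simp add: hderiv_diff[OF U G H x])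

lemma d2_cmult:
  assumes G: "\<And>u v. smooth_on U (\<lambda>y. G y u v)"
  shows "d2 (\<lambda>y a b. r * G y a b) x a b c = r * d2 G x a b c"
  unfolding d2_def by (simp add: hderiv_cmult[OF U G x] algebra_simps)

lemma smooth_on_d1: "(\<And>v. smooth_on U (\<lambda>y. f y v)) \<Longrightarrow> smooth_on U (\<lambda>y. d1 f y u v)"
  unfolding d1_def by (intro smooth_on_diff smooth_on_hderiv[OF U])

lemma smooth_on_w11:
  "(\<And>v. smooth_on U (\<lambda>y. f y v)) \<Longrightarrow> (\<And>v. smooth_on U (\<lambda>y. g y v)) \<Longrightarrow> smooth_on U (\<lambda>y. w11 (f y) (g y) u v)"
  unfolding w11_def by (intro smooth_on_diff smooth_on_mult)

lemma smooth_on_cr11: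
  assumes "\<And>i v. smooth_on U (\<lambda>y. f i y v)" "\<And>i v. smooth_on U (\<lambda>y. g i y v)"
  shows "smooth_on U (\<lambda>y. cr11 (\<lambda>i. f i y) (\<lambda>i. g i y) i u v)"
  unfolding eps_def by (intro smooth_on_sum smooth_on_mult smooth_on_const smooth_on_w11 assms)

lemma d2_cr11:
  assumes f: "\<And>i v. smooth_on U (\<lambda>y. f i y v)" and g: "\<And>i v. smooth_on U (\<lambda>y. g i y v)"
  shows "d2 (\<lambda>y. cr11 (\<lambda>i. f i y) (\<lambda>i. g i y) i) x a b c
    = - cr12 (\<lambda>i. g i x) (\<lambda>i. d1 (f i) x) i a b c - cr12 (\<lambda>i. f i x) (\<lambda>i. d1 (g i) x) i a b c"
proof -
  have "d2 (\<lambda>y a b. w11 (f j y) (g k y) a b - w11 (f l y) (g m y) a b) x a b c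
    = w12 (g k x) (d1 (f j) x) a b c - w12 (f j x) (d1 (g k) x) a b c
      - (w12 (g m x) (d1 (f l) x) a b c - w12 (f l x) (d1 (g m) x) a b c)" for j k l m
    by (subst d2_diff) (use d2_w11[OF f g] smooth_on_w11[OF f g] in \<open>simp_all\<close>)
  then show ?thesis using exhaust_3[of i] by (auto simp: eps_simps)
qed

context
  fixes A e :: "3 \<Rightarrow> real^4 \<Rightarrow> cov1"
  assumes A: "\<And>i v. smooth_on U (\<lambda>y. A i y v)" and e: "\<And>i v. smooth_on U (\<lambda>y. e i y v)"
begin

text \<open>Since d d = 0, only A \<times> dA remains. It differs from A \<times> F by half of A
  \<times> (A \<times> A), which vanishes.\<close>

lemma d2_cF: "d2 (cF A i) x a b c = - cr12 (\<lambda>i. A i x) (\<lambda>i. cF A i x) i a b c"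
proof -
  have "d2 (cF A i) x a b c = d2 (\<lambda>y. d1 (A i) y) x a b c
      + d2 (\<lambda>y a b. 1/2 * cr11 (\<lambda>i. A i y) (\<lambda>i. A i y) i a b) x a b c"
    unfolding cF_def[abs_def] by (rule d2_add) (intro smooth_on_d1 A smooth_on_mult smooth_on_const smooth_on_cr11)+
  also have "\<dots> = 1/2 * d2 (\<lambda>y. cr11 (\<lambda>i. A i y) (\<lambda>i. A i y) i) x a b c"
    by (simp only: d2_d1[OF A] d2_cmult[OF smooth_on_cr11[OF A A]] add_0)
  also have "\<dots> = - cr12 (\<lambda>i. A i x) (\<lambda>i. d1 (A i) x) i a b c"
    by (simp add: d2_cr11[OF A A])
  also have "\<dots> = - cr12 (\<lambda>i. A i x) (\<lambda>i. cF A i x) i a b c"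
    using exhaust_3[of i] by (auto simp: cF_simps eps_simps w12_def w11_def algebra_simps)
  finally show ?thesis .
qed

text \<open>Completing dA to F and de to De in the derivative of A \<times> e leaves half of e
  \<times> (A \<times> A) plus A \<times> (A \<times> e), which is 0 by the Jacobi identity. With
  the one-form in front, F \<times> e reads - e \<times> F.\<close>

lemma d2_cD: "d2 (cD A e i) x a b c = - cr12 (\<lambda>i. e i x) (\<lambda>i. cF A i x) i a b c - cr12 (\<lambda>i. A i x) (\<lambda>i. cD A e i x) i a b c"
proof -
  have "d2 (cD A e i) x a b c = d2 (\<lambda>y. cr11 (\<lambda>i. A i y) (\<lambda>i. e i y) i) x a b c"
    unfolding cD_def[abs_def]
    by (subst d2_add) (simp_all add: d2_d1[OF e] smooth_on_d1 A e smooth_on_cr11)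
  also have "\<dots> = - cr12 (\<lambda>i. e i x) (\<lambda>i. d1 (A i) x) i a b c - cr12 (\<lambda>i. A i x) (\<lambda>i. d1 (e i) x) i a b c"
    by (rule d2_cr11[OF A e])
  also have "\<dots> = - cr12 (\<lambda>i. e i x) (\<lambda>i. cF A i x) i a b c - cr12 (\<lambda>i. A i x) (\<lambda>i. cD A e i x) i a b c"
    using exhaust_3[of i] by (auto simp: cF_simps cD_def eps_simps w12_def w11_def algebra_simps)
  finally show ?thesis .
qed

lemma d2_cE: "d2 (cE e i) x a b c = - 2 * cr12 (\<lambda>i. e i x) (\<lambda>i. cD A e i x) i a b c - cr12 (\<lambda>i. A i x) (\<lambda>i. cE e i x) i a b c"
proof -
  have "d2 (cE e i) x a b c = d2 (\<lambda>y. cr11 (\<lambda>i. e i y) (\<lambda>i. e i y) i) x a b c"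
    unfolding cE_def[abs_def] ..
  also have "\<dots> = - 2 * cr12 (\<lambda>i. e i x) (\<lambda>i. d1 (e i) x) i a b c"
    by (simp add: d2_cr11[OF e e])
  also have "\<dots> = - 2 * cr12 (\<lambda>i. e i x) (\<lambda>i. cD A e i x) i a b c - cr12 (\<lambda>i. A i x) (\<lambda>i. cE e i x) i a b c"
    using exhaust_3[of i] unfolding cE_def cD_def by (auto simp: eps_simps w12_def w11_def algebra_simps)
  finally show ?thesis .
qed

text \<open>Covariant integration by parts. The Leibniz rule treats d, and
  \<open>triple_product\<close> moves A from \<phi> onto G, which completes dG to a covariant
  derivative.\<close>

lemma pair_cD:
  assumes \<phi>: "\<And>i v. smooth_on U (\<lambda>y. \<phi> i y v)" and G: "\<And>i u v. smooth_on U (\<lambda>y. G i y u v)"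
  shows "(\<Sum>i\<in>UNIV. w22 (cD A \<phi> i x) (G i x) a b c d) = (\<Sum>i\<in>UNIV. d3 (\<lambda>y. w12 (\<phi> i y) (G i y)) x a b c d)
    + (\<Sum>i\<in>UNIV. w13 (\<phi> i x) (\<lambda>a b c. d2 (G i) x a b c + cr12 (\<lambda>i. A i x) (\<lambda>i. G i x) i a b c) a b c d)"
proof -
  have "(\<Sum>i\<in>UNIV. w22 (cD A \<phi> i x) (G i x) a b c d)
      = (\<Sum>i\<in>UNIV. w22 (d1 (\<phi> i) x) (G i x) a b c d) + (\<Sum>i\<in>UNIV. w22 (cr11 (\<lambda>i. \<phi> i x) (\<lambda>i. A i x) i) (G i x) a b c d)"
    unfolding sum.distrib[symmetric]
    by (rule sum.cong) (simp_all add: w22_def cD_def cr11_commute[of "\<lambda>i. A i x"] algebra_simps)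
  also have "(\<Sum>i\<in>UNIV. w22 (cr11 (\<lambda>i. \<phi> i x) (\<lambda>i. A i x) i) (G i x) a b c d)
      = (\<Sum>i\<in>UNIV. w13 (\<phi> i x) (cr12 (\<lambda>i. A i x) (\<lambda>i. G i x) i) a b c d)"
    by (rule triple_product)
  finally show ?thesis
    by (simp add: d3_w12[OF \<phi> G] w13_add sum.distrib sum_subtractf)
qed

lemma smooth_on_cF: "smooth_on U (\<lambda>y. cF A i y a b)"
  and smooth_on_cD: "smooth_on U (\<lambda>y. cD A e i y a b)"
  and smooth_on_cE: "smooth_on U (\<lambda>y. cE e i y a b)"
  unfolding cF_def cD_def cE_def
  by (intro smooth_on_add smooth_on_mult smooth_on_const smooth_on_d1 smooth_on_cr11 A e)+

lemma smooth_on_cX: "smooth_on U (\<lambda>y. cX A e \<alpha>2 \<alpha>4 \<alpha>5 i y a b)"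
  and smooth_on_cY: "smooth_on U (\<lambda>y. cY A e \<alpha>1 \<alpha>3 \<alpha>5 i y a b)"
  unfolding cX_def cY_def
  by (intro smooth_on_add smooth_on_mult smooth_on_const smooth_on_cF smooth_on_cD smooth_on_cE)+

lemma d2_linear3:
  assumes "\<And>u v. smooth_on U (\<lambda>y. G y u v)" "\<And>u v. smooth_on U (\<lambda>y. H y u v)" "\<And>u v. smooth_on U (\<lambda>y. K y u v)"
  shows "d2 (\<lambda>y a b. r * G y a b + s * H y a b + t * K y a b) x a b c
    = r * d2 G x a b c + s * d2 H x a b c + t * d2 K x a b c"
  by (subst d2_add, (intro smooth_on_add smooth_on_mult smooth_on_const assms)+,
      subst d2_add, (intro smooth_on_add smooth_on_mult smooth_on_const assms)+)
    (simp only: d2_cmult[OF assms(1)] d2_cmult[OF assms(2)] d2_cmult[OF assms(3)])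

lemma cr12_linear3: "cr12 f (\<lambda>i a b. r * G i a b + s * H i a b + t * K i a b) i a b c
    = r * cr12 f G i a b c + s * cr12 f H i a b c + t * cr12 f K i a b c"
  using exhaust_3[of i] by (auto simp: eps_simps w12_def algebra_simps)

lemma covariant_d2_cX: "d2 (cX A e \<alpha>2 \<alpha>4 \<alpha>5 i) x a b c + cr12 (\<lambda>i. A i x) (\<lambda>i. cX A e \<alpha>2 \<alpha>4 \<alpha>5 i x) i a b c
    = - 2 * \<alpha>2 * cr12 (\<lambda>i. e i x) (\<lambda>i. cF A i x) i a b c - 2 * \<alpha>4 * cr12 (\<lambda>i. e i x) (\<lambda>i. cD A e i x) i a b c"
  unfolding cX_def[abs_def] d2_linear3[OF smooth_on_cD smooth_on_cE smooth_on_cF] cr12_linear3 d2_cF d2_cD d2_cE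
  by (simp add: algebra_simps)

lemma covariant_d2_cY: "d2 (cY A e \<alpha>1 \<alpha>3 \<alpha>5 i) x a b c + cr12 (\<lambda>i. A i x) (\<lambda>i. cY A e \<alpha>1 \<alpha>3 \<alpha>5 i x) i a b c
    = - 2 * \<alpha>1 * cr12 (\<lambda>i. e i x) (\<lambda>i. cD A e i x) i a b c - \<alpha>5 * cr12 (\<lambda>i. e i x) (\<lambda>i. cF A i x) i a b c"
  unfolding cY_def[abs_def] d2_linear3[OF smooth_on_cE smooth_on_cF smooth_on_cD] cr12_linear3 d2_cF d2_cD d2_cE
  by (simp add: algebra_simps)

lemma cr12_cX: "cr12 (\<lambda>i. e i x) (\<lambda>i. cX A e \<alpha>2 \<alpha>4 \<alpha>5 i x) i a b c
    = 2 * \<alpha>2 * cr12 (\<lambda>i. e i x) (\<lambda>i. cD A e i x) i a b c + \<alpha>5 * cr12 (\<lambda>i. e i x) (\<lambda>i. cF A i x) i a b c"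
  unfolding cX_def[abs_def] cr12_linear3 by (simp add: cE_def[abs_def] cr12_cr11_self)

text \<open>The covariant derivatives of X and Y meet the algebraic terms: \<alpha>4 cancels against
  the variation of e \<times> e, \<alpha>5 cancels between DY and e \<times> X, and \<alpha>3 drops
  out because DF = 0. What is left of \<alpha>1 and \<alpha>2 is their difference.\<close>

lemma variation_identity:
  assumes \<delta>e: "\<And>i v. smooth_on U (\<lambda>y. \<delta>e i y v)" and \<delta>A: "\<And>i v. smooth_on U (\<lambda>y. \<delta>A i y v)"
  shows "(\<Sum>i\<in>UNIV. w22 (cD A \<delta>e i x) (cX A e \<alpha>2 \<alpha>4 \<alpha>5 i x) a b c d) + (\<Sum>i\<in>UNIV. w22 (cD A \<delta>A i x) (cY A e \<alpha>1 \<alpha>3 \<alpha>5 i x) a b c d)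
      + 2 * \<alpha>1 * (\<Sum>i\<in>UNIV. w22 (cr11 (\<lambda>i. \<delta>e i x) (\<lambda>i. e i x) i) (cF A i x) a b c d)
      + 2 * \<alpha>4 * (\<Sum>i\<in>UNIV. w22 (cr11 (\<lambda>i. \<delta>e i x) (\<lambda>i. e i x) i) (cD A e i x) a b c d)
      + (\<Sum>i\<in>UNIV. w22 (cr11 (\<lambda>i. \<delta>A i x) (\<lambda>i. e i x) i) (cX A e \<alpha>2 \<alpha>4 \<alpha>5 i x) a b c d)
    = (\<Sum>i\<in>UNIV. w13 (\<delta>e i x) (\<lambda>a b c. 2 * (\<alpha>1 - \<alpha>2) * cr12 (\<lambda>i. e i x) (\<lambda>i. cF A i x) i a b c) a b c d
          + d3 (\<lambda>y. w12 (\<delta>e i y) (cX A e \<alpha>2 \<alpha>4 \<alpha>5 i y)) x a b c d)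
      + (\<Sum>i\<in>UNIV. w13 (\<delta>A i x) (\<lambda>a b c. - 2 * (\<alpha>1 - \<alpha>2) * cr12 (\<lambda>i. e i x) (\<lambda>i. cD A e i x) i a b c) a b c d
          + d3 (\<lambda>y. w12 (\<delta>A i y) (cY A e \<alpha>1 \<alpha>3 \<alpha>5 i y)) x a b c d)"
proof -
  have e_part: "(\<Sum>i\<in>UNIV. w13 (f i) (\<lambda>a b c. 2 * (\<alpha>1 - \<alpha>2) * S i a b c) a b c d)
      = (\<Sum>i\<in>UNIV. w13 (f i) (\<lambda>a b c. - 2 * \<alpha>2 * S i a b c - 2 * \<alpha>4 * T i a b c) a b c d)
        + 2 * \<alpha>1 * (\<Sum>i\<in>UNIV. w13 (f i) (S i) a b c d) + 2 * \<alpha>4 * (\<Sum>i\<in>UNIV. w13 (f i) (T i) a b c d)"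
    and A_part: "(\<Sum>i\<in>UNIV. w13 (f i) (\<lambda>a b c. - 2 * (\<alpha>1 - \<alpha>2) * T i a b c) a b c d)
      = (\<Sum>i\<in>UNIV. w13 (f i) (\<lambda>a b c. - 2 * \<alpha>1 * T i a b c - \<alpha>5 * S i a b c) a b c d)
        + (\<Sum>i\<in>UNIV. w13 (f i) (\<lambda>a b c. 2 * \<alpha>2 * T i a b c + \<alpha>5 * S i a b c) a b c d)"
    for f and S T :: "3 \<Rightarrow> cov3"
    unfolding sum_distrib_left sum.distrib[symmetric]
    by (rule sum.cong; simp add: w13_def algebra_simps)+
  let ?S = "cr12 (\<lambda>i. e i x) (\<lambda>i. cF A i x)" and ?T = "cr12 (\<lambda>i. e i x) (\<lambda>i. cD A e i x)"
  show ?thesis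
    unfolding pair_cD[OF \<delta>e smooth_on_cX] pair_cD[OF \<delta>A smooth_on_cY] triple_product covariant_d2_cX covariant_d2_cY cr12_cX
      sum.distrib
    using e_part[of "\<lambda>i. \<delta>e i x" ?S ?T] A_part[of "\<lambda>i. \<delta>A i x" ?T ?S] by linarith
qed

end

end

section \<open>The first variation of the Lagrangian\<close>

lemma w22_quadratic_derivative:
  "((\<lambda>t. w22 (\<lambda>a b. G a b + t * G' a b + t\<^sup>2 * G'' a b) (\<lambda>a b. H a b + t * H' a b + t\<^sup>2 * H'' a b) a b c d)
     has_real_derivative w22 G' H a b c d + w22 G H' a b c d) (at 0)"
  unfolding w22_def by (auto intro!: derivative_eq_intros simp: algebra_simps)

lemma d1_affine:
  assumes "hopen U" "x \<in> U" "\<And>v. smooth_on U (\<lambda>y. f y v)" "\<And>v. smooth_on U (\<lambda>y. g y v)"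
  shows "d1 (\<lambda>y v. f y v + t * g y v) x a b = d1 f x a b + t * d1 g x a b"
  unfolding d1_def
  by (simp add: hderiv_add[OF assms(1,3) smooth_on_mult[OF smooth_on_const assms(4)] assms(2)]
      hderiv_cmult[OF assms(1,4,2)] algebra_simps)

lemma d3_cong:
  assumes "hopen U" "x \<in> U" "\<And>y u v w. y \<in> U \<Longrightarrow> S y u v w = T y u v w"
  shows "d3 S x a b c d = d3 T x a b c d"
proof -
  have "hderiv (\<lambda>y. S y u v w) x = hderiv (\<lambda>y. T y u v w) x" for u v w
    by (rule hderiv_cong[OF assms(1,2)]) (rule assms(3))
  then show ?thesis by (simp add: d3_def)
qed

lemma cr11_affine:
  "cr11 (\<lambda>i v. f i v + t * f' i v) (\<lambda>i v. g i v + t * g' i v) i a b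
    = cr11 f g i a b + t * (cr11 f g' i a b + cr11 f' g i a b) + t\<^sup>2 * cr11 f' g' i a b"
  using exhaust_3[of i] by (auto simp: eps_simps w11_def algebra_simps power2_eq_square)

context
  fixes U :: "(real^4) set" and x :: "real^4" and A e \<delta>e \<delta>A :: "3 \<Rightarrow> real^4 \<Rightarrow> cov1" and t :: real
  assumes U: "hopen U" and x: "x \<in> U"
    and A: "\<And>i v. smooth_on U (\<lambda>y. A i y v)" and e: "\<And>i v. smooth_on U (\<lambda>y. e i y v)"
    and \<delta>A: "\<And>i v. smooth_on U (\<lambda>y. \<delta>A i y v)" and \<delta>e: "\<And>i v. smooth_on U (\<lambda>y. \<delta>e i y v)"
begin

lemma cF_affine: "cF (\<lambda>i y v. A i y v + t * \<delta>A i y v) i x a b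
    = cF A i x a b + t * cD A \<delta>A i x a b + t\<^sup>2 * (1/2 * cr11 (\<lambda>i. \<delta>A i x) (\<lambda>i. \<delta>A i x) i a b)"
  unfolding cF_def cD_def d1_affine[OF U x A \<delta>A] cr11_affine cr11_commute[of "\<lambda>i. \<delta>A i x" "\<lambda>i. A i x"]
  by (simp add: algebra_simps)

lemma cD_affine: "cD (\<lambda>i y v. A i y v + t * \<delta>A i y v) (\<lambda>i y v. e i y v + t * \<delta>e i y v) i x a b
    = cD A e i x a b + t * (cD A \<delta>e i x a b + cr11 (\<lambda>i. \<delta>A i x) (\<lambda>i. e i x) i a b)
      + t\<^sup>2 * cr11 (\<lambda>i. \<delta>A i x) (\<lambda>i. \<delta>e i x) i a b"
  unfolding cD_def d1_affine[OF U x e \<delta>e] cr11_affine by (simp add: algebra_simps)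

lemma cE_affine: "cE (\<lambda>i y v. e i y v + t * \<delta>e i y v) i x a b
    = cE e i x a b + t * (2 * cr11 (\<lambda>i. \<delta>e i x) (\<lambda>i. e i x) i a b) + t\<^sup>2 * cr11 (\<lambda>i. \<delta>e i x) (\<lambda>i. \<delta>e i x) i a b"
  unfolding cE_def cr11_affine cr11_commute[of "\<lambda>i. e i x" "\<lambda>i. \<delta>e i x"] by simp

end

text \<open>The Lagrangian as a function of E = e \<times> e, F and D = De, the only quantities
  through which it depends on the parameter t.\<close>

definition lag :: "real \<Rightarrow> real \<Rightarrow> real \<Rightarrow> real \<Rightarrow> real \<Rightarrow> (3 \<Rightarrow> cov2) \<Rightarrow> (3 \<Rightarrow> cov2) \<Rightarrow> (3 \<Rightarrow> cov2) \<Rightarrow> real^4 \<Rightarrow> cov3" where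
  "lag \<alpha>1 \<alpha>2 \<alpha>3 \<alpha>4 \<alpha>5 E F D a b c d = (\<Sum>i\<in>UNIV. \<alpha>1 * w22 (E i) (F i) a b c d + \<alpha>2 * w22 (D i) (D i) a b c d
     + \<alpha>3 * w22 (F i) (F i) a b c d + \<alpha>4 * w22 (D i) (E i) a b c d + \<alpha>5 * w22 (F i) (D i) a b c d)"

text \<open>Used with K = \<delta>e \<times> e, N = \<delta>A \<times> e, D1 = D\<delta>e and F1 =
  D\<delta>A. The second-order coefficients do not reach the derivative at 0.\<close>

lemma lag_derivative:
  assumes "\<And>t i. E t i = (\<lambda>a b. E0 i a b + t * (2 * K i a b) + t\<^sup>2 * E2 i a b)"
    and "\<And>t i. F t i = (\<lambda>a b. F0 i a b + t * F1 i a b + t\<^sup>2 * F2 i a b)"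
    and "\<And>t i. D t i = (\<lambda>a b. D0 i a b + t * (D1 i a b + N i a b) + t\<^sup>2 * D2 i a b)"
    and X: "\<And>i. X i = (\<lambda>a b. 2 * \<alpha>2 * D0 i a b + \<alpha>4 * E0 i a b + \<alpha>5 * F0 i a b)"
    and Y: "\<And>i. Y i = (\<lambda>a b. \<alpha>1 * E0 i a b + 2 * \<alpha>3 * F0 i a b + \<alpha>5 * D0 i a b)"
  shows "deriv (\<lambda>t. lag \<alpha>1 \<alpha>2 \<alpha>3 \<alpha>4 \<alpha>5 (E t) (F t) (D t) a b c d) 0
    = (\<Sum>i\<in>UNIV. w22 (D1 i) (X i) a b c d) + (\<Sum>i\<in>UNIV. w22 (F1 i) (Y i) a b c d)
      + 2 * \<alpha>1 * (\<Sum>i\<in>UNIV. w22 (K i) (F0 i) a b c d) + 2 * \<alpha>4 * (\<Sum>i\<in>UNIV. w22 (K i) (D0 i) a b c d)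
      + (\<Sum>i\<in>UNIV. w22 (N i) (X i) a b c d)"
proof (rule DERIV_imp_deriv)
  let ?E1 = "\<lambda>i a b. 2 * K i a b" and ?D1 = "\<lambda>i a b. D1 i a b + N i a b"
  have "((\<lambda>t. lag \<alpha>1 \<alpha>2 \<alpha>3 \<alpha>4 \<alpha>5 (E t) (F t) (D t) a b c d) has_real_derivative
      (\<Sum>i\<in>UNIV. \<alpha>1 * (w22 (?E1 i) (F0 i) a b c d + w22 (E0 i) (F1 i) a b c d)
       + \<alpha>2 * (w22 (?D1 i) (D0 i) a b c d + w22 (D0 i) (?D1 i) a b c d)
       + \<alpha>3 * (w22 (F1 i) (F0 i) a b c d + w22 (F0 i) (F1 i) a b c d)
       + \<alpha>4 * (w22 (?D1 i) (E0 i) a b c d + w22 (D0 i) (?E1 i) a b c d)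
       + \<alpha>5 * (w22 (F1 i) (D0 i) a b c d + w22 (F0 i) (?D1 i) a b c d))) (at 0)"
    unfolding lag_def assms(1-3)
    by (intro DERIV_sum DERIV_add DERIV_cmult w22_quadratic_derivative)
  also have "(\<Sum>i\<in>UNIV. \<alpha>1 * (w22 (?E1 i) (F0 i) a b c d + w22 (E0 i) (F1 i) a b c d)
       + \<alpha>2 * (w22 (?D1 i) (D0 i) a b c d + w22 (D0 i) (?D1 i) a b c d)
       + \<alpha>3 * (w22 (F1 i) (F0 i) a b c d + w22 (F0 i) (F1 i) a b c d)
       + \<alpha>4 * (w22 (?D1 i) (E0 i) a b c d + w22 (D0 i) (?E1 i) a b c d)
       + \<alpha>5 * (w22 (F1 i) (D0 i) a b c d + w22 (F0 i) (?D1 i) a b c d))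
    = (\<Sum>i\<in>UNIV. w22 (D1 i) (X i) a b c d) + (\<Sum>i\<in>UNIV. w22 (F1 i) (Y i) a b c d)
      + 2 * \<alpha>1 * (\<Sum>i\<in>UNIV. w22 (K i) (F0 i) a b c d) + 2 * \<alpha>4 * (\<Sum>i\<in>UNIV. w22 (K i) (D0 i) a b c d)
      + (\<Sum>i\<in>UNIV. w22 (N i) (X i) a b c d)"
    \<comment> \<open>\<open>w22\<close> is symmetric in its two factors, so the terms of the
      product rule collect into X and Y.\<close>
    unfolding sum_distrib_left sum.distrib[symmetric] X Y
    by (rule sum.cong) (simp_all add: w22_def algebra_simps)
  finally show "((\<lambda>t. lag \<alpha>1 \<alpha>2 \<alpha>3 \<alpha>4 \<alpha>5 (E t) (F t) (D t) a b c d) has_real_derivative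
    (\<Sum>i\<in>UNIV. w22 (D1 i) (X i) a b c d) + (\<Sum>i\<in>UNIV. w22 (F1 i) (Y i) a b c d)
      + 2 * \<alpha>1 * (\<Sum>i\<in>UNIV. w22 (K i) (F0 i) a b c d) + 2 * \<alpha>4 * (\<Sum>i\<in>UNIV. w22 (K i) (D0 i) a b c d)
      + (\<Sum>i\<in>UNIV. w22 (N i) (X i) a b c d)) (at 0)" .
qed

section \<open>Passage from forms to components\<close>

definition comp1 :: "('m, 4) form \<Rightarrow> 'm chart \<Rightarrow> real^4 \<Rightarrow> cov1" where
  "comp1 \<omega> c y v = \<omega> c y ((!) [v])"

definition comp2 :: "('m, 4) form \<Rightarrow> 'm chart \<Rightarrow> real^4 \<Rightarrow> cov2" where
  "comp2 \<omega> c y u v = \<omega> c y ((!) [u, v])"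

definition comp3 :: "('m, 4) form \<Rightarrow> 'm chart \<Rightarrow> real^4 \<Rightarrow> cov3" where
  "comp3 \<omega> c y u v w = \<omega> c y ((!) [u, v, w])"

abbreviation comps :: "'m so3_form \<Rightarrow> 'm chart \<Rightarrow> 3 \<Rightarrow> real^4 \<Rightarrow> cov1" where
  "comps \<phi> c \<equiv> \<lambda>i. comp1 (\<phi> i) c"

text \<open>One term of the first variation, split into its Euler-Lagrange part and an exact part.\<close>

definition var :: "('m, 4) form \<Rightarrow> ('m, 4) form \<Rightarrow> ('m, 4) form \<Rightarrow> 'm chart \<Rightarrow> real^4 \<Rightarrow> real" where
  "var Q Z \<phi> c x = wedge 1 3 \<phi> Q c x frame + ext_deriv 3 (wedge 1 2 \<phi> Z) c x frame"

context oriented_manifold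
begin

lemma smooth_on_comp1: "smooth_form \<A> 1 \<omega> \<Longrightarrow> c \<in> \<A> \<Longrightarrow> smooth_on (chart_img c) (\<lambda>y. comp1 \<omega> c y v)"
  and smooth_on_comp2: "smooth_form \<A> 2 \<omega> \<Longrightarrow> c \<in> \<A> \<Longrightarrow> smooth_on (chart_img c) (\<lambda>y. comp2 \<omega> c y u v)"
  unfolding comp1_def comp2_def by (rule smooth_form_smooth; assumption)+

lemma smooth_form_wedges:
  "smooth_form \<A> 1 \<omega> \<Longrightarrow> smooth_form \<A> 1 \<eta> \<Longrightarrow> smooth_form \<A> 2 (wedge 1 1 \<omega> \<eta>)"
  "smooth_form \<A> 1 \<omega> \<Longrightarrow> smooth_form \<A> 2 \<eta> \<Longrightarrow> smooth_form \<A> 3 (wedge 1 2 \<omega> \<eta>)"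
  "smooth_form \<A> 2 \<omega> \<Longrightarrow> smooth_form \<A> 1 \<eta> \<Longrightarrow> smooth_form \<A> 3 (wedge 2 1 \<omega> \<eta>)"
  "smooth_form \<A> 2 \<omega> \<Longrightarrow> smooth_form \<A> 2 \<eta> \<Longrightarrow> smooth_form \<A> 4 (wedge 2 2 \<omega> \<eta>)"
  using smooth_form_wedge[of 1 \<omega> 1 \<eta>] smooth_form_wedge[of 1 \<omega> 2 \<eta>] smooth_form_wedge[of 2 \<omega> 1 \<eta>]
    smooth_form_wedge[of 2 \<omega> 2 \<eta>] by (simp_all add: numeral_eq_Suc)

context
  fixes c x
  assumes c: "c \<in> \<A>" and x: "x \<in> chart_img c"
begin

lemmas alt = smooth_form_alternating[OF _ c x]

lemma wedge_11: "smooth_form \<A> 1 \<omega> \<Longrightarrow> smooth_form \<A> 1 \<eta> \<Longrightarrow>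
    wedge 1 1 \<omega> \<eta> c x vs = w11 (comp1 \<omega> c x) (comp1 \<eta> c x) (vs 0) (vs 1)"
  unfolding wedge_def by (subst alt_wedge_11) (auto simp: alt w11_def comp1_def)

lemma wedge_12: "smooth_form \<A> 1 \<omega> \<Longrightarrow> smooth_form \<A> 2 \<eta> \<Longrightarrow>
    wedge 1 2 \<omega> \<eta> c x vs = w12 (comp1 \<omega> c x) (comp2 \<eta> c x) (vs 0) (vs 1) (vs 2)"
  unfolding wedge_def by (subst alt_wedge_12) (auto simp: alt w12_def comp1_def comp2_def)

lemma wedge_21: "smooth_form \<A> 2 \<omega> \<Longrightarrow> smooth_form \<A> 1 \<eta> \<Longrightarrow>
    wedge 2 1 \<omega> \<eta> c x vs = w12 (comp1 \<eta> c x) (comp2 \<omega> c x) (vs 0) (vs 1) (vs 2)"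
  unfolding wedge_def by (subst alt_wedge_21) (auto simp: alt w12_def comp1_def comp2_def)

lemma wedge_22: "smooth_form \<A> 2 \<omega> \<Longrightarrow> smooth_form \<A> 2 \<eta> \<Longrightarrow>
    wedge 2 2 \<omega> \<eta> c x vs = w22 (comp2 \<omega> c x) (comp2 \<eta> c x) (vs 0) (vs 1) (vs 2) (vs 3)"
  unfolding wedge_def by (subst alt_wedge_22) (auto simp: alt w22_def comp2_def)

lemma wedge_13: "smooth_form \<A> 1 \<omega> \<Longrightarrow> smooth_form \<A> 3 \<eta> \<Longrightarrow>
    wedge 1 3 \<omega> \<eta> c x vs = w13 (comp1 \<omega> c x) (comp3 \<eta> c x) (vs 0) (vs 1) (vs 2) (vs 3)"
  unfolding wedge_def by (subst alt_wedge_13) (auto simp: alt w13_def comp1_def comp3_def)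

lemma wedge_22_11: "smooth_form \<A> 1 \<omega> \<Longrightarrow> smooth_form \<A> 1 \<eta> \<Longrightarrow> smooth_form \<A> 2 \<zeta> \<Longrightarrow>
    wedge 2 2 (wedge 1 1 \<omega> \<eta>) \<zeta> c x vs
      = w22 (w11 (comp1 \<omega> c x) (comp1 \<eta> c x)) (comp2 \<zeta> c x) (vs 0) (vs 1) (vs 2) (vs 3)"
  by (subst wedge_22)
    (auto simp: smooth_form_wedges comp2_def[of "wedge 1 1 \<omega> \<eta>"] wedge_11 w22_def simp del: One_nat_def)

text \<open>The instance of associativity that the \<alpha>4 term of the Lagrangian
  requires.\<close>

lemma wedge_31_21: "smooth_form \<A> 1 \<omega> \<Longrightarrow> smooth_form \<A> 1 \<eta> \<Longrightarrow> smooth_form \<A> 2 \<zeta> \<Longrightarrow>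
    wedge 3 1 (wedge 2 1 \<zeta> \<omega>) \<eta> c x vs
      = w22 (comp2 \<zeta> c x) (w11 (comp1 \<omega> c x) (comp1 \<eta> c x)) (vs 0) (vs 1) (vs 2) (vs 3)"
  unfolding wedge_def[of 3 1]
  by (subst alt_wedge_31)
    (auto simp: alt smooth_form_wedges wedge_21 w12_def w11_def w22_def comp1_def algebra_simps simp del: One_nat_def)

end

lemma smooth_form_cross:
  assumes "\<And>j. smooth_form \<A> p (\<phi> j)" "\<And>k. smooth_form \<A> q (\<psi> k)" "n = p + q"
  shows "smooth_form \<A> n (cross p q \<phi> \<psi> i)"
  unfolding cross_def[abs_def] assms(3)
  by (intro smooth_form_sum smooth_form_cmult smooth_form_wedge assms)

lemma smooth_form_curvature:
  assumes "\<And>i. smooth_form \<A> 1 (A i)"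
  shows "smooth_form \<A> 2 (curvature A i)"
  unfolding curvature_def[abs_def]
  by (intro smooth_form_add smooth_form_cmult smooth_form_ext_deriv_1 smooth_form_cross assms) simp

lemma smooth_form_cov_deriv:
  assumes "\<And>i. smooth_form \<A> 1 (A i)" "\<And>i. smooth_form \<A> 1 (\<phi> i)"
  shows "smooth_form \<A> 2 (cov_deriv A 1 \<phi> i)"
  unfolding cov_deriv_def[abs_def]
  by (intro smooth_form_add smooth_form_ext_deriv_1 smooth_form_cross assms) simp

lemma smooth_form_add_scaled:
  assumes "\<And>i. smooth_form \<A> k (\<phi> i)" "\<And>i. smooth_form \<A> k (\<psi> i)"
  shows "smooth_form \<A> k (add_scaled \<phi> t \<psi> i)"
  unfolding add_scaled_def[abs_def] by (intro smooth_form_add smooth_form_cmult assms)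

lemma comps_add_scaled: "comps (add_scaled \<phi> t \<psi>) c = (\<lambda>i y v. comps \<phi> c i y v + t * comps \<psi> c i y v)"
  by (simp add: fun_eq_iff comp1_def add_scaled_def)

context
  fixes c x
  assumes c: "c \<in> \<A>" and x: "x \<in> chart_img c"
begin

lemma cross_11:
  assumes "\<And>i. smooth_form \<A> 1 (\<phi> i)" "\<And>i. smooth_form \<A> 1 (\<psi> i)"
  shows "cross 1 1 \<phi> \<psi> i c x vs = cr11 (\<lambda>i. comps \<phi> c i x) (\<lambda>i. comps \<psi> c i x) i (vs 0) (vs 1)"
  unfolding cross_def eps_def by (simp only: wedge_11[OF c x assms])

lemma cross_12:
  assumes "\<And>i. smooth_form \<A> 1 (\<phi> i)" "\<And>i. smooth_form \<A> 2 (\<psi> i)"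
  shows "cross 1 2 \<phi> \<psi> i c x vs = cr12 (\<lambda>i. comps \<phi> c i x) (\<lambda>i. comp2 (\<psi> i) c x) i (vs 0) (vs 1) (vs 2)"
  unfolding cross_def eps_def by (simp only: wedge_12[OF c x assms])

text \<open>Exchanging a 2-form with a 1-form costs no sign, but exchanging two indices of
  \<open>levi_civita\<close> does.\<close>

lemma cross_21:
  assumes "\<And>i. smooth_form \<A> 2 (\<phi> i)" "\<And>i. smooth_form \<A> 1 (\<psi> i)"
  shows "cross 2 1 \<phi> \<psi> i c x vs = - cr12 (\<lambda>i. comps \<psi> c i x) (\<lambda>i. comp2 (\<phi> i) c x) i (vs 0) (vs 1) (vs 2)"
  using exhaust_3[of i] by (auto simp: cross_def sum_3 levi_civita_def eps_simps wedge_21[OF c x assms] simp del: One_nat_def)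

lemma ext_deriv_1_comp:
  assumes "smooth_form \<A> 1 \<omega>"
  shows "ext_deriv 1 \<omega> c x vs = d1 (comp1 \<omega> c) x (vs 0) (vs 1)"
  unfolding ext_deriv_1[OF assms c x] d1_def comp1_def ..

lemma curvature_comp:
  assumes A: "\<And>i. smooth_form \<A> 1 (A i)"
  shows "curvature A i c x vs = cF (comps A c) i x (vs 0) (vs 1)"
  unfolding curvature_def cF_def ext_deriv_1_comp[OF A] cross_11[OF A A] ..

lemma cov_deriv_comp:
  assumes A: "\<And>i. smooth_form \<A> 1 (A i)" and \<phi>: "\<And>i. smooth_form \<A> 1 (\<phi> i)"
  shows "cov_deriv A 1 \<phi> i c x vs = cD (comps A c) (comps \<phi> c) i x (vs 0) (vs 1)"
  unfolding cov_deriv_def cD_def ext_deriv_1_comp[OF \<phi>] cross_11[OF A \<phi>] ..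

lemma comp2_curvature:
  assumes A: "\<And>i. smooth_form \<A> 1 (A i)"
  shows "comp2 (curvature A i) c x = cF (comps A c) i x"
  by (intro ext) (simp add: comp2_def curvature_comp[OF A])

lemma comp2_cov_deriv:
  assumes A: "\<And>i. smooth_form \<A> 1 (A i)" and \<phi>: "\<And>i. smooth_form \<A> 1 (\<phi> i)"
  shows "comp2 (cov_deriv A 1 \<phi> i) c x = cD (comps A c) (comps \<phi> c) i x"
  by (intro ext, unfold comp2_def cov_deriv_comp[OF A \<phi>]) simp

lemma comp2_cross_11:
  assumes "\<And>i. smooth_form \<A> 1 (\<phi> i)" "\<And>i. smooth_form \<A> 1 (\<psi> i)"
  shows "comp2 (cross 1 1 \<phi> \<psi> i) c x = cr11 (\<lambda>i. comps \<phi> c i x) (\<lambda>i. comps \<psi> c i x) i"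
  by (intro ext, unfold comp2_def cross_11[OF assms]) simp

lemma ext_deriv_3_comp:
  assumes \<phi>: "smooth_form \<A> 1 \<phi>" and X: "smooth_form \<A> 2 X"
  shows "ext_deriv 3 (wedge 1 2 \<phi> X) c x vs
    = d3 (\<lambda>y. w12 (comp1 \<phi> c y) (comp2 X c y)) x (vs 0) (vs 1) (vs 2) (vs 3)"
proof -
  have "hderiv (\<lambda>y. wedge 1 2 \<phi> X c y ws) x = hderiv (\<lambda>y. w12 (comp1 \<phi> c y) (comp2 X c y) (ws 0) (ws 1) (ws 2)) x" for ws
    by (rule hderiv_cong[OF hopen_chart_img[OF c] x]) (rule wedge_12[OF c _ \<phi> X])
  then show ?thesis unfolding ext_deriv_def d3_def by (simp add: numeral_eq_Suc)
qed

lemma lagrangian_comp: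
  assumes A: "\<And>i. smooth_form \<A> 1 (A i)" and e: "\<And>i. smooth_form \<A> 1 (e i)"
  shows "lagrangian \<alpha>1 \<alpha>2 \<alpha>3 \<alpha>4 \<alpha>5 e A c x vs = lag \<alpha>1 \<alpha>2 \<alpha>3 \<alpha>4 \<alpha>5 (\<lambda>i. cE (comps e c) i x)
    (\<lambda>i. cF (comps A c) i x) (\<lambda>i. cD (comps A c) (comps e c) i x) (vs 0) (vs 1) (vs 2) (vs 3)"
proof -
  note sF = smooth_form_curvature[of A, OF A] and sD = smooth_form_cov_deriv[of A e, OF A e]
  \<comment> \<open>The triple sums regroup into one pairing per index; the first uses cyclic
    symmetry of the Levi-Civita symbol.\<close>
  have 1: "(\<Sum>i\<in>UNIV. \<Sum>j\<in>UNIV. \<Sum>k\<in>UNIV. levi_civita i j k * w22 (w11 (f i) (f j)) (G k) a b c d)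
      = (\<Sum>i\<in>UNIV. w22 (cr11 f f i) (G i) a b c d)"
    and 2: "(\<Sum>i\<in>UNIV. \<Sum>j\<in>UNIV. \<Sum>k\<in>UNIV. levi_civita i j k * w22 (G i) (w11 (f j) (f k)) a b c d)
      = (\<Sum>i\<in>UNIV. w22 (G i) (cr11 f f i) a b c d)" for f G a b c d
    by (simp_all add: sum_3 levi_civita_def eps_simps w22_def algebra_simps)
  show ?thesis
    unfolding lagrangian_def Let_def wedge_22_11[OF c x e e sF] wedge_22[OF c x sF sF] wedge_22[OF c x sD sD]
      wedge_22[OF c x sF sD] wedge_31_21[OF c x e e sD] comp2_curvature[OF A] comp2_cov_deriv[OF A e] 1 2
    by (simp add: lag_def sum.distrib sum_distrib_left cE_def[abs_def])
qed

end

end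

locale gauge_fields = oriented_manifold \<A>
  for \<A> :: "'m::{t2_space, second_countable_topology} chart set" +
  fixes e A :: "'m so3_form" and \<alpha>1 \<alpha>2 \<alpha>3 \<alpha>4 \<alpha>5 :: real
  assumes e: "\<And>i. smooth_form \<A> 1 (e i)" and A: "\<And>i. smooth_form \<A> 1 (A i)"
begin

abbreviation "L \<equiv> lagrangian \<alpha>1 \<alpha>2 \<alpha>3 \<alpha>4 \<alpha>5"
abbreviation "F \<equiv> curvature A"
abbreviation "De \<equiv> cov_deriv A 1 e"
abbreviation "E \<equiv> cross 1 1 e e"

text \<open>\<open>P\<close> and \<open>R\<close> are the Euler-Lagrange 3-forms paired with
  \<delta>e and \<delta>A. The factor 2 comes from varying quadratic expressions, and writing De
  before e in \<open>R\<close> absorbs the minus sign in front of e \<times> De.\<close>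

definition P :: "'m so3_form" where "P i = (\<lambda>c x vs. 2 * (\<alpha>1 - \<alpha>2) * cross 1 2 e F i c x vs)"
definition R :: "'m so3_form" where "R i = (\<lambda>c x vs. 2 * (\<alpha>1 - \<alpha>2) * cross 2 1 De e i c x vs)"
definition X :: "'m so3_form" where
  "X i = (\<lambda>c x vs. 2 * \<alpha>2 * De i c x vs + \<alpha>4 * E i c x vs + \<alpha>5 * F i c x vs)"
definition Y :: "'m so3_form" where
  "Y i = (\<lambda>c x vs. \<alpha>1 * E i c x vs + 2 * \<alpha>3 * F i c x vs + \<alpha>5 * De i c x vs)"

lemmas sF = smooth_form_curvature[of A, OF A]
lemmas sD = smooth_form_cov_deriv[of A e, OF A e]

lemma sE: "smooth_form \<A> 2 (E i)"
  by (rule smooth_form_cross[OF e e]) simp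

lemma smooth_form_X: "smooth_form \<A> 2 (X i)" and smooth_form_Y: "smooth_form \<A> 2 (Y i)"
  unfolding X_def Y_def by (intro smooth_form_add smooth_form_cmult sF sD sE)+

lemma smooth_form_P: "smooth_form \<A> 3 (P i)" and smooth_form_R: "smooth_form \<A> 3 (R i)"
  unfolding P_def R_def by (intro smooth_form_cmult smooth_form_cross e sF sD; simp)+

text \<open>Built from wedge products of smooth forms, so that smoothness and compatibility between
  charts are immediate; neither is visible in \<open>first_variation\<close>, a pointwise derivative
  in t.\<close>

definition variation :: "'m so3_form \<Rightarrow> 'm so3_form \<Rightarrow> ('m, 4) form" where
  "variation \<delta>e \<delta>A = (\<lambda>c x vs. (\<Sum>i\<in>UNIV. wedge 2 2 (cov_deriv A 1 \<delta>e i) (X i) c x vs)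
      + (\<Sum>i\<in>UNIV. wedge 2 2 (cov_deriv A 1 \<delta>A i) (Y i) c x vs)
      + 2 * \<alpha>1 * (\<Sum>i\<in>UNIV. wedge 2 2 (cross 1 1 \<delta>e e i) (F i) c x vs)
      + 2 * \<alpha>4 * (\<Sum>i\<in>UNIV. wedge 2 2 (cross 1 1 \<delta>e e i) (De i) c x vs)
      + (\<Sum>i\<in>UNIV. wedge 2 2 (cross 1 1 \<delta>A e i) (X i) c x vs))"

lemma smooth_form_variation:
  assumes "\<And>i. smooth_form \<A> 1 (\<delta>e i)" "\<And>i. smooth_form \<A> 1 (\<delta>A i)"
  shows "smooth_form \<A> 4 (variation \<delta>e \<delta>A)"
  unfolding variation_def
  by (intro smooth_form_add smooth_form_cmult smooth_form_sum smooth_form_wedges(4) smooth_form_cov_deriv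
      smooth_form_cross[where n = 2] smooth_form_X smooth_form_Y sF sD A e assms; simp)

lemma comp2_X: "c \<in> \<A> \<Longrightarrow> x \<in> chart_img c \<Longrightarrow> comp2 (X i) c x = cX (comps A c) (comps e c) \<alpha>2 \<alpha>4 \<alpha>5 i x"
  and comp2_Y: "c \<in> \<A> \<Longrightarrow> x \<in> chart_img c \<Longrightarrow> comp2 (Y i) c x = cY (comps A c) (comps e c) \<alpha>1 \<alpha>3 \<alpha>5 i x"
proof -
  assume c: "c \<in> \<A>" and x: "x \<in> chart_img c"
  show "comp2 (X i) c x = cX (comps A c) (comps e c) \<alpha>2 \<alpha>4 \<alpha>5 i x"
    unfolding X_def
    by (intro ext, unfold comp2_def cov_deriv_comp[OF c x A e] curvature_comp[OF c x A] cross_11[OF c x e e])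
      (simp add: cX_def cE_def)
  show "comp2 (Y i) c x = cY (comps A c) (comps e c) \<alpha>1 \<alpha>3 \<alpha>5 i x"
    unfolding Y_def
    by (intro ext, unfold comp2_def cov_deriv_comp[OF c x A e] curvature_comp[OF c x A] cross_11[OF c x e e])
      (simp add: cY_def cE_def)
qed

context
  fixes c x and \<delta>e \<delta>A :: "'m so3_form"
  assumes c: "c \<in> \<A>" and x: "x \<in> chart_img c"
    and \<delta>e: "\<And>i. smooth_form \<A> 1 (\<delta>e i)" and \<delta>A: "\<And>i. smooth_form \<A> 1 (\<delta>A i)"
begin

lemma variation_comp: "variation \<delta>e \<delta>A c x vs =
      (\<Sum>i\<in>UNIV. w22 (cD (comps A c) (comps \<delta>e c) i x) (cX (comps A c) (comps e c) \<alpha>2 \<alpha>4 \<alpha>5 i x) (vs 0) (vs 1) (vs 2) (vs 3))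
      + (\<Sum>i\<in>UNIV. w22 (cD (comps A c) (comps \<delta>A c) i x) (cY (comps A c) (comps e c) \<alpha>1 \<alpha>3 \<alpha>5 i x) (vs 0) (vs 1) (vs 2) (vs 3))
      + 2 * \<alpha>1 * (\<Sum>i\<in>UNIV. w22 (cr11 (\<lambda>i. comps \<delta>e c i x) (\<lambda>i. comps e c i x) i) (cF (comps A c) i x) (vs 0) (vs 1) (vs 2) (vs 3))
      + 2 * \<alpha>4 * (\<Sum>i\<in>UNIV. w22 (cr11 (\<lambda>i. comps \<delta>e c i x) (\<lambda>i. comps e c i x) i) (cD (comps A c) (comps e c) i x) (vs 0) (vs 1) (vs 2) (vs 3))
      + (\<Sum>i\<in>UNIV. w22 (cr11 (\<lambda>i. comps \<delta>A c i x) (\<lambda>i. comps e c i x) i) (cX (comps A c) (comps e c) \<alpha>2 \<alpha>4 \<alpha>5 i x) (vs 0) (vs 1) (vs 2) (vs 3))"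
proof -
  have ce: "smooth_form \<A> 2 (cross 1 1 \<delta>e e i)" and cA: "smooth_form \<A> 2 (cross 1 1 \<delta>A e i)" for i
    by (rule smooth_form_cross[OF \<delta>e e] smooth_form_cross[OF \<delta>A e]; simp)+
  show ?thesis
    unfolding variation_def wedge_22[OF c x smooth_form_cov_deriv[of A \<delta>e, OF A \<delta>e] smooth_form_X]
      wedge_22[OF c x smooth_form_cov_deriv[of A \<delta>A, OF A \<delta>A] smooth_form_Y]
      wedge_22[OF c x ce sF] wedge_22[OF c x ce sD] wedge_22[OF c x cA smooth_form_X]
      comp2_X[OF c x] comp2_Y[OF c x] comp2_cov_deriv[OF c x A \<delta>e] comp2_cov_deriv[OF c x A \<delta>A] comp2_cov_deriv[OF c x A e]
      comp2_curvature[OF c x A] comp2_cross_11[OF c x \<delta>e e] comp2_cross_11[OF c x \<delta>A e] ..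
qed

lemma first_variation_eq: "first_variation L e A \<delta>e \<delta>A c x vs = variation \<delta>e \<delta>A c x vs"
proof -
  note sm = smooth_on_comp1[OF A c] smooth_on_comp1[OF e c] smooth_on_comp1[OF \<delta>A c] smooth_on_comp1[OF \<delta>e c]
  note o = hopen_chart_img[OF c]
  have "L (add_scaled e t \<delta>e) (add_scaled A t \<delta>A) c x vs = lag \<alpha>1 \<alpha>2 \<alpha>3 \<alpha>4 \<alpha>5
      (\<lambda>i. cE (\<lambda>i y v. comps e c i y v + t * comps \<delta>e c i y v) i x)
      (\<lambda>i. cF (\<lambda>i y v. comps A c i y v + t * comps \<delta>A c i y v) i x)
      (\<lambda>i. cD (\<lambda>i y v. comps A c i y v + t * comps \<delta>A c i y v) (\<lambda>i y v. comps e c i y v + t * comps \<delta>e c i y v) i x)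
      (vs 0) (vs 1) (vs 2) (vs 3)" for t
    using lagrangian_comp[OF c x, of "add_scaled A t \<delta>A" "add_scaled e t \<delta>e", OF smooth_form_add_scaled[OF A \<delta>A]
        smooth_form_add_scaled[OF e \<delta>e]]
    unfolding comps_add_scaled .
  then show ?thesis
    unfolding first_variation_def variation_comp
    by (simp only:, intro lag_derivative[where ?E2.0 = "\<lambda>i. cr11 (\<lambda>i. comps \<delta>e c i x) (\<lambda>i. comps \<delta>e c i x) i"
          and ?F2.0 = "\<lambda>i a b. 1/2 * cr11 (\<lambda>i. comps \<delta>A c i x) (\<lambda>i. comps \<delta>A c i x) i a b"
          and ?D2.0 = "\<lambda>i. cr11 (\<lambda>i. comps \<delta>A c i x) (\<lambda>i. comps \<delta>e c i x) i"
          and ?E0.0 = "\<lambda>i. cE (comps e c) i x"]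
        ext cE_affine[OF o x sm] cF_affine[OF o x sm] cD_affine[OF o x sm])
      (simp_all add: cX_def cY_def)
qed

text \<open>Stated in one chart and at \<open>frame\<close>, which is what the chart integral
  evaluates; the separate summands \<open>var\<close> are not claimed to transform as forms.\<close>

lemma variation_eq_var: "variation \<delta>e \<delta>A c x frame
    = (\<Sum>i\<in>UNIV. var (P i) (X i) (\<delta>e i) c x) + (\<Sum>i\<in>UNIV. var (R i) (Y i) (\<delta>A i) c x)"
proof -
  note sm = smooth_on_comp1[OF A c] smooth_on_comp1[OF e c] smooth_on_comp1[OF \<delta>e c] smooth_on_comp1[OF \<delta>A c]
  note o = hopen_chart_img[OF c]
  have P: "comp3 (P i) c x = (\<lambda>a b d. 2 * (\<alpha>1 - \<alpha>2) * cr12 (\<lambda>i. comps e c i x) (\<lambda>i. cF (comps A c) i x) i a b d)"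
for i
    by (intro ext, unfold P_def comp3_def cross_12[OF c x e sF] comp2_curvature[OF c x A]) simp
  have R: "comp3 (R i) c x = (\<lambda>a b d. - 2 * (\<alpha>1 - \<alpha>2) * cr12 (\<lambda>i. comps e c i x) (\<lambda>i. cD (comps A c) (comps e c) i x) i a b d)" for i
    by (intro ext, unfold R_def comp3_def cross_21[OF c x sD e] comp2_cov_deriv[OF c x A e]) (simp add: algebra_simps)
  have X: "d3 (\<lambda>y. w12 (f y) (comp2 (X i) c y)) x a1 a2 a3 a4
      = d3 (\<lambda>y. w12 (f y) (cX (comps A c) (comps e c) \<alpha>2 \<alpha>4 \<alpha>5 i y)) x a1 a2 a3 a4"
    and Y: "d3 (\<lambda>y. w12 (f y) (comp2 (Y i) c y)) x a1 a2 a3 a4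
      = d3 (\<lambda>y. w12 (f y) (cY (comps A c) (comps e c) \<alpha>1 \<alpha>3 \<alpha>5 i y)) x a1 a2 a3 a4" for f i a1 a2 a3 a4
    by (rule d3_cong[OF o x], simp only: comp2_X[OF c] comp2_Y[OF c])+
  show ?thesis
    unfolding variation_comp variation_identity[OF o x sm] var_def
      wedge_13[OF c x \<delta>e smooth_form_P] wedge_13[OF c x \<delta>A smooth_form_R] P R
      ext_deriv_3_comp[OF c x \<delta>e smooth_form_X] ext_deriv_3_comp[OF c x \<delta>A smooth_form_Y] X Y ..
qed

end

end

section \<open>Stokes' theorem in a chart\<close>

lemma integral_4:
  fixes f g h k :: "real^4 \<Rightarrow> real"
  assumes "f integrable_on S" "g integrable_on S" "h integrable_on S" "k integrable_on S"
  shows "integral S (\<lambda>x. f x - g x + h x - k x) = integral S f - integral S g + integral S h - integral S k"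
  using assms by (simp add: integral_diff integral_add integrable_diff integrable_add)

definition tang :: "nat \<Rightarrow> real^4" where
  "tang = (!) [axis 2 1, axis 3 1, axis 4 1]"

lemma wedge_zero_left: "\<omega> c x = (\<lambda>vs. 0) \<Longrightarrow> wedge p q \<omega> \<eta> c x vs = 0"
  and wedge_zero_right: "\<eta> c x = (\<lambda>vs. 0) \<Longrightarrow> wedge p q \<omega> \<eta> c x vs = 0"
  by (simp_all add: wedge_def alt_wedge_def)

context oriented_manifold
begin

lemma chart_img_half_space: "c \<in> \<A> \<Longrightarrow> x \<in> chart_img c \<Longrightarrow> x \<in> half_space"
  using hopen_subset[OF hopen_chart_img] by blast


text \<open>Extension by zero stays smooth because the compact K keeps away from the edge of the
  chart image. Integrals over the chart image thereby become integrals over the half-space.\<close>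

lemma half_space_extension:
  assumes c: "c \<in> \<A>" and f: "smooth_on (chart_img c) f" and K: "compact K" "K \<subseteq> chart_img c"
    and 0: "\<And>x. x \<in> chart_img c \<Longrightarrow> x \<notin> K \<Longrightarrow> f x = 0"
  defines "g \<equiv> \<lambda>x. if x \<in> chart_img c then f x else 0"
  shows "half_space_compact_support g K"
    "(\<lambda>x. hderiv f x v) integrable_on chart_img c"
    "integral (chart_img c) (\<lambda>x. hderiv f x v) = integral half_space (\<lambda>x. hderiv g x v)"
proof -
  note o = hopen_chart_img[OF c]
  have gK: "g x = 0" if "x \<notin> K" for x using that 0 by (auto simp: g_def)
  have "smooth_on half_space g"
  proof (rule smooth_on_hopen_cover)
    fix x assume x: "x \<in> half_space"
    show "\<exists>V. hopen V \<and> x \<in> V \<and> smooth_on (half_space \<inter> V) g"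
    proof (cases "x \<in> K")
      case True
      have "smooth_on (half_space \<inter> chart_img c) g"
        using smooth_on_subset[OF f, of "half_space \<inter> chart_img c"]
        by (subst smooth_on_cong[of _ g f]) (auto simp: g_def)
      then show ?thesis using o True K(2) by blast
    next
      case False
      have "smooth_on (half_space \<inter> (half_space \<inter> - K)) g"
        by (subst smooth_on_cong[of _ g "\<lambda>x. 0"]) (auto simp: gK)
      moreover have "hopen (half_space \<inter> - K)"
        using compact_imp_closed[OF K(1)] by (simp add: openin_open_Int open_Compl)
      ultimately show ?thesis using False x by blast
    qed
  qed simp
  then show hs: "half_space_compact_support g K"
    by unfold_locales (use K gK in auto)
  interpret half_space_compact_support g K by (rule hs)
  have eq: "(if x \<in> chart_img c then hderiv f x v else 0) = (if x \<in> half_space then hderiv g x v else 0)" for x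
  proof (cases "x \<in> chart_img c")
    case True
    have "hderiv f x = hderiv g x" by (rule hderiv_cong[OF o True]) (simp add: g_def)
    then show ?thesis using True chart_img_half_space[OF c] by simp
  next
    case False
    then show ?thesis using support_hderiv K(2) by auto
  qed
  show "integral (chart_img c) (\<lambda>x. hderiv f x v) = integral half_space (\<lambda>x. hderiv g x v)"
    by (subst (1 2) integral_restrict_UNIV[symmetric]) (simp only: eq)
  have "(\<lambda>x. hderiv f x v) absolutely_integrable_on chart_img c"
  proof (rule absolutely_integrable_on_compact_support[OF K(1) _ K(2)])
    show "continuous_on K (\<lambda>x. hderiv f x v)"
      by (rule continuous_on_subset[OF smooth_on_continuous[OF smooth_on_hderiv[OF o f]] K(2)])
    fix x assume x: "x \<in> chart_img c - K"
    then show "hderiv f x v = 0" using eq[of x] support_hderiv[of x] chart_img_half_space[OF c] by auto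
  qed
  then show "(\<lambda>x. hderiv f x v) integrable_on chart_img c" by (rule set_lebesgue_integral_eq_integral(1))
qed

text \<open>The boundary density \<phi> \<and> Z on the tangential frame. It is taken on the whole
  chart image and extended by zero because its normal derivative is integrated over the
  half-space.\<close>

definition bdf :: "('m, 4) form \<Rightarrow> ('m, 4) form \<Rightarrow> 'm chart \<Rightarrow> real^4 \<Rightarrow> real" where
  "bdf Z \<phi> c y = (if y \<in> chart_img c then wedge 1 2 \<phi> Z c y tang else 0)"

lemma vanishes_off_chart:
  assumes "c \<in> \<A>" "vanishes_off \<A> K \<phi>" "x \<in> chart_img c" "x \<notin> snd c ` K"
  shows "\<phi> c x = (\<lambda>vs. 0)"
proof -
  have "chart_inv c x \<notin> K"
  proof
    assume "chart_inv c x \<in> K"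
    then have "snd c (chart_inv c x) \<in> snd c ` K" by (rule imageI)
    then show False using assms(4) chart_chart_inv[OF assms(1,3)] by simp
  qed
  then show ?thesis by (intro ext vanishes_offD[OF assms(2,1,3)])
qed

text \<open>Of the four terms of the exterior derivative the three tangential ones integrate to 0.
  The normal one stays as a half-space integral, since later only its vanishing or its sign
  matters.\<close>

lemma var_integral:
  assumes c: "c \<in> \<A>" and Q: "smooth_form \<A> 3 Q" and Z: "smooth_form \<A> 2 Z" and \<phi>: "smooth_form \<A> 1 \<phi>"
    and K: "compact K" "K \<subseteq> chart_dom c" "vanishes_off \<A> K \<phi>"
  shows "half_space_compact_support (bdf Z \<phi> c) (snd c ` K)"
    "var Q Z \<phi> c integrable_on chart_img c"
    "(\<lambda>x. wedge 1 3 \<phi> Q c x frame) integrable_on chart_img c"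
    "integral (chart_img c) (var Q Z \<phi> c) = integral (chart_img c) (\<lambda>x. wedge 1 3 \<phi> Q c x frame)
      + integral half_space (\<lambda>x. hderiv (bdf Z \<phi> c) x (axis 1 1))"
proof -
  let ?K = "snd c ` K"
  note Kc = compact_chart_image[OF c K(1,2)]
  have 0: "\<phi> c x = (\<lambda>vs. 0)" if "x \<in> chart_img c" "x \<notin> ?K" for x
    by (rule vanishes_off_chart[OF c K(3) that])
  let ?w = "\<lambda>ws y. wedge 1 2 \<phi> Z c y ws"
  have sw: "smooth_on (chart_img c) (?w ws)" for ws
    by (rule smooth_form_smooth[OF smooth_form_wedges(2)[OF \<phi> Z] c])
  have w0: "wedge p q \<phi> \<eta> c x vs = 0" if "x \<in> chart_img c" "x \<notin> ?K" for p q \<eta> x vs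
    by (rule wedge_zero_left[of \<phi>, OF 0[OF that]])
  have ext: "half_space_compact_support (\<lambda>x. if x \<in> chart_img c then ?w ws x else 0) ?K"
    "(\<lambda>x. hderiv (?w ws) x v) integrable_on chart_img c"
    "integral (chart_img c) (\<lambda>x. hderiv (?w ws) x v)
      = integral half_space (\<lambda>x. hderiv (\<lambda>x. if x \<in> chart_img c then ?w ws x else 0) x v)" for ws v
    by (rule half_space_extension[OF c sw Kc w0]; assumption)+
  show hs: "half_space_compact_support (bdf Z \<phi> c) ?K"
    using ext(1)[of tang] by (simp add: bdf_def[abs_def])
  have tangential: "integral (chart_img c) (\<lambda>x. hderiv (?w ws) x (axis a 1)) = 0" if "a \<noteq> 1" for a ws
    unfolding ext(3) by (rule half_space_compact_support.integral_hderiv_tangential[OF ext(1) that])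
  \<comment> \<open>The frame with its i-th vector omitted, in the form in which
    \<open>ext_deriv\<close> produces it.\<close>
  let ?skip = "\<lambda>i j. if j < i then frame j else frame (Suc j)"
  have fr: "frame 0 = axis 1 1" "frame (Suc 0) = axis 2 1" "frame (Suc (Suc 0)) = axis 3 1"
    "frame (Suc (Suc (Suc 0))) = axis 4 1" by (simp_all add: frame_def)
  have ed: "ext_deriv 3 (wedge 1 2 \<phi> Z) c x frame = hderiv (?w (?skip 0)) x (axis 1 1) - hderiv (?w (?skip 1)) x (axis 2 1)
      + hderiv (?w (?skip 2)) x (axis 3 1) - hderiv (?w (?skip 3)) x (axis 4 1)" for x
    by (simp add: ext_deriv_def numeral_eq_Suc fr)
  have i: "(\<lambda>x. ext_deriv 3 (wedge 1 2 \<phi> Z) c x frame) integrable_on chart_img c"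
    unfolding ed by (intro integrable_add integrable_diff ext(2))
  \<comment> \<open>Both sequences begin with the axes 2, 3 and 4; they may differ at later indices,
    which a 3-form does not see.\<close>
  have tang: "?w (?skip 0) y = ?w tang y" if "y \<in> chart_img c" for y
    by (rule alternating_cong[OF smooth_form_alternating[OF smooth_form_wedges(2)[OF \<phi> Z] c that]])
      (auto simp: frame_def tang_def less_Suc_eq numeral_eq_Suc)
  have "integral (chart_img c) (\<lambda>x. ext_deriv 3 (wedge 1 2 \<phi> Z) c x frame)
      = integral (chart_img c) (\<lambda>x. hderiv (?w (?skip 0)) x (axis 1 1))"
    unfolding ed by (subst integral_4[OF ext(2) ext(2) ext(2) ext(2)]) (simp add: tangential del: One_nat_def)
  also have "\<dots> = integral (chart_img c) (\<lambda>x. hderiv (?w tang) x (axis 1 1))"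
  proof (rule integral_cong)
    fix x assume x: "x \<in> chart_img c"
    have "hderiv (?w (?skip 0)) x = hderiv (?w tang) x"
      by (rule hderiv_cong[OF hopen_chart_img[OF c] x tang])
    then show "hderiv (?w (?skip 0)) x (axis 1 1) = hderiv (?w tang) x (axis 1 1)" by simp
  qed
  also have "\<dots> = integral half_space (\<lambda>x. hderiv (bdf Z \<phi> c) x (axis 1 1))"
    unfolding ext(3) bdf_def[abs_def] ..
  finally have I: "integral (chart_img c) (\<lambda>x. ext_deriv 3 (wedge 1 2 \<phi> Z) c x frame)
    = integral half_space (\<lambda>x. hderiv (bdf Z \<phi> c) x (axis 1 1))" .
  have "smooth_form \<A> 4 (wedge 1 3 \<phi> Q)" using smooth_form_wedge[OF \<phi> Q] by (simp add: numeral_eq_Suc)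
  then have "smooth_on (chart_img c) (\<lambda>x. wedge 1 3 \<phi> Q c x frame)" using smooth_form_smooth c by blast
  then have "(\<lambda>x. wedge 1 3 \<phi> Q c x frame) absolutely_integrable_on chart_img c"
    by (intro absolutely_integrable_on_compact_support[OF Kc(1) _ Kc(2)] continuous_on_subset[OF smooth_on_continuous Kc(2)])
      (auto intro: w0)
  then show j: "(\<lambda>x. wedge 1 3 \<phi> Q c x frame) integrable_on chart_img c" by (rule set_lebesgue_integral_eq_integral(1))
  show "var Q Z \<phi> c integrable_on chart_img c"
    unfolding var_def[abs_def] by (rule integrable_add[OF j i])
  show "integral (chart_img c) (var Q Z \<phi> c) = integral (chart_img c) (\<lambda>x. wedge 1 3 \<phi> Q c x frame)
      + integral half_space (\<lambda>x. hderiv (bdf Z \<phi> c) x (axis 1 1))"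
    unfolding var_def[abs_def] integral_add[OF j i] I ..
qed

section \<open>Pullback to the boundary\<close>

definition boundary_zero :: "('m, 4) form \<Rightarrow> bool" where
  "boundary_zero \<omega> \<longleftrightarrow> (\<forall>c\<in>\<A>. \<forall>y\<in>chart_img c. y $ 1 = 0 \<longrightarrow> (\<forall>vs. (\<forall>i. vs i $ 1 = 0) \<longrightarrow> \<omega> c y vs = 0))"

lemma bd_incl_linear: "linear bd_incl"
  by (auto simp: linear_iff bd_incl_def vec_eq_iff)

lemma bd_incl_surj: "y $ 1 = 0 \<Longrightarrow> bd_incl (\<chi> i. if i = 1 then y $ 2 else if i = 2 then y $ 3 else y $ 4) = y"
  unfolding vec_eq_iff forall_4 by (simp add: bd_incl_def)

lemma bd_pullback_eq: "bd_pullback \<omega> c y vs = \<omega> c (bd_incl y) (\<lambda>i. bd_incl (vs i))"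
proof -
  have "frechet_derivative bd_incl (at y) = bd_incl"
    using frechet_derivative_at[OF linear_imp_has_derivative[OF bd_incl_linear]] by simp
  then show ?thesis by (simp add: bd_pullback_def pullback_def)
qed

text \<open>\<open>bd_incl\<close> is linear, hence its own derivative, and maps onto the hyperplane
  of vanishing first coordinate. Pulling back along it amounts to restricting to points and vectors
  of that hyperplane.\<close>

lemma eq_on_boundary_zero: "eq_on_boundary \<A> (bd_pullback \<omega>) zero_form \<longleftrightarrow> boundary_zero \<omega>"
proof
  assume L: "eq_on_boundary \<A> (bd_pullback \<omega>) zero_form"
  show "boundary_zero \<omega>"
    unfolding boundary_zero_def
  proof (intro ballI allI impI)
    fix c y and vs :: "nat \<Rightarrow> real^4"
    assume c: "c \<in> \<A>" and y: "y \<in> chart_img c" "y $ 1 = 0" and vs: "\<forall>i. vs i $ 1 = 0"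
    define p :: "real^4 \<Rightarrow> real^3" where "p v = (\<chi> i. if i = 1 then v $ 2 else if i = 2 then v $ 3 else v $ 4)" for v
    have p: "bd_incl (p y) = y" "\<And>i. bd_incl (p (vs i)) = vs i"
      unfolding p_def using y vs by (auto intro: bd_incl_surj)
    have "bd_pullback \<omega> c (p y) (\<lambda>i. p (vs i)) = 0"
      using L c y p(1) unfolding eq_on_boundary_def zero_form_def by metis
    then show "\<omega> c y vs = 0" by (simp add: bd_pullback_eq p)
  qed
next
  assume R: "boundary_zero \<omega>"
  have 0: "bd_incl y $ 1 = 0" for y by (simp add: bd_incl_def)
  show "eq_on_boundary \<A> (bd_pullback \<omega>) zero_form"
    unfolding eq_on_boundary_def
  proof (intro ballI allI impI ext)
    fix c y and vs :: "nat \<Rightarrow> real^3" assume "c \<in> \<A>" "bd_incl y \<in> chart_img c"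
    then have "\<omega> c (bd_incl y) (\<lambda>i. bd_incl (vs i)) = 0"
      using R 0 unfolding boundary_zero_def by (meson ballE)
    then show "bd_pullback \<omega> c y vs = zero_form c y vs" by (simp add: bd_pullback_eq zero_form_def)
  qed
qed

lemma var_integral_eq_0:
  assumes c: "c \<in> \<A>" and Q: "smooth_form \<A> 3 Q" and Z: "smooth_form \<A> 2 Z" and \<phi>: "smooth_form \<A> 1 \<phi>"
    and K: "compact K" "K \<subseteq> chart_dom c" "vanishes_off \<A> K \<phi>"
    and Q0: "\<And>x. x \<in> chart_img c \<Longrightarrow> Q c x = (\<lambda>vs. 0)" and Z0: "boundary_zero Z"
  shows "integral (chart_img c) (var Q Z \<phi> c) = 0"
proof -
  have "bdf Z \<phi> c y = 0" if y: "y $ 1 = 0" for y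
  proof (cases "y \<in> chart_img c")
    case True
    have "wedge 1 2 \<phi> Z c y tang = 0"
      unfolding wedge_def alt_wedge_12[OF smooth_form_alternating[OF \<phi> c True] smooth_form_alternating[OF Z c True]]
    proof -
      have "Z c y ((!) [tang i, tang j]) = 0" if "i < 3" "j < 3" for i j
      proof -
        have t: "tang i $ 1 = 0" "tang j $ 1 = 0"
          using that by (auto simp: tang_def axis_def less_Suc_eq numeral_eq_Suc)
        \<comment> \<open>\<open>boundary_zero\<close> asks for a tangential vector at every index,
          and list access beyond the end is unspecified; hence the constant continuation.\<close>
        have "Z c y ((!) [tang i, tang j]) = Z c y (\<lambda>k. if k = 0 then tang i else tang j)"
          by (rule alternating_cong[OF smooth_form_alternating[OF Z c True]]) (auto simp: less_Suc_eq numeral_eq_Suc)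
        also have "\<dots> = 0" using Z0 c True y t unfolding boundary_zero_def by auto
        finally show ?thesis .
      qed
      then show "\<phi> c y ((!) [tang 0]) * Z c y ((!) [tang 1, tang 2]) - \<phi> c y ((!) [tang 1]) * Z c y ((!) [tang 0, tang 2])
        + \<phi> c y ((!) [tang 2]) * Z c y ((!) [tang 0, tang 1]) = 0" by simp
    qed
    then show ?thesis by (simp add: bdf_def)
  qed (simp add: bdf_def)
  then have 1: "integral half_space (\<lambda>x. hderiv (bdf Z \<phi> c) x (axis 1 1)) = 0"
    by (rule half_space_compact_support.integral_hderiv_normal_0[OF var_integral(1)[OF c Q Z \<phi> K]])
  have "integral (chart_img c) (\<lambda>x. wedge 1 3 \<phi> Q c x frame) = integral (chart_img c) (\<lambda>x. 0)"
    by (rule integral_cong) (rule wedge_zero_right[of Q, OF Q0])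
  then show ?thesis unfolding var_integral(4)[OF c Q Z \<phi> K] 1 by simp
qed

section \<open>Test forms supported in a chart\<close>

text \<open>The 1-form \<beta> dx_a of the chart c, pulled back to the other charts and extended by
  zero.\<close>

definition test :: "'m chart \<Rightarrow> (real^4 \<Rightarrow> real) \<Rightarrow> 4 \<Rightarrow> ('m, 4) form" where
  "test c \<beta> a = (\<lambda>c' x vs. if x \<in> overlap c' c
     then \<beta> (transition c' c x) * hderiv (transition c' c) x (vs 0) $ a else 0)"

text \<open>The cocycle rule with its chain rule; it makes the test forms compatible between two
  charts that both differ from c.\<close>

lemma transition_cocycle:
  assumes "c \<in> \<A>" "c' \<in> \<A>" "d \<in> \<A>" "x \<in> overlap c c'" "x \<in> overlap c d"
  shows "transition c d x = transition c' d (transition c c' x)"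
    "hderiv (transition c d) x v = hderiv (transition c' d) (transition c c' x) (hderiv (transition c c') x v)"
    "transition c c' x \<in> overlap c' d"
proof -
  let ?O = "overlap c c' \<inter> overlap c d"
  have eq: "transition c d y = transition c' d (transition c c' y)" and mem: "transition c c' y \<in> overlap c' d" if "y \<in> ?O" for y
    using that transition_overlap[OF assms(1,2), of y] chart_inv_transition[OF assms(1,2), of y]
    by (auto simp: transition_eq[of c' d] transition_eq[of c d] overlap_iff[OF assms(1)] overlap_iff[OF assms(2)])
  have x: "x \<in> ?O" using assms by simp
  then show "transition c d x = transition c' d (transition c c' x)" "transition c c' x \<in> overlap c' d"
    using eq mem by auto
  have o: "hopen ?O" using hopen_overlap[OF assms(1,2)] hopen_overlap[OF assms(1,3)] by (rule openin_Int)
  have "hderiv (transition c d) x v = hderiv (\<lambda>y. transition c' d (transition c c' y)) x v"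
    by (rule fun_cong[OF hderiv_cong[OF o x]]) (rule eq)
  also have "\<dots> = hderiv (transition c' d) (transition c c' x) (hderiv (transition c c') x v)"
    by (rule hderiv_compose[OF o smooth_on_subset[OF smooth_transition[OF assms(1,2)]] x _
          hopen_overlap[OF assms(2,3)] smooth_transition[OF assms(2,3)]]) (use mem in auto)
  finally show "hderiv (transition c d) x v = hderiv (transition c' d) (transition c c' x) (hderiv (transition c c') x v)" .
qed

lemma overlap_transition_iff:
  assumes "c \<in> \<A>" "c' \<in> \<A>" "x \<in> overlap c c'"
  shows "transition c c' x \<in> overlap c' d \<longleftrightarrow> x \<in> overlap c d"
  using assms transition_overlap[OF assms] chart_inv_transition[OF assms] by (auto simp: overlap_iff)

context
  fixes c and \<beta> :: "real^4 \<Rightarrow> real" and K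
  assumes c: "c \<in> \<A>" and \<beta>: "smooth_on (chart_img c) \<beta>"
    and K: "compact K" "K \<subseteq> chart_img c" "\<And>x. x \<in> chart_img c \<Longrightarrow> x \<notin> K \<Longrightarrow> \<beta> x = 0"
begin

lemma test_self:
  assumes "x \<in> chart_img c"
  shows "test c \<beta> a c x vs = \<beta> x * vs 0 $ a"
proof -
  have id: "transition c c y = y" if "y \<in> chart_img c" for y using that by (simp add: transition_eq chart_chart_inv[OF c])
  have "hderiv (transition c c) x = hderiv (\<lambda>y. y) x"
    by (rule hderiv_cong[OF hopen_chart_img[OF c] assms id])
  also have "\<dots> = (\<lambda>v. v)" by (rule hderiv_eq[OF chart_img_half_space[OF c assms]]) auto
  finally show ?thesis using assms by (simp add: test_def overlap_self[OF c] id)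
qed

lemma test_vanishes_off: "vanishes_off \<A> (chart_inv c ` K) (test c \<beta> a)"
  unfolding vanishes_off_def
proof (intro ballI allI)
  fix c' p vs assume c': "c' \<in> \<A>" and p: "p \<in> chart_dom c' - chart_inv c ` K"
  show "test c \<beta> a c' (snd c' p) vs = 0"
  proof (cases "p \<in> chart_dom c")
    case True
    have "snd c p \<notin> K" using p chart_inv_chart[OF c True] by (metis DiffD2 imageI)
    then have "\<beta> (snd c p) = 0" using K(3) True by blast
    then show ?thesis using p by (simp add: test_def transition_eq chart_inv_chart[OF c'])
  next
    case False
    then show ?thesis using p by (simp add: test_def overlap_iff[OF c'] chart_inv_chart[OF c'])
  qed
qed

lemma smooth_form_test: "smooth_form \<A> 1 (test c \<beta> a)"
proof (rule smooth_formI)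
  fix c' x assume c': "c' \<in> \<A>" "x \<in> chart_img c'"
  show "alternating 1 (test c \<beta> a c' x)"
  proof (cases "x \<in> overlap c' c")
    case True
    have "alternating 1 (\<lambda>vs. covec a (\<lambda>i. hderiv (transition c' c) x (vs i)))"
      by (rule alternating_compose_linear[OF alternating_covec linear_transition[OF c'(1) c True]])
    from alternating_cmult[OF this] show ?thesis using True by (simp add: test_def covec_def)
  qed (simp add: test_def alternating_zero)
next
  fix c' and vs :: "nat \<Rightarrow> real^4" assume c': "c' \<in> \<A>"
  show "smooth_on (chart_img c') (\<lambda>x. test c \<beta> a c' x vs)"
  proof (rule smooth_on_hopen_cover[OF hopen_chart_img[OF c']])
    fix x assume x: "x \<in> chart_img c'"
    show "\<exists>V. hopen V \<and> x \<in> V \<and> smooth_on (chart_img c' \<inter> V) (\<lambda>x. test c \<beta> a c' x vs)"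
    proof (cases "x \<in> overlap c' c")
      case True
      have "smooth_on (overlap c' c) (\<lambda>y. \<beta> (transition c' c y) * hderiv (transition c' c) y (vs 0) $ a)"
        by (intro smooth_on_mult smooth_on_compose[OF smooth_transition[OF c' c] \<beta>]
            smooth_on_bounded_linear_compose[OF bounded_linear_vec_nth]
            smooth_on_hderiv[OF hopen_overlap[OF c' c] smooth_transition[OF c' c]])
          (use transition_image[OF c' c] overlap_subset[of c c'] in blast)
      then have "smooth_on (overlap c' c) (\<lambda>x. test c \<beta> a c' x vs)"
        by (subst smooth_on_cong[of _ _ "\<lambda>y. \<beta> (transition c' c y) * hderiv (transition c' c) y (vs 0) $ a"])
          (auto simp: test_def)
      moreover have "chart_img c' \<inter> overlap c' c = overlap c' c" using overlap_subset[of c' c] by blast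
      ultimately show ?thesis using True hopen_overlap[OF c' c] by (intro exI[of _ "overlap c' c"]) simp
    next
      case False
      \<comment> \<open>Outside the overlap the form is 0 near x, because its compact carrier lies
        in the domain of c.\<close>
      let ?V = "{x \<in> chart_img c'. chart_inv c' x \<notin> chart_inv c ` K}"
      have "smooth_on (chart_img c' \<inter> ?V) (\<lambda>x. test c \<beta> a c' x vs)"
        by (subst smooth_on_cong[of _ _ "\<lambda>y. 0"]) (auto intro: vanishes_offD[OF test_vanishes_off c'])
      moreover have "x \<in> ?V"
        using False x compact_chart_inv_image(2)[OF c K(1,2)] overlap_iff[OF c'] by blast
      ultimately show ?thesis
        using hopen_off_compact[OF c' compact_chart_inv_image(1)[OF c K(1,2)]] by (intro exI[of _ ?V]) blast
    qed
  qed
next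
  fix c' d x and vs :: "nat \<Rightarrow> real^4" assume cd: "c' \<in> \<A>" "d \<in> \<A>" "x \<in> overlap c' d"
  show "test c \<beta> a c' x vs = test c \<beta> a d (transition c' d x) (\<lambda>i. hderiv (transition c' d) x (vs i))"
  proof (cases "x \<in> overlap c' c")
    case True
    then show ?thesis
      using transition_cocycle[OF cd(1,2) c cd(3) True] by (simp add: test_def)
  next
    case False
    then show ?thesis using overlap_transition_iff[OF cd] by (simp add: test_def)
  qed
qed

end

end

section \<open>The fundamental lemma\<close>

lemma alt_wedge_cmult: "alt_wedge p q (\<lambda>vs. r * f vs) g vs = r * alt_wedge p q f g vs"
  by (simp add: alt_wedge_def sum_distrib_left algebra_simps)

lemma sign_neighbourhood:
  fixes g :: "real^4 \<Rightarrow> real"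
  assumes "continuous_on U g" "x \<in> U" "g x \<noteq> 0"
  obtains W where "open W" "x \<in> W" "\<And>y. y \<in> W \<Longrightarrow> y \<in> U \<Longrightarrow> 0 < sgn (g x) * g y"
proof -
  have "continuous_on U (\<lambda>y. sgn (g x) * g y)" by (intro continuous_intros assms)
  then have "openin (top_of_set U) (U \<inter> (\<lambda>y. sgn (g x) * g y) -` {0<..})"
    by (rule continuous_openin_preimage_gen) simp
  then obtain W where W: "open W" "U \<inter> (\<lambda>y. sgn (g x) * g y) -` {0<..} = U \<inter> W" by (auto simp: openin_open)
  show ?thesis
  proof (rule that[OF W(1)])
    have "x \<in> U \<inter> (\<lambda>y. sgn (g x) * g y) -` {0<..}" using assms by (simp add: sgn_mult_self_eq mult.commute flip: abs_sgn)
    then show "x \<in> W" using W(2) by blast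
    show "0 < sgn (g x) * g y" if "y \<in> W" "y \<in> U" for y using W(2) that by blast
  qed
qed

text \<open>Tests of the bulk term must keep off the boundary, so a point at which a coefficient is
  nonzero is pushed slightly inwards.\<close>

lemma hopen_inner_point:
  assumes "hopen U" "x \<in> U" "open W" "x \<in> W"
  obtains z where "z \<in> U" "z \<in> W" "0 < z $ 1"
proof -
  obtain V where V: "open V" "U = half_space \<inter> V" using assms(1) by (auto simp: openin_open)
  have "open (V \<inter> W)" "x \<in> V \<inter> W" using V assms by auto
  then obtain r where r: "0 < r" "ball x r \<subseteq> V \<inter> W" using open_contains_ball by metis
  let ?z = "x + (r / 2) *\<^sub>R axis 1 1"
  have "dist x ?z < r" using r(1) by (simp add: dist_norm norm_axis_1)
  then have "?z \<in> V \<inter> W" using r(2) by auto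
  moreover have "0 < ?z $ 1" using assms(2) V r(1) by (simp add: half_space_def axis_def)
  ultimately show ?thesis using V by (intro that[of ?z]) (auto simp: half_space_def)
qed

lemma hopen_interior:
  assumes "hopen U" "x \<in> U" "0 < x $ 1"
  obtains V where "open V" "x \<in> V" "V \<subseteq> U"
proof -
  obtain V where V: "open V" "U = half_space \<inter> V" using assms(1) by (auto simp: openin_open)
  show ?thesis
    by (rule that[of "V \<inter> {x. 0 < x $ 1}"])
      (use V assms in \<open>auto simp: half_space_def intro!: open_Int open_halfspace_component_gt_cart\<close>)
qed

lemma integral_pos:
  fixes f :: "real^4 \<Rightarrow> real"
  assumes f: "continuous_on S f" "f integrable_on S" "\<And>y. y \<in> S \<Longrightarrow> 0 \<le> f y"
    and V: "open V" "V \<subseteq> S" "x \<in> V" "0 < f x"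
  shows "0 < integral S f"
proof (rule ccontr)
  assume neg: "\<not> 0 < integral S f"
  obtain a b where ab: "cbox a b \<subseteq> V" "x \<in> box a b" using open_contains_cbox[OF V(1,3)] by metis
  have sub: "cbox a b \<subseteq> S" using ab V by blast
  have i: "f integrable_on cbox a b" by (rule integrable_on_subcbox[OF f(2) sub])
  have "integral (cbox a b) f \<le> integral S f" by (rule integral_subset_le[OF sub i f(2)]) (use f(3) in blast)
  moreover have "0 \<le> integral (cbox a b) f" by (rule integral_nonneg[OF i]) (use f(3) sub in blast)
  ultimately have "integral (cbox a b) f = 0" using neg by linarith
  then have "(f has_integral 0) (cbox a b)" using i by (simp add: has_integral_integrable_integral)
  moreover have "box a b \<noteq> {}" using ab(2) by blast
  moreover have "x \<in> cbox a b" using ab(2) box_subset_cbox by blast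
  ultimately have "f x = 0"
    using has_integral_0_cbox_imp_0[of a b f x] continuous_on_subset[OF f(1) sub] f(3) sub box_subset_cbox[of a b] by blast
  then show False using V(4) by simp
qed

context oriented_manifold
begin

text \<open>For a test form with profile \<beta> the hypothesis is one scalar equation: the integral
  of \<beta> times a coefficient of Q, plus the half-space integral of the normal derivative of
  \<beta> times a coefficient of Z, is 0. Multiplying \<beta> by the sign of the coefficient under
  test makes the term in question strictly positive or strictly negative.\<close>

lemma fundamental_lemma:
  assumes c: "c \<in> \<A>" and Q: "smooth_form \<A> 3 Q" and Z: "smooth_form \<A> 2 Z"
    and 0: "\<And>\<beta> K a. smooth_on (chart_img c) \<beta> \<Longrightarrow> compact K \<Longrightarrow> K \<subseteq> chart_img c \<Longrightarrow>
      (\<And>x. x \<in> chart_img c \<Longrightarrow> x \<notin> K \<Longrightarrow> \<beta> x = 0) \<Longrightarrow> integral (chart_img c) (var Q Z (test c \<beta> a) c) = 0"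
  shows "x \<in> chart_img c \<Longrightarrow> Q c x vs = 0"
    and "x \<in> chart_img c \<Longrightarrow> x $ 1 = 0 \<Longrightarrow> vs 0 $ 1 = 0 \<Longrightarrow> vs 1 $ 1 = 0 \<Longrightarrow> Z c x vs = 0"
proof -
  let ?U = "chart_img c"
  note o = hopen_chart_img[OF c]
  \<comment> \<open>The coefficients that dx_a extracts from Q and Z; their vanishing for all a is
    what the algebraic criteria ask for.\<close>
  define g where "g a y = alt_wedge 1 3 (covec a) (Q c y) frame" for a y
  define b where "b a y = alt_wedge 1 2 (covec a) (Z c y) tang" for a y
  have g: "smooth_on ?U (g a)" and b: "smooth_on ?U (b a)" for a
    unfolding g_def[abs_def] b_def[abs_def] alt_wedge_def divide_inverse
    by (intro smooth_on_mult smooth_on_sum smooth_on_const smooth_form_smooth[OF Q c] smooth_form_smooth[OF Z c])+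
  have test: "(\<forall>x\<in>?U. wedge 1 3 (test c \<beta> a) Q c x frame = \<beta> x * g a x)
      \<and> (\<forall>x. bdf Z (test c \<beta> a) c x = (if x \<in> ?U then \<beta> x * b a x else 0))
      \<and> half_space_compact_support (bdf Z (test c \<beta> a) c) K
      \<and> (\<lambda>x. \<beta> x * g a x) integrable_on ?U
      \<and> integral ?U (\<lambda>x. \<beta> x * g a x) + integral half_space (\<lambda>x. hderiv (bdf Z (test c \<beta> a) c) x (axis 1 1)) = 0"
    if \<beta>: "smooth_on ?U \<beta>" and K: "compact K" "K \<subseteq> ?U" "\<And>x. x \<in> ?U \<Longrightarrow> x \<notin> K \<Longrightarrow> \<beta> x = 0" for \<beta> K a
  proof -
    have t: "test c \<beta> a c x = (\<lambda>vs. \<beta> x * covec a vs)" if "x \<in> ?U" for x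
      unfolding covec_def by (rule ext) (rule test_self[OF c \<beta> K that])
    have 1: "wedge 1 3 (test c \<beta> a) Q c x frame = \<beta> x * g a x" if "x \<in> ?U" for x
      by (simp only: wedge_def t[OF that] alt_wedge_cmult g_def)
    have 2: "wedge 1 2 (test c \<beta> a) Z c x tang = \<beta> x * b a x" if "x \<in> ?U" for x
      by (simp only: wedge_def t[OF that] alt_wedge_cmult b_def)
    have img: "snd c ` chart_inv c ` K = K" using chart_chart_inv[OF c] K(2) by (force simp: image_iff)
    note v = var_integral[OF c Q Z smooth_form_test[OF c \<beta> K] compact_chart_inv_image[OF c K(1,2)] test_vanishes_off[OF c \<beta> K]]
    have "integral ?U (\<lambda>x. wedge 1 3 (test c \<beta> a) Q c x frame) = integral ?U (\<lambda>x. \<beta> x * g a x)"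
      by (rule integral_cong) (rule 1)
    moreover have "(\<lambda>x. \<beta> x * g a x) integrable_on ?U"
      by (rule integrable_eq[OF v(3)[of a]]; (assumption | erule 1))
    ultimately show ?thesis
      using v(1)[of a] v(4)[of a] 0[OF \<beta> K, of a] 1 2 unfolding img by (simp add: bdf_def)
  qed
  have g0: "g a x = 0" if x: "x \<in> ?U" for a x
  proof (rule ccontr)
    assume "g a x \<noteq> 0"
    then obtain W where W: "open W" "x \<in> W" "\<And>y. y \<in> W \<Longrightarrow> y \<in> ?U \<Longrightarrow> 0 < sgn (g a x) * g a y"
      using sign_neighbourhood[OF smooth_on_continuous[OF g] x] by metis
    \<comment> \<open>The point x may lie on the boundary; z is an interior point nearby at which
      the coefficient has the same sign.\<close>
    obtain z where z: "z \<in> ?U" "z \<in> W" "0 < z $ 1" using hopen_inner_point[OF o x W(1,2)] by metis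
    have oW: "open (W \<inter> {x. 0 < x $ 1})" using W(1) by (intro open_Int open_halfspace_component_gt_cart)
    have zW: "z \<in> W \<inter> {x. 0 < x $ 1}" using z by simp
    obtain \<beta> :: "real^4 \<Rightarrow> real" and K r where \<beta>: "\<And>S. smooth_on S \<beta>" "\<And>x. 0 \<le> \<beta> x" "\<And>x. \<beta> x \<le> 1" "0 < r"
      "\<And>x. dist z x < r \<Longrightarrow> \<beta> x = 1" "compact K" "K \<subseteq> ?U \<inter> (W \<inter> {x. 0 < x $ 1})"
      "\<And>x. x \<in> half_space \<Longrightarrow> x \<notin> K \<Longrightarrow> \<beta> x = 0"
      by (rule chart_bump[OF c z(1) oW zW], rule that)
    have KU: "K \<subseteq> ?U" using \<beta>(7) by blast
    have \<beta>0: "\<beta> y = 0" if "y \<in> ?U" "y \<notin> K" for y using \<beta>(8) chart_img_half_space[OF c that(1)] that(2) by blast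
    let ?\<beta> = "\<lambda>y. sgn (g a x) * \<beta> y"
    have s\<beta>: "smooth_on ?U ?\<beta>" by (intro smooth_on_mult smooth_on_const \<beta>(1))
    have s0: "?\<beta> y = 0" if "y \<in> ?U" "y \<notin> K" for y using \<beta>0[OF that] by simp
    note t = test[OF s\<beta> \<beta>(6) KU s0, of a]
    \<comment> \<open>The support avoids the hyperplane, so the boundary term contributes
      nothing.\<close>
    have "bdf Z (test c ?\<beta> a) c y = 0" if y: "y $ 1 = 0" for y
    proof -
      have "y \<notin> K" using \<beta>(7) y by auto
      then show ?thesis using t s0[of y] by (cases "y \<in> ?U") simp_all
    qed
    then have "integral half_space (\<lambda>x. hderiv (bdf Z (test c ?\<beta> a) c) x (axis 1 1)) = 0"
      using t half_space_compact_support.integral_hderiv_normal_0 by blast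
    then have "integral ?U (\<lambda>y. ?\<beta> y * g a y) = 0" using t by simp
    moreover have "0 < integral ?U (\<lambda>y. ?\<beta> y * g a y)"
    proof -
      obtain V where V: "open V" "z \<in> V" "V \<subseteq> ?U" using hopen_interior[OF o z(1,3)] by metis
      have nn: "0 \<le> ?\<beta> y * g a y" if y: "y \<in> ?U" for y
      proof (cases "y \<in> K")
        case True
        then have "0 < sgn (g a x) * g a y" using W(3) \<beta>(7) y by blast
        then have "0 \<le> \<beta> y * (sgn (g a x) * g a y)" by (intro mult_nonneg_nonneg \<beta>(2) less_imp_le)
        then show ?thesis by (simp add: mult_ac)
      qed (use \<beta>0[OF y] in simp)
      have "\<beta> z = 1" using \<beta>(4,5) by simp
      then have "0 < ?\<beta> z * g a z" using W(3)[OF z(2,1)] by simp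
      then show ?thesis
        using t by (intro integral_pos[OF _ _ nn V(1,3,2)] smooth_on_continuous smooth_on_mult s\<beta> g) auto
    qed
    ultimately show False by simp
  qed
  show Q0: "Q c x vs = 0" if x: "x \<in> ?U" for x vs
    by (rule alternating3_eq_0[OF smooth_form_alternating[OF Q c x]]) (use g0[OF x] in \<open>simp add: g_def\<close>)
  have b0: "b a x = 0" if x: "x \<in> ?U" "x $ 1 = 0" for a x
  proof (rule ccontr)
    assume "b a x \<noteq> 0"
    then obtain W where W: "open W" "x \<in> W" "\<And>y. y \<in> W \<Longrightarrow> y \<in> ?U \<Longrightarrow> 0 < sgn (b a x) * b a y"
      using sign_neighbourhood[OF smooth_on_continuous[OF b] x(1)] by metis
    obtain \<beta> :: "real^4 \<Rightarrow> real" and K r where \<beta>: "\<And>S. smooth_on S \<beta>" "\<And>x. 0 \<le> \<beta> x" "\<And>x. \<beta> x \<le> 1" "0 < r"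
      "\<And>y. dist x y < r \<Longrightarrow> \<beta> y = 1" "compact K" "K \<subseteq> ?U \<inter> W"
      "\<And>x. x \<in> half_space \<Longrightarrow> x \<notin> K \<Longrightarrow> \<beta> x = 0"
      by (rule chart_bump[OF c x(1) W(1,2)], rule that)
    have KU: "K \<subseteq> ?U" using \<beta>(7) by blast
    have \<beta>0: "\<beta> y = 0" if "y \<in> ?U" "y \<notin> K" for y using \<beta>(8) chart_img_half_space[OF c that(1)] that(2) by blast
    let ?\<beta> = "\<lambda>y. sgn (b a x) * \<beta> y"
    have s\<beta>: "smooth_on ?U ?\<beta>" by (intro smooth_on_mult smooth_on_const \<beta>(1))
    have s0: "?\<beta> y = 0" if "y \<in> ?U" "y \<notin> K" for y using \<beta>0[OF that] by simp
    note t = test[OF s\<beta> \<beta>(6) KU s0, of a]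
    \<comment> \<open>With g known to vanish the normal derivative integrates to 0, whereas a
      nonnegative density that is positive at x makes that integral negative.\<close>
    have "integral ?U (\<lambda>y. ?\<beta> y * g a y) = integral ?U (\<lambda>y. 0)" by (rule integral_cong) (simp add: g0)
    then have I: "integral half_space (\<lambda>x. hderiv (bdf Z (test c ?\<beta> a) c) x (axis 1 1)) = 0" using t by simp
    have nn: "0 \<le> bdf Z (test c ?\<beta> a) c y" for y
    proof (cases "y \<in> K")
      case True
      then have y: "y \<in> ?U" "0 < sgn (b a x) * b a y" using W(3) \<beta>(7) by blast+
      have "0 \<le> \<beta> y * (sgn (b a x) * b a y)" by (intro mult_nonneg_nonneg \<beta>(2) less_imp_le y(2))
      then show ?thesis using t y(1) by (simp add: mult_ac)
    next
      case False
      then show ?thesis using t \<beta>0[of y] by (cases "y \<in> ?U") simp_all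
    qed
    have "\<beta> x = 1" using \<beta>(4,5) by simp
    then have pos: "0 < bdf Z (test c ?\<beta> a) c x" using W(3)[OF W(2) x(1)] t x(1) by simp
    have "half_space_compact_support (bdf Z (test c ?\<beta> a) c) K" using t by blast
    from half_space_compact_support.integral_hderiv_normal_neg[OF this nn x(2) pos] show False using I by simp
  qed
  show "Z c x vs = 0" if x: "x \<in> ?U" "x $ 1 = 0" and vs: "vs 0 $ 1 = 0" "vs 1 $ 1 = 0" for x vs
    by (rule alternating2_boundary_eq_0[OF smooth_form_alternating[OF Z c x(1)] _ vs])
      (use b0[OF x] in \<open>simp add: b_def tang_def\<close>)
qed

end

section \<open>Stationary points\<close>

lemma w22_sum: "w22 (\<lambda>a b. \<Sum>n\<in>N. G n a b) H a b c d = (\<Sum>n\<in>N. w22 (G n) H a b c d)"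
  by (simp add: w22_def sum_distrib_right sum.distrib sum_subtractf)

lemma eps_sum: "eps (\<lambda>j k. \<Sum>n\<in>N. h n j k) i = (\<Sum>n\<in>N. eps (h n) i)"
  using exhaust_3[of i] by (auto simp: eps_simps sum_subtractf)

context gauge_fields
begin

text \<open>Everything is linear in the variations. The decompositions are assumed on the whole
  chart image, not only at x, because their derivatives enter.\<close>

lemma variation_sum:
  assumes c: "c \<in> \<A>" and x: "x \<in> chart_img c"
    and \<delta>e: "\<And>i. smooth_form \<A> 1 (\<delta>e i)" and \<delta>A: "\<And>i. smooth_form \<A> 1 (\<delta>A i)"
    and f: "\<And>n i. n \<in> N \<Longrightarrow> smooth_form \<A> 1 (f n i)" and g: "\<And>n i. n \<in> N \<Longrightarrow> smooth_form \<A> 1 (g n i)"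
    and e_sum: "\<And>i y vs. y \<in> chart_img c \<Longrightarrow> \<delta>e i c y vs = (\<Sum>n\<in>N. f n i c y vs)"
    and A_sum: "\<And>i y vs. y \<in> chart_img c \<Longrightarrow> \<delta>A i c y vs = (\<Sum>n\<in>N. g n i c y vs)"
  shows "variation \<delta>e \<delta>A c x vs = (\<Sum>n\<in>N. variation (f n) (g n) c x vs)"
proof -
  note o = hopen_chart_img[OF c]
  let ?CR = "\<lambda>\<phi> i. cr11 (\<lambda>i. comps \<phi> c i x) (\<lambda>i. comps e c i x) i" and ?CD = "\<lambda>\<phi> i. cD (comps A c) (comps \<phi> c) i x"
  have lin: "?CR \<phi> i = (\<lambda>a b. \<Sum>n\<in>N. ?CR (h n) i a b) \<and> ?CD \<phi> i = (\<lambda>a b. \<Sum>n\<in>N. ?CD (h n) i a b)"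
    if h: "\<And>n i. n \<in> N \<Longrightarrow> smooth_form \<A> 1 (h n i)"
      and sum: "\<And>i y vs. y \<in> chart_img c \<Longrightarrow> \<phi> i c y vs = (\<Sum>n\<in>N. h n i c y vs)" for \<phi> h i
  proof
    have comp: "comps \<phi> c i y v = (\<Sum>n\<in>N. comps (h n) c i y v)" if "y \<in> chart_img c" for i y v
      unfolding comp1_def by (rule sum[OF that])
    have "hderiv (\<lambda>y. comps \<phi> c i y v) x u = (\<Sum>n\<in>N. hderiv (\<lambda>y. comps (h n) c i y v) x u)" for i u v
    proof -
      have "hderiv (\<lambda>y. comps \<phi> c i y v) x u = hderiv (\<lambda>y. \<Sum>n\<in>N. comps (h n) c i y v) x u"
        by (rule fun_cong[OF hderiv_cong[OF o x]]) (rule comp)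
      also have "\<dots> = (\<Sum>n\<in>N. hderiv (\<lambda>y. comps (h n) c i y v) x u)"
        by (rule hderiv_sum[OF o _ x]) (rule smooth_on_comp1[OF h c])
      finally show ?thesis .
    qed
    then have d1: "d1 (comps \<phi> c i) x a b = (\<Sum>n\<in>N. d1 (comps (h n) c i) x a b)" for i a b
      by (simp add: d1_def sum_subtractf)
    show "?CR \<phi> i = (\<lambda>a b. \<Sum>n\<in>N. ?CR (h n) i a b)"
      unfolding eps_sum[symmetric] w11_def comp[OF x] by (simp add: sum_distrib_right sum_subtractf)
    have "cr11 (\<lambda>i. comps A c i x) (\<lambda>i. comps \<phi> c i x) i a b = (\<Sum>n\<in>N. cr11 (\<lambda>i. comps A c i x) (\<lambda>i. comps (h n) c i x) i a b)" for a b
      unfolding eps_sum[symmetric] w11_def comp[OF x] by (simp add: sum_distrib_left sum_subtractf)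
    then show "?CD \<phi> i = (\<lambda>a b. \<Sum>n\<in>N. ?CD (h n) i a b)"
      by (simp add: cD_def fun_eq_iff d1 sum.distrib)
  qed
  have e_lin: "?CR \<delta>e i = (\<lambda>a b. \<Sum>n\<in>N. ?CR (f n) i a b) \<and> ?CD \<delta>e i = (\<lambda>a b. \<Sum>n\<in>N. ?CD (f n) i a b)" for i
    by (rule lin[of f \<delta>e, OF f e_sum])
  have A_lin: "?CR \<delta>A i = (\<lambda>a b. \<Sum>n\<in>N. ?CR (g n) i a b) \<and> ?CD \<delta>A i = (\<lambda>a b. \<Sum>n\<in>N. ?CD (g n) i a b)" for i
    by (rule lin[of g \<delta>A, OF g A_sum])
  show ?thesis
    unfolding variation_comp[OF c x \<delta>e \<delta>A] conjunct1[OF e_lin] conjunct2[OF e_lin] conjunct1[OF A_lin] conjunct2[OF A_lin] w22_sum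
    by (subst sum.cong[OF refl variation_comp[OF c x f g]])
      (simp_all add: sum.distrib sum_distrib_left sum.swap[of _ N UNIV])
qed

lemma vanishes_off_mono: "vanishes_off \<A> K \<omega> \<Longrightarrow> K \<subseteq> K' \<Longrightarrow> vanishes_off \<A> K' \<omega>"
  by (auto simp: vanishes_off_def)

text \<open>Derivatives of the variations vanish off K because the complement of a compact set is
  open, so the components are 0 on a neighbourhood.\<close>

lemma variation_vanishes_off:
  assumes K: "compact K" and \<delta>e: "\<And>i. smooth_form \<A> 1 (\<delta>e i)" and \<delta>A: "\<And>i. smooth_form \<A> 1 (\<delta>A i)"
    and e0: "\<And>i. vanishes_off \<A> K (\<delta>e i)" and A0: "\<And>i. vanishes_off \<A> K (\<delta>A i)"
  shows "vanishes_off \<A> K (variation \<delta>e \<delta>A)"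
  unfolding vanishes_off_def
proof (intro ballI allI)
  fix c p vs assume c: "c \<in> \<A>" and p: "p \<in> chart_dom c - K"
  let ?x = "snd c p" and ?V = "{x \<in> chart_img c. chart_inv c x \<notin> K}"
  have x: "?x \<in> chart_img c" "?x \<in> ?V" using p by (auto simp: chart_inv_chart[OF c])
  note o = hopen_off_compact[OF c K]
  have cr: "cr11 (\<lambda>i. comps \<phi> c i ?x) (\<lambda>i. comps e c i ?x) i = (\<lambda>a b. 0)"
    and cD: "cD (comps A c) (comps \<phi> c) i ?x = (\<lambda>a b. 0)"
    if v: "\<And>i. vanishes_off \<A> K (\<phi> i)" for \<phi> i
  proof -
    have comp: "comps \<phi> c i y u = 0" if "y \<in> ?V" for i y u
      unfolding comp1_def using that by (intro vanishes_offD[OF v c]) auto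
    have "hderiv (\<lambda>y. comps \<phi> c i y u) ?x = hderiv (\<lambda>y. 0) ?x" for i u
      by (rule hderiv_cong[OF o x(2)]) (rule comp)
    then have "d1 (comps \<phi> c i) ?x a b = 0" for i a b
      using chart_img_half_space[OF c x(1)] by (simp add: d1_def)
    then show "cr11 (\<lambda>i. comps \<phi> c i ?x) (\<lambda>i. comps e c i ?x) i = (\<lambda>a b. 0)"
      "cD (comps A c) (comps \<phi> c) i ?x = (\<lambda>a b. 0)"
      using comp[OF x(2)] by (simp_all add: cD_def fun_eq_iff w11_def eps_def)
  qed
  show "variation \<delta>e \<delta>A c ?x vs = 0"
    unfolding variation_comp[OF c x(1) \<delta>e \<delta>A] cr[of \<delta>e, OF e0] cr[of \<delta>A, OF A0] cD[of \<delta>e, OF e0] cD[of \<delta>A, OF A0]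
    by (simp add: w22_def)
qed

lemma variation_integral_chart:
  assumes c: "c \<in> \<A>" and K: "compact K" "K \<subseteq> chart_dom c"
    and \<delta>e: "\<And>i. smooth_form \<A> 1 (\<delta>e i)" and \<delta>A: "\<And>i. smooth_form \<A> 1 (\<delta>A i)"
    and e0: "\<And>i. vanishes_off \<A> K (\<delta>e i)" and A0: "\<And>i. vanishes_off \<A> K (\<delta>A i)"
  shows "form_integral \<A> (variation \<delta>e \<delta>A) = (\<Sum>i\<in>UNIV. integral (chart_img c) (var (P i) (X i) (\<delta>e i) c))
    + (\<Sum>i\<in>UNIV. integral (chart_img c) (var (R i) (Y i) (\<delta>A i) c))"
proof -
  have e: "var (P i) (X i) (\<delta>e i) c integrable_on chart_img c" for i
    by (rule var_integral(2)[OF c smooth_form_P smooth_form_X \<delta>e K e0])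
  have A: "var (R i) (Y i) (\<delta>A i) c integrable_on chart_img c" for i
    by (rule var_integral(2)[OF c smooth_form_R smooth_form_Y \<delta>A K A0])
  have "form_integral \<A> (variation \<delta>e \<delta>A) = integral (chart_img c) (\<lambda>x. variation \<delta>e \<delta>A c x frame)"
    by (rule form_integral_chart[OF smooth_form_variation[of \<delta>e \<delta>A, OF \<delta>e \<delta>A]
          variation_vanishes_off[OF K(1) \<delta>e \<delta>A e0 A0] K c])
  also have "\<dots> = integral (chart_img c) (\<lambda>x. (\<Sum>i\<in>UNIV. var (P i) (X i) (\<delta>e i) c x) + (\<Sum>i\<in>UNIV. var (R i) (Y i) (\<delta>A i) c x))"
    by (rule integral_cong) (rule variation_eq_var[OF c _ \<delta>e \<delta>A])
  also have "\<dots> = (\<Sum>i\<in>UNIV. integral (chart_img c) (var (P i) (X i) (\<delta>e i) c))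
    + (\<Sum>i\<in>UNIV. integral (chart_img c) (var (R i) (Y i) (\<delta>A i) c))"
    by (subst integral_add) (auto intro!: integrable_sum e A simp: integral_sum e A)
  finally show ?thesis .
qed

lemma form_integral_first_variation:
  assumes "\<And>i. smooth_form \<A> 1 (\<delta>e i)" "\<And>i. smooth_form \<A> 1 (\<delta>A i)"
  shows "form_integral \<A> (first_variation L e A \<delta>e \<delta>A) = form_integral \<A> (variation \<delta>e \<delta>A)"
  by (rule form_integral_cong) (rule first_variation_eq[OF _ _ assms])

definition field_equations :: bool where
  "field_equations \<longleftrightarrow> (\<forall>i. (\<forall>c\<in>\<A>. \<forall>x\<in>chart_img c. P i c x = (\<lambda>vs. 0) \<and> R i c x = (\<lambda>vs. 0))
     \<and> boundary_zero (X i) \<and> boundary_zero (Y i))"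

text \<open>A partition of unity splits an arbitrary variation into variations supported in charts.\<close>

lemma stationary_if:
  assumes fe: field_equations
  shows "stationary_point \<A> L e A"
  unfolding stationary_point_def
proof (intro allI impI, elim conjE)
  fix \<delta>e \<delta>A :: "'m so3_form"
  assume de: "\<forall>i. smooth_form \<A> 1 (\<delta>e i) \<and> compactly_supported \<A> (\<delta>e i)"
    and dA: "\<forall>i. smooth_form \<A> 1 (\<delta>A i) \<and> compactly_supported \<A> (\<delta>A i)"
  then have \<delta>e: "smooth_form \<A> 1 (\<delta>e i)" and \<delta>A: "smooth_form \<A> 1 (\<delta>A i)" for i by auto
  from de obtain Ke where Ke: "\<And>i. compact (Ke i)" "\<And>i. vanishes_off \<A> (Ke i) (\<delta>e i)"
    unfolding compactly_supported_def by metis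
  from dA obtain KA where KA: "\<And>i. compact (KA i)" "\<And>i. vanishes_off \<A> (KA i) (\<delta>A i)"
    unfolding compactly_supported_def by metis
  \<comment> \<open>Compact support is given for each of the six components separately; one compact
    set is needed for all.\<close>
  define K where "K = (\<Union>i\<in>UNIV. Ke i) \<union> (\<Union>i\<in>UNIV. KA i)"
  have K: "compact K" unfolding K_def using Ke KA by (intro compact_Un compact_UN) auto
  have eK: "vanishes_off \<A> K (\<delta>e i)" and AK: "vanishes_off \<A> K (\<delta>A i)" for i
    by (rule vanishes_off_mono[OF Ke(2)[of i]] vanishes_off_mono[OF KA(2)[of i]]; auto simp: K_def)+
  have "\<forall>p. \<exists>c. c \<in> \<A> \<and> p \<in> chart_dom c" using chart_exists by blast
  then obtain cc where cc: "\<forall>p. cc p \<in> \<A> \<and> p \<in> chart_dom (cc p)" by (rule choice[THEN exE])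
  obtain n c \<rho> where pu: "partition_of_unity \<A> K n c \<rho>"
    by (rule partition_of_unity_exists[OF K spec[OF cc]], rule that)
  define part where "part \<phi> m i = (\<lambda>c x vs. \<rho> m (chart_inv c x) * \<phi> i c x vs)" for \<phi> :: "'m so3_form" and m i
  have sm: "smooth_form \<A> 1 (part \<phi> m i)" if "m < n" "\<And>i. smooth_form \<A> 1 (\<phi> i)" for m \<phi> i
    unfolding part_def by (rule smooth_form_smooth_function[OF partition_of_unityD(2)[OF pu that(1)] that(2)])
  have partK: "vanishes_off \<A> K (part \<phi> m i)" if "\<And>i. vanishes_off \<A> K (\<phi> i)" for m \<phi> i
    using that[of i] unfolding vanishes_off_def part_def by simp
  have sum: "\<phi> i d y vs = (\<Sum>m\<in>{..<n}. part \<phi> m i d y vs)"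
    if "\<And>i. vanishes_off \<A> K (\<phi> i)" "d \<in> \<A>" "y \<in> chart_img d" for \<phi> i d y vs
  proof (cases "chart_inv d y \<in> K")
    case True
    then have "(\<Sum>m<n. \<rho> m (chart_inv d y)) = 1" using pu by (simp add: partition_of_unity_def)
    then show ?thesis by (simp add: part_def flip: sum_distrib_right)
  next
    case False
    then show ?thesis using vanishes_offD[OF that(1,2,3)] by (simp add: part_def)
  qed
  have "form_integral \<A> (variation \<delta>e \<delta>A) = form_integral \<A> (\<lambda>d x vs. \<Sum>m\<in>{..<n}. variation (part \<delta>e m) (part \<delta>A m) d x vs)"
    by (rule form_integral_cong)
      (rule variation_sum[OF _ _ \<delta>e \<delta>A], auto intro: sm \<delta>e \<delta>A sum eK AK simp del: One_nat_def)
  also have "\<dots> = (\<Sum>m\<in>{..<n}. form_integral \<A> (variation (part \<delta>e m) (part \<delta>A m)))"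
  proof (rule form_integral_sum[OF K])
    fix m assume "m \<in> {..<n}"
    then have m: "m < n" by simp
    show "smooth_form \<A> 4 (variation (part \<delta>e m) (part \<delta>A m))"
      by (rule smooth_form_variation) (intro sm[OF m] \<delta>e \<delta>A)+
    show "vanishes_off \<A> K (variation (part \<delta>e m) (part \<delta>A m))"
      by (rule variation_vanishes_off[OF K]) (intro sm[OF m] \<delta>e \<delta>A partK eK AK)+
  qed simp
  also have "\<dots> = 0"
  proof (rule sum.neutral, rule ballI)
    fix m assume "m \<in> {..<n}"
    then have m: "m < n" by simp
    note cm = partition_of_unityD(1)[OF pu m]
    obtain C where C: "compact C" "C \<subseteq> chart_dom (c m)" "\<forall>p. p \<notin> C \<longrightarrow> \<rho> m p = 0"
      using partition_of_unityD(4)[OF pu m] by blast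
    \<comment> \<open>The weight \<rho> m confines each piece to a compact subset of one chart
      domain.\<close>
    have v: "vanishes_off \<A> C (part \<phi> m i)" for \<phi> i
      unfolding vanishes_off_def part_def using C(3) chart_inv_chart by auto
    have "integral (chart_img (c m)) (var (P i) (X i) (part \<delta>e m i) (c m)) = 0" for i
      by (rule var_integral_eq_0[OF cm smooth_form_P smooth_form_X sm[OF m \<delta>e] C(1,2) v])
        (use fe cm in \<open>auto simp: field_equations_def\<close>)
    moreover have "integral (chart_img (c m)) (var (R i) (Y i) (part \<delta>A m i) (c m)) = 0" for i
      by (rule var_integral_eq_0[OF cm smooth_form_R smooth_form_Y sm[OF m \<delta>A] C(1,2) v])
        (use fe cm in \<open>auto simp: field_equations_def\<close>)
    ultimately show "form_integral \<A> (variation (part \<delta>e m) (part \<delta>A m)) = 0"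
      by (subst variation_integral_chart[OF cm C(1,2)]) (auto intro: sm[OF m] \<delta>e \<delta>A v simp del: One_nat_def)
  qed
  finally show "form_integral \<A> (first_variation L e A \<delta>e \<delta>A) = 0"
    by (simp only: form_integral_first_variation[OF \<delta>e \<delta>A])
qed

lemma var_zero: "c \<in> \<A> \<Longrightarrow> x \<in> chart_img c \<Longrightarrow> var Q Z (\<lambda>c x vs. 0) c x = 0"
  using chart_img_half_space by (simp add: var_def wedge_def alt_wedge_def ext_deriv_def)

lemma stationary_only_if:
  assumes st: "stationary_point \<A> L e A"
  shows field_equations
proof -
  have stD: "form_integral \<A> (variation \<delta>e \<delta>A) = 0"
    if "\<And>i. smooth_form \<A> 1 (\<delta>e i)" "\<And>i. smooth_form \<A> 1 (\<delta>A i)"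
      "\<And>i. compactly_supported \<A> (\<delta>e i)" "\<And>i. compactly_supported \<A> (\<delta>A i)" for \<delta>e \<delta>A
  proof -
    have "form_integral \<A> (first_variation L e A \<delta>e \<delta>A) = 0"
      using st that unfolding stationary_point_def by blast
    then show ?thesis by (simp only: form_integral_first_variation[of \<delta>e \<delta>A, OF that(1,2)])
  qed
  have *: "(integral (chart_img c) (var (P m) (X m) (test c \<beta> a) c) = 0) \<and> (integral (chart_img c) (var (R m) (Y m) (test c \<beta> a) c) = 0)"
    if c: "c \<in> \<A>" and \<beta>: "smooth_on (chart_img c) \<beta>"
      and K: "compact K" "K \<subseteq> chart_img c" "\<And>x. x \<in> chart_img c \<Longrightarrow> x \<notin> K \<Longrightarrow> \<beta> x = 0" for c \<beta> K a m
  proof -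
    \<comment> \<open>Only component m of one field is varied: the pair (\<open>?t\<close>,
      \<open>?z\<close>) tests the equations of e, the pair (\<open>?z\<close>, \<open>?t\<close>)
      those of A.\<close>
    let ?z = "\<lambda>i::3. (\<lambda>c x vs. 0) :: ('m, 4) form"
    let ?t = "\<lambda>i. if i = m then test c \<beta> a else (\<lambda>c x vs. 0)"
    let ?K = "chart_inv c ` K"
    note Kc = compact_chart_inv_image[OF c K(1,2)]
    have s: "smooth_form \<A> 1 (?t i)" "smooth_form \<A> 1 (?z i)" for i
      using smooth_form_test[OF c \<beta> K] smooth_form_zero by auto
    have v: "vanishes_off \<A> ?K (?t i)" "vanishes_off \<A> ?K (?z i)" for i
      using test_vanishes_off[OF c \<beta> K] by (auto simp: vanishes_off_def)
    have cs: "compactly_supported \<A> (?t i)" "compactly_supported \<A> (?z i)" for i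
      unfolding compactly_supported_def using v Kc(1) by blast+
    have z: "integral (chart_img c) (var Q Z (\<lambda>c x vs. 0) c) = 0" for Q Z
    proof -
      have "integral (chart_img c) (var Q Z (\<lambda>c x vs. 0) c) = integral (chart_img c) (\<lambda>x. 0)"
        by (rule integral_cong) (rule var_zero[OF c])
      then show ?thesis by simp
    qed
    have one: "(\<Sum>i\<in>UNIV. integral (chart_img c) (var (Q i) (Z i) (?t i) c)) = integral (chart_img c) (var (Q m) (Z m) (test c \<beta> a) c)" for Q Z
    proof -
      have "integral (chart_img c) (var (Q i) (Z i) (?t i) c)
          = (if i = m then integral (chart_img c) (var (Q m) (Z m) (test c \<beta> a) c) else 0)" for i
        by (simp add: z)
      then show ?thesis by simp
    qed
    have "form_integral \<A> (variation ?t ?z) = 0" "form_integral \<A> (variation ?z ?t) = 0"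
      by (rule stD; rule s cs)+
    then show ?thesis
      unfolding variation_integral_chart[OF c Kc s v] variation_integral_chart[OF c Kc s(2,1) v(2,1)] one
      by (simp add: z)
  qed
  have P0: "P i c x vs = 0" and R0: "R i c x vs = 0" if "c \<in> \<A>" "x \<in> chart_img c" for i c x vs
    by (rule fundamental_lemma(1)[OF that(1) smooth_form_P smooth_form_X _ that(2)],
        rule conjunct1[OF *[OF that(1)]], assumption+)
      (rule fundamental_lemma(1)[OF that(1) smooth_form_R smooth_form_Y _ that(2)],
        rule conjunct2[OF *[OF that(1)]], assumption+)
  have X0: "X i c x vs = 0" and Y0: "Y i c x vs = 0"
    if "c \<in> \<A>" "x \<in> chart_img c" "x $ 1 = 0" "\<forall>i. vs i $ 1 = 0" for i c x vs
    by (rule fundamental_lemma(2)[OF that(1) smooth_form_P smooth_form_X _ that(2,3) spec[OF that(4)] spec[OF that(4)]],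
        rule conjunct1[OF *[OF that(1)]], assumption+)
      (rule fundamental_lemma(2)[OF that(1) smooth_form_R smooth_form_Y _ that(2,3) spec[OF that(4)] spec[OF that(4)]],
        rule conjunct2[OF *[OF that(1)]], assumption+)
  show ?thesis
    unfolding field_equations_def boundary_zero_def
    using P0 R0 X0 Y0 by (simp add: fun_eq_iff)
qed

lemma stationary_iff: "stationary_point \<A> L e A \<longleftrightarrow> field_equations"
  using stationary_if stationary_only_if by blast

lemma field_equations_iff:
  "field_equations \<longleftrightarrow> bulk_equations \<A> \<alpha>1 \<alpha>2 e A \<and> boundary_equations \<A> \<alpha>1 \<alpha>2 \<alpha>3 \<alpha>4 \<alpha>5 e A"
proof -
  have "bulk_equations \<A> \<alpha>1 \<alpha>2 e A \<longleftrightarrow> (\<forall>i. \<forall>c\<in>\<A>. \<forall>x\<in>chart_img c. P i c x = (\<lambda>vs. 0) \<and> R i c x = (\<lambda>vs. 0))"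
  proof -
    have "2 * (\<alpha>1 - \<alpha>2) * r = 0 \<longleftrightarrow> (\<alpha>1 - \<alpha>2) * r = 0" for r by simp
    then show ?thesis
      unfolding bulk_equations_def eq_on_M_def zero_form_def Let_def P_def R_def fun_eq_iff by (simp only:) blast
  qed
  moreover have "boundary_equations \<A> \<alpha>1 \<alpha>2 \<alpha>3 \<alpha>4 \<alpha>5 e A \<longleftrightarrow> (\<forall>i. boundary_zero (X i) \<and> boundary_zero (Y i))"
    unfolding boundary_equations_def eq_on_boundary_zero Let_def X_def Y_def ..
  ultimately show ?thesis unfolding field_equations_def by blast
qed

end

section \<open>The boundary equations\<close>

text \<open>For a fixed chart, point and choice of vectors the boundary equations are two linear
  equations for the numbers D and F, with determinant 4 * \<alpha>2 * \<alpha>3 -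
  \<alpha>5^2.\<close>

lemma boundary_linear_system:
  fixes D E F \<alpha>1 \<alpha>2 \<alpha>3 \<alpha>4 \<alpha>5 :: real
  assumes "4 * \<alpha>2 * \<alpha>3 - \<alpha>5^2 \<noteq> 0"
  shows "2 * \<alpha>2 * D + \<alpha>4 * E + \<alpha>5 * F = 0 \<and> \<alpha>1 * E + 2 * \<alpha>3 * F + \<alpha>5 * D = 0 \<longleftrightarrow>
    F = - ((2 * \<alpha>1 * \<alpha>2 - \<alpha>4 * \<alpha>5) / (4 * \<alpha>2 * \<alpha>3 - \<alpha>5^2)) * E \<and>
    D = - ((2 * \<alpha>3 * \<alpha>4 - \<alpha>1 * \<alpha>5) / (4 * \<alpha>2 * \<alpha>3 - \<alpha>5^2)) * E"
    (is "?a = 0 \<and> ?b = 0 \<longleftrightarrow> ?f \<and> ?d")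
proof -
  let ?\<Delta> = "4 * \<alpha>2 * \<alpha>3 - \<alpha>5^2"
  \<comment> \<open>Cramer's rule with cleared denominators: p and q are combinations of the two
    equations, and conversely the determinant times either equation is a combination of p and
    q.\<close>
  define p q where "p = ?\<Delta> * F + (2 * \<alpha>1 * \<alpha>2 - \<alpha>4 * \<alpha>5) * E" and "q = ?\<Delta> * D + (2 * \<alpha>3 * \<alpha>4 - \<alpha>1 * \<alpha>5) * E"
  have "?f \<longleftrightarrow> p = 0" "?d \<longleftrightarrow> q = 0"
    using assms unfolding p_def q_def by (auto simp: field_simps eq_neg_iff_add_eq_0)
  moreover have "p = 2 * \<alpha>2 * ?b - \<alpha>5 * ?a" "q = 2 * \<alpha>3 * ?a - \<alpha>5 * ?b"
    unfolding p_def q_def by (simp_all add: algebra_simps power2_eq_square)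
  moreover have "?\<Delta> * ?a = 2 * \<alpha>2 * q + \<alpha>5 * p" "?\<Delta> * ?b = 2 * \<alpha>3 * p + \<alpha>5 * q"
    unfolding p_def q_def by (simp_all add: algebra_simps power2_eq_square)
  ultimately show ?thesis using assms by (metis add.right_neutral diff_0_right mult_eq_0_iff mult_zero_right)
qed

lemma boundary_equations_solved:
  assumes "4 * \<alpha>2 * \<alpha>3 - \<alpha>5^2 \<noteq> 0"
  shows "boundary_equations \<A> \<alpha>1 \<alpha>2 \<alpha>3 \<alpha>4 \<alpha>5 e A \<longleftrightarrow>
    (\<forall>i. eq_on_boundary \<A> (bd_pullback (curvature A i))
           (bd_pullback (\<lambda>c x vs. - ((2 * \<alpha>1 * \<alpha>2 - \<alpha>4 * \<alpha>5) / (4 * \<alpha>2 * \<alpha>3 - \<alpha>5^2)) * cross 1 1 e e i c x vs)) \<and>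
         eq_on_boundary \<A> (bd_pullback (cov_deriv A 1 e i))
           (bd_pullback (\<lambda>c x vs. - ((2 * \<alpha>3 * \<alpha>4 - \<alpha>1 * \<alpha>5) / (4 * \<alpha>2 * \<alpha>3 - \<alpha>5^2)) * cross 1 1 e e i c x vs)))"
proof -
  have conj: "eq_on_boundary \<A> \<omega> \<eta> \<and> eq_on_boundary \<A> \<omega>' \<eta>' \<longleftrightarrow>
      (\<forall>c\<in>\<A>. \<forall>y. bd_incl y \<in> chart_img c \<longrightarrow> (\<forall>vs. \<omega> c y vs = \<eta> c y vs \<and> \<omega>' c y vs = \<eta>' c y vs))" for \<omega> \<eta> \<omega>' \<eta>' :: "('a, 3) form"
    unfolding eq_on_boundary_def fun_eq_iff by blast
  show ?thesis
    unfolding boundary_equations_def Let_def conj bd_pullback_def pullback_def zero_form_def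
      boundary_linear_system[OF assms] ..
qed

lemma gr3_equations_iff:
  "gr3_equations \<A> \<Lambda> e A \<longleftrightarrow>
    (\<forall>i. eq_on_boundary \<A> (bd_pullback (curvature A i)) (bd_pullback (\<lambda>c x vs. - (\<Lambda> / 2) * cross 1 1 e e i c x vs)) \<and>
         eq_on_boundary \<A> (bd_pullback (cov_deriv A 1 e i)) (bd_pullback (\<lambda>c x vs. 0)))"
proof -
  have "F + \<Lambda> / 2 * E = 0 \<longleftrightarrow> F = - (\<Lambda> / 2) * E" for F E :: real by auto
  then show ?thesis
    unfolding gr3_equations_def eq_on_boundary_def bd_pullback_def pullback_def zero_form_def fun_eq_iff by simp blast
qed

lemma cosmological_constant_exists:
  fixes \<Lambda> :: real
  shows "\<exists>\<beta>1 \<beta>2 \<beta>3 \<beta>4 \<beta>5 :: real. \<beta>1 \<noteq> \<beta>2 \<and> 4 * \<beta>2 * \<beta>3 - \<beta>5^2 \<noteq> 0 \<and> 2 * \<beta>3 * \<beta>4 - \<beta>1 * \<beta>5 = 0 \<and>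
    \<Lambda> = (4 * \<beta>1 * \<beta>2 - 2 * \<beta>4 * \<beta>5) / (4 * \<beta>2 * \<beta>3 - \<beta>5^2)"
proof -
  \<comment> \<open>With \<beta>3 = 1 and \<beta>4 = \<beta>5 = 0 the quotient reduces to \<beta>1,
    so \<beta>1 = \<Lambda>. The value \<bar>\<Lambda>\<bar> + 1 for \<beta>2 is nonzero and differs
    from \<Lambda>.\<close>
  have "\<Lambda> \<noteq> \<bar>\<Lambda>\<bar> + 1" "\<bar>\<Lambda>\<bar> + 1 \<noteq> 0" by linarith+
  then show ?thesis by (intro exI[of _ \<Lambda>] exI[of _ "\<bar>\<Lambda>\<bar> + 1"] exI[of _ 1] exI[of _ 0]) (simp add: field_simps)
qed

theorem mainTheorem2:
  fixes \<A> :: "'m::{t2_space, second_countable_topology} chart set"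
    and \<alpha>1 \<alpha>2 \<alpha>3 \<alpha>4 \<alpha>5 :: real
    and e A :: "'m so3_form"
  assumes "oriented_smooth_manifold \<A>"
    and "\<And>i. smooth_form \<A> 1 (e i)"
    and "\<And>i. smooth_form \<A> 1 (A i)"
  shows
    "(stationary_point \<A> (lagrangian \<alpha>1 \<alpha>2 \<alpha>3 \<alpha>4 \<alpha>5) e A \<longleftrightarrow>
        bulk_equations \<A> \<alpha>1 \<alpha>2 e A \<and> boundary_equations \<A> \<alpha>1 \<alpha>2 \<alpha>3 \<alpha>4 \<alpha>5 e A)
     \<and>
     (4 * \<alpha>2 * \<alpha>3 - \<alpha>5^2 \<noteq> 0 \<longrightarrow>
        (boundary_equations \<A> \<alpha>1 \<alpha>2 \<alpha>3 \<alpha>4 \<alpha>5 e A \<longleftrightarrow>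
          (\<forall>i. eq_on_boundary \<A> (bd_pullback (curvature A i))
                 (bd_pullback (\<lambda>c x vs. - ((2 * \<alpha>1 * \<alpha>2 - \<alpha>4 * \<alpha>5) / (4 * \<alpha>2 * \<alpha>3 - \<alpha>5^2))
                    * cross 1 1 e e i c x vs)) \<and>
               eq_on_boundary \<A> (bd_pullback (cov_deriv A 1 e i))
                 (bd_pullback (\<lambda>c x vs. - ((2 * \<alpha>3 * \<alpha>4 - \<alpha>1 * \<alpha>5) / (4 * \<alpha>2 * \<alpha>3 - \<alpha>5^2))
                    * cross 1 1 e e i c x vs)))))
     \<and>
     (4 * \<alpha>2 * \<alpha>3 - \<alpha>5^2 \<noteq> 0 \<and> 2 * \<alpha>3 * \<alpha>4 - \<alpha>1 * \<alpha>5 = 0 \<longrightarrow>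
        (boundary_equations \<A> \<alpha>1 \<alpha>2 \<alpha>3 \<alpha>4 \<alpha>5 e A \<longleftrightarrow>
          gr3_equations \<A> ((4 * \<alpha>1 * \<alpha>2 - 2 * \<alpha>4 * \<alpha>5) / (4 * \<alpha>2 * \<alpha>3 - \<alpha>5^2)) e A))
     \<and>
     (\<forall>\<Lambda>::real. \<exists>\<beta>1 \<beta>2 \<beta>3 \<beta>4 \<beta>5 :: real.
        \<beta>1 \<noteq> \<beta>2 \<and> 4 * \<beta>2 * \<beta>3 - \<beta>5^2 \<noteq> 0 \<and> 2 * \<beta>3 * \<beta>4 - \<beta>1 * \<beta>5 = 0 \<and>
        \<Lambda> = (4 * \<beta>1 * \<beta>2 - 2 * \<beta>4 * \<beta>5) / (4 * \<beta>2 * \<beta>3 - \<beta>5^2))"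
proof -
  interpret gauge_fields \<A> e A \<alpha>1 \<alpha>2 \<alpha>3 \<alpha>4 \<alpha>5
    by unfold_locales (fact assms)+
  have gr3: "boundary_equations \<A> \<alpha>1 \<alpha>2 \<alpha>3 \<alpha>4 \<alpha>5 e A \<longleftrightarrow>
      gr3_equations \<A> ((4 * \<alpha>1 * \<alpha>2 - 2 * \<alpha>4 * \<alpha>5) / (4 * \<alpha>2 * \<alpha>3 - \<alpha>5^2)) e A"
    if "4 * \<alpha>2 * \<alpha>3 - \<alpha>5^2 \<noteq> 0" "2 * \<alpha>3 * \<alpha>4 - \<alpha>1 * \<alpha>5 = 0"
  proof -
    \<comment> \<open>The factor 2 in the numerator offsets the convention by which \<Lambda> / 2
      stands in the field equation.\<close>
    have num: "4 * \<alpha>1 * \<alpha>2 - 2 * \<alpha>4 * \<alpha>5 = 2 * (2 * \<alpha>1 * \<alpha>2 - \<alpha>4 * \<alpha>5)" by simp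
    have half: "2 * r / s / 2 = r / s" for r s :: real by simp
    show ?thesis
      unfolding boundary_equations_solved[OF that(1)] gr3_equations_iff that(2) num half by simp
  qed
  show ?thesis
    using stationary_iff field_equations_iff boundary_equations_solved gr3 cosmological_constant_exists
    by (intro conjI impI allI) simp_all
qed

end
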